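(* Let $\hat f_h^{\mathfrak n}=X^\top U^{\mathfrak n}S^{\mathfrak n}(E^{\mathfrak n})^\top Y$ be given and let $U^{\mathfrak n+1},E^{\mathfrak n+1},V_0^{\mathfrak n+1}$ be generated by one step of the DLR-DG scheme with time step $\Delta t>0$. Let $f_S^{\mathrm{eq},\mathfrak n+1}\in V_0^{\mathfrak n+1}$ be the orthogonal projection of $f_h^{\mathrm{eq}}$ onto $V_0^{\mathfrak n+1}$ with respect to $(\cdot,\cdot;\varepsilon^2)_\Omega$. Assume there exist constants $\beta\in(0,1]$ and $\alpha>0$ such that $\|P_{U^{\mathfrak n}}U^{\mathrm{eq}}\|\ge\beta$ and $\|(E^{\mathrm{eq}})^\top A_\chi P^\chi_{E^{\mathfrak n}}\|_{A_{\boldsymbol 1}}\ge\alpha$. Then for any $\delta>0$, setting $$\Delta t_0=\frac{\sqrt2}{\delta}\max\left\{\frac{r^{1/2}}{\beta\chi_{\min}},\ \frac{r^{1/2}\chi_{\max}^{1/2}}{\alpha\chi_{\min}^{3/2}}\right\},$$ whenever $\Delta t\ge\Delta t_0$, $$\|\varepsilon(f_S^{\mathrm{eq},\mathfrak n+1}-f_h^{\mathrm{eq}})\|_{L^2(\Omega)}\le\delta\,\|\varepsilon(\hat f_h^{\mathfrak n}-f_h^{\mathrm{eq}})\|_{L^2(\Omega)}.$$ Moreover, if $\hat f_h^{\mathfrak n}=f_h^{\mathrm{eq}}$, then for any $\Delta t>0$, $f_S^{\mathrm{eq},\mathfrak n+1}=f_h^{\mathrm{eq}}$.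
   Context: Let $\varepsilon_{\max}>0$, $\Omega=\Omega_\mu\times\Omega_\varepsilon$ with $\Omega_\mu=[-1,1]\ni\mu$, $\Omega_\varepsilon=[0,\varepsilon_{\max}]\ni\varepsilon$. The weighted inner product is $(v,w;\varepsilon^2)_\Omega=\int_0^{\varepsilon_{\max}}\int_{-1}^1 vw\,\varepsilon^2\,d\mu\,d\varepsilon$, and $\|\varepsilon w\|_{L^2(\Omega)}=(w,w;\varepsilon^2)_\Omega^{1/2}$. The emissivity $\eta=\eta(\varepsilon)>0$ (square integrable with respect to $\varepsilon^2d\varepsilon$) and the opacity $\chi=\chi(\varepsilon)$ are given, with constants $0<\chi_{\min}\le\chi\le\chi_{\max}$. Set $\mathcal A(f,w)=(\eta,w;\varepsilon^2)_\Omega-(\chi f,w;\varepsilon^2)_\Omega$. Partition $\Omega_\mu$ and $\Omega_\varepsilon$ into $N_\mu$ and $N_\varepsilon$ intervals; $V_{\mu,h}$, $V_{\varepsilon,h}$ are the spaces of (discontinuous) piecewise polynomials of degree at most $k$ on these partitions, and $V_h=V_{\mu,h}\otimes V_{\varepsilon,h}$. Let $m=(k+1)N_\mu$, $n=(k+1)N_\varepsilon$, $1\le r\le\min\{m,n\}$. Let $\{x_i(\mu)\}_{i=1}^m$, $\{y_j(\varepsilon)\}_{j=1}^n$ be the bases of $V_{\mu,h}$, $V_{\varepsilon,h}$ consisting of Legendre polynomials supported on single cells and orthonormal in the unweighted $L^2$ inner product of the cell; $X=[x_1,\dots,x_m]^\top$, $Y=[y_1,\dots,y_n]^\top$. $A_{\boldsymbol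 1}=[\int_{\Omega_\varepsilon}y_iy_j\varepsilon^2d\varepsilon]$, $A_\chi=[\int_{\Omega_\varepsilon}\chi y_iy_j\varepsilon^2d\varepsilon]$ are symmetric positive definite $n\times n$ matrices; $L_0=[\int_{-1}^1x_i\,d\mu]_i\in\mathbb R^{m\times1}$, $L_\eta=[\int_{\Omega_\varepsilon}\eta y_j\varepsilon^2d\varepsilon]_j\in\mathbb R^{n\times1}$. Norms: $\|\cdot\|$ is the Euclidean norm of column vectors; for $Z\in\mathbb R^{\ell\times n}$ and symmetric positive definite $M\in\mathbb R^{n\times n}$, $\|Z\|_M^2=\mathrm{tr}(ZMZ^\top)$. Equilibrium: $f_h^{\mathrm{eq}}\in V_h$ is the unique solution of $\mathcal A(f_h^{\mathrm{eq}},w_h)=0$ for all $w_h\in V_h$; its coefficient matrix is $F^{\mathrm{eq}}=L_0L_\eta^\top A_\chi^{-1}=U^{\mathrm{eq}}S^{\mathrm{eq}}(E^{\mathrm{eq}})^\top$ (i.e. $f_h^{\mathrm{eq}}=X^\top F^{\mathrm{eq}}Y$), where $U^{\mathrm{eq}}=L_0/\|L_0\|$, $E^{\mathrm{eq}}=A_\chi^{-1}L_\eta/\|L_\eta^\top A_\chi^{-1}\|_{A_{\boldsymbol 1}}$, $S^{\mathrm{eq}}=\|L_0\|\,\|L_\eta^\top A_\chi^{-1}\|_{A_{\boldsymbol 1}}$. Projections: $P_U=UU^\top$ for $U^\top U=I_r$; $P_E=EE^\top$ and $P_E^\chi=E(E^\top A_\chi E)^{-1}E^\top$ for $E^\top A_{\boldsymbol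 1}E=I_r$. One step of the DLR-DG scheme. $\hat f_h^{\mathfrak n}=X^\top U^{\mathfrak n}S^{\mathfrak n}(E^{\mathfrak n})^\top Y$ with $U^{\mathfrak n}\in\mathbb R^{m\times r}$, $S^{\mathfrak n}\in\mathbb R^{r\times r}$, $E^{\mathfrak n}\in\mathbb R^{n\times r}$, $(U^{\mathfrak n})^\top U^{\mathfrak n}=I_r=(E^{\mathfrak n})^\top A_{\boldsymbol 1}E^{\mathfrak n}$. With $V_1^{\mathfrak n}=\{X^\top\mathbf K(E^{\mathfrak n})^\top Y:\mathbf K\in\mathbb R^{m\times r}\}$, $V_2^{\mathfrak n}=\{X^\top U^{\mathfrak n}\mathbf L^\top Y:\mathbf L\in\mathbb R^{n\times r}\}$, find $f_{\mathbf K}=X^\top\mathbf K^{\mathfrak n+1}(E^{\mathfrak n})^\top Y\in V_1^{\mathfrak n}$ and $f_{\mathbf L}=X^\top U^{\mathfrak n}(\mathbf L^{\mathfrak n+1})^\top Y\in V_2^{\mathfrak n}$ with $\frac1{\Delta t}(f_{\mathbf K}-\hat f_h^{\mathfrak n},w_1;\varepsilon^2)_\Omega=\mathcal A(f_{\mathbf K},w_1)$ for all $w_1\in V_1^{\mathfrak n}$ and $\frac1{\Delta t}(f_{\mathbf L}-\hat f_h^{\mathfrak n},w_2;\varepsilon^2)_\Omega=\mathcal A(f_{\mathbf L},w_2)$ for all $w_2\in V_2^{\mathfrak n}$ (unique solutions); factor $\mathbf K^{\mathfrak n+1}=U^{\mathfrak n+1}R_{\mathbf K}$, $\mathbf L^{\mathfrak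 n+1}=E^{\mathfrak n+1}R_{\mathbf L}$ with $(U^{\mathfrak n+1})^\top U^{\mathfrak n+1}=I_r=(E^{\mathfrak n+1})^\top A_{\boldsymbol 1}E^{\mathfrak n+1}$ (QR and weighted QR; any choice); set $V_0^{\mathfrak n+1}=\{X^\top U^{\mathfrak n+1}S(E^{\mathfrak n+1})^\top Y:S\in\mathbb R^{r\times r}\}$. *)

theory Defs
  imports
    "HOL-Analysis.Analysis"
    "HOL-Computational_Algebra.Polynomial"
    "Jordan_Normal_Form.Gauss_Jordan_Elimination"
begin

definition is_partition :: "real \<Rightarrow> real \<Rightarrow> nat \<Rightarrow> (nat \<Rightarrow> real) \<Rightarrow> bool" where
  "is_partition a b N t \<longleftrightarrow> t 0 = a \<and> t N = b \<and> (\<forall>j<N. t j < t (Suc j))"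

text \<open>
  Discontinuous piecewise polynomials have no distinguished value at interior nodes.  To get
  genuine functions, cells are taken half-open (the last one closed), so that they form a
  set-theoretic partition of \<open>[a, b]\<close>, and all functions are extended by \<open>0\<close> outside \<open>[a, b]\<close>.
  With this convention two piecewise polynomials agree almost everywhere on the domain iff they
  are equal as functions.
\<close>

definition cell :: "nat \<Rightarrow> (nat \<Rightarrow> real) \<Rightarrow> nat \<Rightarrow> real set" where
  "cell N t j = (if Suc j = N then {t j .. t (Suc j)} else {t j ..< t (Suc j)})"

definition dg_space :: "nat \<Rightarrow> nat \<Rightarrow> (nat \<Rightarrow> real) \<Rightarrow> (real \<Rightarrow> real) set" where
  "dg_space k N t = {v. (\<forall>x. x \<notin> {t 0 .. t N} \<longrightarrow> v x = 0) \<and>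
     (\<forall>j<N. \<exists>p::real poly. degree p \<le> k \<and> (\<forall>x\<in>cell N t j. v x = poly p x))}"

definition tensor_space ::
    "(real \<Rightarrow> real) set \<Rightarrow> (real \<Rightarrow> real) set \<Rightarrow> (real \<Rightarrow> real \<Rightarrow> real) set" where
  "tensor_space V W = {f. \<exists>p::nat. \<exists>v w. (\<forall>i<p. v i \<in> V \<and> w i \<in> W) \<and>
     f = (\<lambda>\<mu> \<epsilon>. \<Sum>i<p. v i \<mu> * w i \<epsilon>)}"

text \<open>Legendre polynomials on \<open>[-1, 1]\<close> by Rodrigues' formula.\<close>

definition legendre :: "nat \<Rightarrow> real poly" where
  "legendre d = Polynomial.smult (1 / (2 ^ d * fact d)) ((pderiv ^^ d) ([:-1, 0, 1:] ^ d))"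

definition legendre_on :: "real \<Rightarrow> real \<Rightarrow> nat \<Rightarrow> real \<Rightarrow> real" where
  "legendre_on a b d x = poly (legendre d) ((2 * x - a - b) / (b - a))"

text \<open>
  Basis functions are indexed from \<open>0\<close>: number \<open>i < (k + 1) * N\<close> lives on cell \<open>i div (k + 1)\<close>
  and has degree \<open>i mod (k + 1)\<close> there.
\<close>

definition legendre_basis :: "nat \<Rightarrow> nat \<Rightarrow> (nat \<Rightarrow> real) \<Rightarrow> nat \<Rightarrow> real \<Rightarrow> real" where
  "legendre_basis k N t i x =
    (let j = i div (k + 1); d = i mod (k + 1); a = t j; b = t (Suc j) in
     if x \<in> cell N t j
     then legendre_on a b d x / sqrt (LINT z:{a..b}|lebesgue. (legendre_on a b d z)\<^sup>2)
     else 0)"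

text \<open>Functions on \<open>\<Omega> = [-1, 1] \<times> [0, emax]\<close> are written \<open>f \<mu> \<epsilon>\<close>.\<close>

definition weighted_inner :: "real \<Rightarrow> (real \<Rightarrow> real \<Rightarrow> real) \<Rightarrow> (real \<Rightarrow> real \<Rightarrow> real) \<Rightarrow> real" where
  "weighted_inner emax v w =
     (LINT \<epsilon>:{0..emax}|lebesgue. (LINT \<mu>:{-1..1}|lebesgue. v \<mu> \<epsilon> * w \<mu> \<epsilon> * \<epsilon>\<^sup>2))"

definition wnorm :: "real \<Rightarrow> (real \<Rightarrow> real \<Rightarrow> real) \<Rightarrow> real" where
  "wnorm emax w = sqrt (weighted_inner emax w w)"

definition Aform :: "real \<Rightarrow> (real \<Rightarrow> real) \<Rightarrow> (real \<Rightarrow> real) \<Rightarrow>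
    (real \<Rightarrow> real \<Rightarrow> real) \<Rightarrow> (real \<Rightarrow> real \<Rightarrow> real) \<Rightarrow> real" where
  "Aform emax eta chi f w =
     weighted_inner emax (\<lambda>\<mu> \<epsilon>. eta \<epsilon>) w - weighted_inner emax (\<lambda>\<mu> \<epsilon>. chi \<epsilon> * f \<mu> \<epsilon>) w"

definition is_equilibrium :: "real \<Rightarrow> (real \<Rightarrow> real) \<Rightarrow> (real \<Rightarrow> real) \<Rightarrow>
    (real \<Rightarrow> real \<Rightarrow> real) set \<Rightarrow> (real \<Rightarrow> real \<Rightarrow> real) \<Rightarrow> bool" where
  "is_equilibrium emax eta chi V f \<longleftrightarrow> f \<in> V \<and> (\<forall>w\<in>V. Aform emax eta chi f w = 0)"

text \<open>One implicit Euler step from \<open>g\<close> to \<open>f\<close>, Galerkin-projected onto \<open>V\<close>;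
  \<open>g\<close> itself need not belong to \<open>V\<close>.\<close>

definition euler_step :: "real \<Rightarrow> (real \<Rightarrow> real) \<Rightarrow> (real \<Rightarrow> real) \<Rightarrow> real \<Rightarrow>
    (real \<Rightarrow> real \<Rightarrow> real) set \<Rightarrow> (real \<Rightarrow> real \<Rightarrow> real) \<Rightarrow> (real \<Rightarrow> real \<Rightarrow> real) \<Rightarrow> bool" where
  "euler_step emax eta chi dt V g f \<longleftrightarrow> f \<in> V \<and>
     (\<forall>w\<in>V. 1 / dt * weighted_inner emax (\<lambda>\<mu> \<epsilon>. f \<mu> \<epsilon> - g \<mu> \<epsilon>) w = Aform emax eta chi f w)"

definition is_orth_projection :: "real \<Rightarrow> (real \<Rightarrow> real \<Rightarrow> real) set \<Rightarrow>
    (real \<Rightarrow> real \<Rightarrow> real) \<Rightarrow> (real \<Rightarrow> real \<Rightarrow> real) \<Rightarrow> bool" where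
  "is_orth_projection emax V g f \<longleftrightarrow> f \<in> V \<and>
     (\<forall>w\<in>V. weighted_inner emax (\<lambda>\<mu> \<epsilon>. f \<mu> \<epsilon> - g \<mu> \<epsilon>) w = 0)"

text \<open>Column vectors are matrices with one column, row vectors matrices with one row.\<close>

definition col_norm :: "real mat \<Rightarrow> real" where
  "col_norm z = sqrt (\<Sum>i<dim_row z. (z $$ (i, 0))\<^sup>2)"

definition mat_trace :: "real mat \<Rightarrow> real" where
  "mat_trace B = (\<Sum>i<dim_row B. B $$ (i, i))"

definition weighted_norm :: "real mat \<Rightarrow> real mat \<Rightarrow> real" where
  "weighted_norm M Z = sqrt (mat_trace (Z * M * transpose_mat Z))"

definition mat_inv :: "real mat \<Rightarrow> real mat" where
  "mat_inv B = the (mat_inverse B)"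

text \<open>The function \<open>X\<^sup>T F Y\<close> with coefficient matrix \<open>F\<close>.\<close>

definition recon :: "(nat \<Rightarrow> real \<Rightarrow> real) \<Rightarrow> (nat \<Rightarrow> real \<Rightarrow> real) \<Rightarrow> real mat \<Rightarrow>
    real \<Rightarrow> real \<Rightarrow> real" where
  "recon x y F = (\<lambda>\<mu> \<epsilon>. \<Sum>i<dim_row F. \<Sum>j<dim_col F. x i \<mu> * F $$ (i, j) * y j \<epsilon>)"

definition mass_mat :: "real \<Rightarrow> nat \<Rightarrow> (nat \<Rightarrow> real \<Rightarrow> real) \<Rightarrow> (real \<Rightarrow> real) \<Rightarrow> real mat" where
  "mass_mat emax n y \<rho> =
     mat n n (\<lambda>(i, j). LINT \<epsilon>:{0..emax}|lebesgue. \<rho> \<epsilon> * y i \<epsilon> * y j \<epsilon> * \<epsilon>\<^sup>2)"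

definition load_mu :: "nat \<Rightarrow> (nat \<Rightarrow> real \<Rightarrow> real) \<Rightarrow> real mat" where
  "load_mu m x = mat m 1 (\<lambda>(i, _). LINT \<mu>:{-1..1}|lebesgue. x i \<mu>)"

definition load_eps :: "real \<Rightarrow> nat \<Rightarrow> (nat \<Rightarrow> real \<Rightarrow> real) \<Rightarrow> (real \<Rightarrow> real) \<Rightarrow> real mat" where
  "load_eps emax n y eta = mat n 1 (\<lambda>(j, _). LINT \<epsilon>:{0..emax}|lebesgue. eta \<epsilon> * y j \<epsilon> * \<epsilon>\<^sup>2)"

definition proj_U :: "real mat \<Rightarrow> real mat" where
  "proj_U U = U * transpose_mat U"

definition proj_E_chi :: "real mat \<Rightarrow> real mat \<Rightarrow> real mat" where
  "proj_E_chi Achi E = E * mat_inv (transpose_mat E * Achi * E) * transpose_mat E"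

definition space_K :: "(nat \<Rightarrow> real \<Rightarrow> real) \<Rightarrow> (nat \<Rightarrow> real \<Rightarrow> real) \<Rightarrow> nat \<Rightarrow> nat \<Rightarrow>
    real mat \<Rightarrow> (real \<Rightarrow> real \<Rightarrow> real) set" where
  "space_K x y m r E = {recon x y (K * transpose_mat E) | K. K \<in> carrier_mat m r}"

definition space_L :: "(nat \<Rightarrow> real \<Rightarrow> real) \<Rightarrow> (nat \<Rightarrow> real \<Rightarrow> real) \<Rightarrow> nat \<Rightarrow> nat \<Rightarrow>
    real mat \<Rightarrow> (real \<Rightarrow> real \<Rightarrow> real) set" where
  "space_L x y n r U = {recon x y (U * transpose_mat L) | L. L \<in> carrier_mat n r}"

definition space_S :: "(nat \<Rightarrow> real \<Rightarrow> real) \<Rightarrow> (nat \<Rightarrow> real \<Rightarrow> real) \<Rightarrow> nat \<Rightarrow>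
    real mat \<Rightarrow> real mat \<Rightarrow> (real \<Rightarrow> real \<Rightarrow> real) set" where
  "space_S x y r U E = {recon x y (U * S * transpose_mat E) | S. S \<in> carrier_mat r r}"

end

theory Submission
  imports Defs "Jordan_Normal_Form.Determinant"
begin

text \<open>
  Coefficient matrices turn the problem into linear algebra. The basis in \<open>\<mu>\<close> is orthonormal, so the
  weighted inner product of \<open>X\<^sup>T F Y\<close> and \<open>X\<^sup>T G Y\<close> is the sum over the rows of \<open>F\<close> and \<open>G\<close> of the form
  \<open>A\<close> given by the mass matrix of \<open>\<epsilon>\<^sup>2\<close>; the opacity adds a second form \<open>C\<close> with
  \<open>\<chi>\<^sub>m\<^sub>i\<^sub>n A \<le> C \<le> \<chi>\<^sub>m\<^sub>a\<^sub>x A\<close>. The equilibrium has rank one, \<open>F\<^sup>e\<^sup>q = u e\<^sup>T\<close>, where \<open>u\<close> holds the coefficients of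
  the constant \<open>1\<close> and \<open>C e\<close> is the load vector of the emissivity. Let \<open>D\<close> be the error of the given
  iterate, measured in the row-wise norm of \<open>A\<close>.

  Because the equilibrium has rank one, its projection onto \<open>range U \<otimes> range E\<close> has an error that
  Pythagoras bounds by two products (\<open>outer_projection_error\<close>): the residual of \<open>u\<close> times the length of
  \<open>e\<close>, and the residual of \<open>e\<close> times the length of \<open>u\<close>. Each half step of the scheme makes one of the
  two residuals small.

  The K-step controls the residual \<open>c\<close> of \<open>u\<close>. As \<open>c\<close> is orthogonal to the columns of the new \<open>U\<close>,
  testing the K-equation with \<open>c \<otimes> w\<close> removes the unknown \<open>K\<close>. What remains is an implicit Euler
  step of length \<open>\<Delta>t\<close> that starts from the \<open>C\<close>-projection of \<open>D\<^sup>T c\<close> onto the old \<open>range E\<close> and ends at \<open>- |c|\<^sup>2\<close>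
  times the \<open>C\<close>-projection of \<open>e\<close> (\<open>projected_step_estimate\<close>, \<open>K_step_estimate\<close>). Coercivity of \<open>C\<close> yields the factor
  \<open>1 / (1 + \<Delta>t \<chi>\<^sub>m\<^sub>i\<^sub>n)\<close>, and \<open>\<alpha>\<close> bounds from below how much of \<open>e\<close> the old space sees.
  The L-step controls the residual of \<open>e\<close>: contracting the L-equation with the projection \<open>z\<close> of \<open>u\<close>
  onto the old \<open>range U\<close> gives an implicit Euler step for the contraction of \<open>f\<^sub>L\<close> with \<open>z\<close>, minus the multiple \<open>|z|\<^sup>2 e\<close> of
  the equilibrium, driven by \<open>D\<^sup>T z\<close> (\<open>implicit_step_estimate\<close>, \<open>L_step_estimate\<close>); this is at least as
  far from zero as \<open>|z|\<^sup>2\<close> times the residual of \<open>e\<close>, and \<open>|z|\<close> is bounded below through \<open>\<beta>\<close>.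

  Adding the two estimates (\<open>dlr_step_error\<close>) bounds the squared projection error by
  \<open>\<kappa> |D|\<^sup>2\<close> with \<open>\<kappa>\<close> of order \<open>\<Delta>t\<^sup>-\<^sup>2\<close>; the threshold on \<open>\<Delta>t\<close> makes each of its two terms at most \<open>\<delta>\<^sup>2 / 2\<close>.
  For any \<open>\<Delta>t > 0\<close> the same bound with \<open>D = 0\<close> shows that the equilibrium is reproduced exactly, since \<open>A\<close>
  is definite.
\<close>

section \<open>Legendre polynomials and the discontinuous piecewise polynomial basis\<close>

lemma power_dvd_pderiv:
  fixes q P :: "real poly"
  assumes "q ^ Suc a dvd P"
  shows "q ^ a dvd pderiv P"
proof -
  from assms obtain R where "P = q ^ Suc a * R" by (auto elim: dvdE)
  then have "pderiv P = q ^ a * (q * pderiv R + Polynomial.smult (of_nat (Suc a)) (R * pderiv q))"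
    by (simp add: pderiv_mult pderiv_power_Suc algebra_simps del: power_Suc of_nat_Suc)
       (simp add: algebra_simps)
  then show ?thesis by simp
qed

lemma power_dvd_iterated_pderiv:
  fixes q :: "real poly"
  assumes "j \<le> d"
  shows "q ^ (d - j) dvd (pderiv ^^ j) (q ^ d)"
  using assms
proof (induction j)
  case (Suc j)
  then have "q ^ Suc (d - Suc j) dvd (pderiv ^^ j) (q ^ d)"
    by (simp add: Suc_diff_Suc del: power_Suc)
  from power_dvd_pderiv[OF this] show ?case by simp
qed simp

lemma has_integral_pderiv:
  fixes P :: "real poly"
  assumes "a \<le> b"
  shows "((\<lambda>x. poly (pderiv P) x) has_integral (poly P b - poly P a)) {a..b}"
proof (rule fundamental_theorem_of_calculus[OF assms])
  fix x
  show "(poly P has_vector_derivative poly (pderiv P) x) (at x within {a..b})"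
    using has_field_derivative_at_within[OF poly_DERIV[of P x]]
    by (simp only: has_real_derivative_iff_has_vector_derivative)
qed

text \<open>
  Integration by parts moves one derivative from the Rodrigues power to \<open>p\<close>. The boundary terms vanish
  because a factor \<open>x\<^sup>2 - 1\<close> survives fewer than \<open>d\<close> differentiations, and a polynomial of
  degree below \<open>j\<close> is annihilated by \<open>j\<close> derivatives.
\<close>
lemma rodrigues_orthogonal:
  fixes p :: "real poly"
  assumes "j \<le> d" "degree p < j"
  shows "((\<lambda>x. poly ((pderiv ^^ j) ([:-1, 0, 1:] ^ d)) x * poly p x) has_integral 0) {-1..1}"
  using assms
proof (induction j arbitrary: p)
  case (Suc j)
  let ?W = "\<lambda>j. (pderiv ^^ j) ([:-1, 0, 1:] ^ d) :: real poly"
  have "[:-1, 0, 1:] ^ (d - j) dvd ?W j"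
    by (rule power_dvd_iterated_pderiv) (use Suc.prems in simp)
  moreover have "[:-1, 0, 1 :: real:] dvd [:-1, 0, 1:] ^ (d - j)"
    using Suc.prems by (intro dvd_power) auto
  ultimately have "[:-1, 0, 1:] dvd ?W j" by (rule dvd_trans[rotated])
  then obtain R where R: "?W j = [:-1, 0, 1:] * R" by (auto elim: dvdE)
  have bdry: "poly (?W j) 1 = 0" "poly (?W j) (-1) = 0" by (simp_all add: R)
  have ibp: "((\<lambda>x. poly (pderiv (?W j * p)) x) has_integral 0) {-1..1}"
    using has_integral_pderiv[of "-1" 1 "?W j * p"] bdry by simp
  have rest: "((\<lambda>x. poly (?W j) x * poly (pderiv p) x) has_integral 0) {-1..1}"
  proof (cases "degree p = 0")
    case True
    then have "pderiv p = 0" by (simp add: pderiv_eq_0_iff)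
    then show ?thesis by simp
  next
    case False
    then show ?thesis using Suc by (intro Suc.IH) (auto simp: degree_pderiv)
  qed
  show ?case
    using has_integral_diff[OF ibp rest] by (simp add: pderiv_mult algebra_simps)
qed simp

lemma degree_iterated_pderiv:
  fixes P :: "real poly"
  shows "degree ((pderiv ^^ j) P) = degree P - j"
  by (induction j) (auto simp: degree_pderiv)

lemma degree_legendre: "degree (legendre d) = d"
proof -
  have "degree ([:-1, 0, 1 :: real:] ^ d) = d * degree [:-1, 0, 1 :: real:]"
    by (rule degree_power_eq) simp
  then show ?thesis by (simp add: legendre_def degree_iterated_pderiv)
qed

lemma legendre_nonzero: "legendre d \<noteq> 0"
proof (cases "d = 0")
  case False
  then show ?thesis using degree_legendre[of d] by auto
qed (simp add: legendre_def)

lemma legendre_orthogonal: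
  assumes "d \<noteq> d'"
  shows "((\<lambda>x. poly (legendre d) x * poly (legendre d') x) has_integral 0) {-1..1}"
proof -
  have *: "((\<lambda>x. poly (legendre d) x * poly (legendre d') x) has_integral 0) {-1..1}"
    if "d' < d" for d d'
    using has_integral_mult_right[OF rodrigues_orthogonal[of d d "legendre d'"],
        of "1 / (2 ^ d * fact d)"] that
    by (simp add: degree_legendre) (simp add: legendre_def[of d] mult.assoc)
  show ?thesis
    using assms *[of d d'] *[of d' d] by (cases "d' < d") (auto simp: mult.commute)
qed

text \<open>
  The polynomials \<open>legendre d\<close> have degree exactly \<open>d\<close>, so subtracting a multiple of the top one lowers the
  degree.
\<close>
lemma legendre_span:
  fixes p :: "real poly"
  assumes "degree p \<le> k"
  shows "\<exists>c. p = (\<Sum>d\<le>k. Polynomial.smult (c d) (legendre d))"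
  using assms
proof (induction k arbitrary: p)
  case 0
  let ?c = "coeff p 0 / coeff (legendre 0) 0"
  have "coeff (legendre 0) 0 \<noteq> 0"
    using legendre_nonzero[of 0] degree_legendre[of 0] by (metis leading_coeff_0_iff)
  then have "p = Polynomial.smult ?c (legendre 0)"
  proof (intro poly_eqI)
    fix i
    show "coeff p i = coeff (Polynomial.smult ?c (legendre 0)) i"
      using 0 \<open>coeff (legendre 0) 0 \<noteq> 0\<close>
      by (cases "i = 0") (simp_all add: coeff_eq_0 degree_legendre)
  qed
  then show ?case by (intro exI[of _ "\<lambda>_. ?c"]) simp
next
  case (Suc k)
  let ?c = "coeff p (Suc k) / coeff (legendre (Suc k)) (Suc k)"
  have nz: "coeff (legendre (Suc k)) (Suc k) \<noteq> 0"
    using legendre_nonzero[of "Suc k"] degree_legendre[of "Suc k"] by (metis leading_coeff_0_iff)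
  let ?q = "p - Polynomial.smult ?c (legendre (Suc k))"
  have "degree ?q \<le> k"
  proof (rule degree_le, intro allI impI)
    fix i assume "k < i"
    show "coeff ?q i = 0"
    proof (cases "i = Suc k")
      case False
      with \<open>k < i\<close> Suc.prems show ?thesis by (simp add: coeff_eq_0 degree_legendre)
    qed (use nz in simp)
  qed
  from Suc.IH[OF this] obtain c where c: "?q = (\<Sum>d\<le>k. Polynomial.smult (c d) (legendre d))" by blast
  have "p = ?q + Polynomial.smult ?c (legendre (Suc k))" by simp
  also have "\<dots> = (\<Sum>d\<le>Suc k. Polynomial.smult ((c(Suc k := ?c)) d) (legendre d))"
    by (simp add: c)
  finally show ?case by blast
qed

lemma continuous_on_legendre_on [continuous_intros]: "continuous_on S (legendre_on a b d)"
  unfolding legendre_on_def by (cases "b = a") (auto intro!: continuous_intros)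

lemma LINT_interval_eq_integral:
  fixes f :: "real \<Rightarrow> real"
  assumes "continuous_on {a..b} f"
  shows "(LINT z:{a..b}|lebesgue. f z) = integral {a..b} f"
  using assms by (intro set_lebesgue_integral_eq_integral absolutely_integrable_continuous_real)

lemma legendre_on_orthogonal:
  assumes "a < b" "d \<noteq> d'"
  shows "(LINT z:{a..b}|lebesgue. legendre_on a b d z * legendre_on a b d' z) = 0"
proof -
  let ?g = "\<lambda>x. poly (legendre d) x * poly (legendre d') x"
  \<comment> \<open>The affine map \<open>z \<mapsto> ?m * z + ?c\<close> sends \<open>[a, b]\<close> to \<open>[-1, 1]\<close>.\<close>
  let ?m = "2 / (b - a)" and ?c = "- (a + b) / (b - a)"
  have m: "?m > 0" using assms by simp
  have "((\<lambda>z. ?g (?m *\<^sub>R z + ?c)) has_integral 0) ((\<lambda>x. (1 / ?m) *\<^sub>R x + - ((1 / ?m) *\<^sub>R ?c)) ` cbox (-1) 1)"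
    using has_integral_affinity[of ?g 0 "-1" 1 ?m ?c] legendre_orthogonal[OF assms(2)] m by simp
  also have "(\<lambda>x. (1 / ?m) *\<^sub>R x + - ((1 / ?m) *\<^sub>R ?c)) ` cbox (-1) 1 = {a..b}"
    using assms
    by (subst image_affinity_cbox) (auto simp: field_simps)
  also have "(\<lambda>z. ?g (?m *\<^sub>R z + ?c)) = (\<lambda>z. legendre_on a b d z * legendre_on a b d' z)"
  proof -
    have "?m *\<^sub>R z + ?c = (2 * z - a - b) / (b - a)" for z
      by (simp add: diff_divide_distrib add_divide_distrib)
    then show ?thesis by (simp add: legendre_on_def)
  qed
  finally have "integral {a..b} (\<lambda>z. legendre_on a b d z * legendre_on a b d' z) = 0"
    by (rule integral_unique)
  then show ?thesis
    by (subst LINT_interval_eq_integral) (auto intro!: continuous_intros)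
qed

text \<open>
  A vanishing norm would force a nonzero polynomial to vanish on a whole interval.
\<close>
lemma legendre_on_norm_pos:
  assumes "a < b"
  shows "(LINT z:{a..b}|lebesgue. (legendre_on a b d z)\<^sup>2) > 0"
proof -
  let ?f = "\<lambda>z. (legendre_on a b d z)\<^sup>2"
  have cont: "continuous_on {a..b} ?f" by (intro continuous_intros)
  have "integral {a..b} ?f \<noteq> 0"
  proof
    assume "integral {a..b} ?f = 0"
    then have "\<forall>z\<in>{a..b}. ?f z = 0"
      using integral_eq_0_iff[OF cont assms] by simp
    then have "(\<lambda>z. (2 * z - a - b) / (b - a)) ` {a..b} \<subseteq> {x. poly (legendre d) x = 0}"
      by (auto simp: legendre_on_def)
    then have "finite ((\<lambda>z. (2 * z - a - b) / (b - a)) ` {a..b})"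
      using poly_roots_finite[OF legendre_nonzero] finite_subset by blast
    moreover have "inj_on (\<lambda>z. (2 * z - a - b) / (b - a)) {a..b}"
      using assms by (auto simp: inj_on_def)
    ultimately have "finite {a..b}" using finite_imageD by blast
    with assms show False using infinite_Icc by blast
  qed
  moreover have "integral {a..b} ?f \<ge> 0"
    by (rule Henstock_Kurzweil_Integration.integral_nonneg[OF integrable_continuous_real[OF cont]]) simp
  ultimately show ?thesis by (simp add: LINT_interval_eq_integral[OF cont])
qed

context
  fixes a b :: real and N :: nat and t :: "nat \<Rightarrow> real"
  assumes part: "is_partition a b N t"
begin

lemma partition_less: "i < j \<Longrightarrow> j \<le> N \<Longrightarrow> t i < t j"
proof (induction j)
  case (Suc j)
  then have "t j < t (Suc j)" using part by (simp add: is_partition_def)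
  with Suc show ?case by (cases "i = j") auto
qed simp

lemma partition_le: "i \<le> j \<Longrightarrow> j \<le> N \<Longrightarrow> t i \<le> t j"
  using partition_less[of i j] by (cases "i = j") auto

lemma cell_subset: "j < N \<Longrightarrow> cell N t j \<subseteq> {t j..t (Suc j)}"
  by (auto simp: cell_def)

lemma cell_subset_domain: "j < N \<Longrightarrow> cell N t j \<subseteq> {a..b}"
  using partition_le[of 0 j] partition_le[of "Suc j" N] cell_subset[of j] part
  by (fastforce simp: is_partition_def)

lemma cell_unique:
  assumes "i < N" "j < N" "z \<in> cell N t i" "z \<in> cell N t j"
  shows "i = j"
proof -
  have False if "i < j" "j < N" "z \<in> cell N t i" "z \<in> cell N t j" for i j
    using that partition_le[of "Suc i" j] by (auto simp: cell_def split: if_splits)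
  with assms show ?thesis by (metis linorder_neqE_nat)
qed

lemma cell_exists:
  assumes "0 < N" "z \<in> {a..b}"
  shows "\<exists>j<N. z \<in> cell N t j"
proof -
  have ends: "t 0 = a" "t N = b" using part by (auto simp: is_partition_def)
  let ?P = "\<lambda>j. j < N \<and> t j \<le> z"
  define j where "j = (GREATEST j. ?P j)"
  have "?P 0" using assms ends by simp
  then have j: "?P j" and max: "\<And>i. ?P i \<Longrightarrow> i \<le> j"
    unfolding j_def
    by (rule GreatestI_nat[where b = N], simp) (rule Greatest_le_nat[where b = N], auto)
  have "z \<in> cell N t j"
  proof (cases "Suc j = N")
    case True
    then show ?thesis using j assms ends by (auto simp: cell_def)
  next
    case False
    then have "\<not> t (Suc j) \<le> z" using max[of "Suc j"] j by auto
    with False j show ?thesis by (auto simp: cell_def)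
  qed
  with j show ?thesis by blast
qed

definition legendre_scale :: "nat \<Rightarrow> nat \<Rightarrow> real" where
  "legendre_scale j d = sqrt (LINT z:{t j..t (Suc j)}|lebesgue. (legendre_on (t j) (t (Suc j)) d z)\<^sup>2)"

lemma legendre_scale_pos: "j < N \<Longrightarrow> legendre_scale j d > 0"
  using legendre_on_norm_pos[of "t j" "t (Suc j)" d] part
  by (simp add: legendre_scale_def is_partition_def)

lemma legendre_basis_eq:
  "legendre_basis k N t i z =
     (if z \<in> cell N t (i div (k + 1))
      then legendre_on (t (i div (k + 1))) (t (Suc (i div (k + 1)))) (i mod (k + 1)) z
             / legendre_scale (i div (k + 1)) (i mod (k + 1))
      else 0)"
  by (simp add: legendre_basis_def legendre_scale_def Let_def)

lemma index_cell: "i < (k + 1) * N \<Longrightarrow> i div (k + 1) < N"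
  by (metis less_mult_imp_div_less mult.commute)

lemma legendre_basis_measurable: "legendre_basis k N t i \<in> borel_measurable lebesgue"
proof -
  have "cell N t j \<in> sets borel" for j by (auto simp: cell_def)
  moreover have "(\<lambda>z. legendre_on u v d z / c) \<in> borel_measurable borel" for u v d c
    unfolding divide_inverse by (intro borel_measurable_continuous_onI continuous_intros)
  ultimately have "legendre_basis k N t i \<in> borel_measurable borel"
    unfolding legendre_basis_eq[abs_def]
    by (intro measurable_If_set) auto
  then show ?thesis by (simp add: measurable_completion)
qed

lemma legendre_basis_bounded: "\<exists>B. \<forall>z. \<bar>legendre_basis k N t i z\<bar> \<le> B"
proof -
  let ?j = "i div (k + 1)"
  let ?f = "\<lambda>z. legendre_on (t ?j) (t (Suc ?j)) (i mod (k + 1)) z / legendre_scale ?j (i mod (k + 1))"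
  have "continuous_on {t ?j..t (Suc ?j)} ?f"
    unfolding divide_inverse by (intro continuous_intros)
  then have "bounded (?f ` {t ?j..t (Suc ?j)})"
    by (intro compact_imp_bounded compact_continuous_image) auto
  then obtain B where "\<forall>w \<in> ?f ` {t ?j..t (Suc ?j)}. norm w \<le> B"
    unfolding bounded_iff by blast
  then have B: "\<bar>?f z\<bar> \<le> B" if "z \<in> {t ?j..t (Suc ?j)}" for z
    using that by (auto simp del: abs_divide)
  have "\<bar>legendre_basis k N t i z\<bar> \<le> max B 0" for z
  proof (cases "z \<in> cell N t ?j")
    case True
    then have "z \<in> {t ?j..t (Suc ?j)}" by (auto simp: cell_def split: if_splits)
    with True B[of z] show ?thesis by (simp add: legendre_basis_eq)
  qed (simp add: legendre_basis_eq)
  then show ?thesis by blast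
qed

text \<open>
  Basis functions of different cells have disjoint supports; on one cell this is Legendre orthogonality,
  the half-open cell differing from the closed interval by one point.
\<close>
lemma legendre_basis_orthonormal:
  assumes "i < (k + 1) * N" "j < (k + 1) * N"
  shows "(LINT z:{a..b}|lebesgue. legendre_basis k N t i z * legendre_basis k N t j z)
           = (if i = j then 1 else 0)"
proof (cases "i div (k + 1) = j div (k + 1)")
  case False
  then have "(\<lambda>z. legendre_basis k N t i z * legendre_basis k N t j z) = (\<lambda>z. 0)"
    using cell_unique[OF index_cell[OF assms(1)] index_cell[OF assms(2)]]
    by (auto simp: legendre_basis_eq fun_eq_iff)
  with False show ?thesis by (simp only:) auto
next
  case True
  define J where "J = i div (k + 1)"
  have J: "J < N" "j div (k + 1) = J" using index_cell[OF assms(1)] True by (simp_all add: J_def)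
  define d e where "d = i mod (k + 1)" and "e = j mod (k + 1)"
  let ?u = "t J" and ?v = "t (Suc J)"
  have uv: "?u < ?v" using partition_less[of J "Suc J"] J by simp
  have ij: "i = j \<longleftrightarrow> d = e"
    using True by (metis d_def e_def div_mult_mod_eq)
  have bi: "legendre_basis k N t i z
      = (if z \<in> cell N t J then legendre_on ?u ?v d z / legendre_scale J d else 0)" for z
    unfolding legendre_basis_eq J_def d_def ..
  have bj: "legendre_basis k N t j z
      = (if z \<in> cell N t J then legendre_on ?u ?v e z / legendre_scale J e else 0)" for z
    unfolding legendre_basis_eq J(2) e_def ..
  have "(LINT z:{a..b}|lebesgue. legendre_basis k N t i z * legendre_basis k N t j z)
      = (LINT z:{?u..?v}|lebesgue. inverse (legendre_scale J d * legendre_scale J e) *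
           (legendre_on ?u ?v d z * legendre_on ?u ?v e z))"
    unfolding set_lebesgue_integral_def
  proof (rule integral_discrete_difference[where X = "{?v}"])
    fix z assume z: "z \<notin> {?v}"
    have "z \<in> cell N t J \<longleftrightarrow> z \<in> {?u..?v}"
      using z by (auto simp: cell_def)
    then show "indicat_real {a..b} z *\<^sub>R (legendre_basis k N t i z * legendre_basis k N t j z)
        = indicat_real {?u..?v} z *\<^sub>R (inverse (legendre_scale J d * legendre_scale J e) *
           (legendre_on ?u ?v d z * legendre_on ?u ?v e z))"
      unfolding bi bj using cell_subset_domain[OF J(1)]
      by (auto simp: indicator_def field_simps)
  qed auto
  also have "\<dots> = inverse (legendre_scale J d * legendre_scale J e) *
      (LINT z:{?u..?v}|lebesgue. legendre_on ?u ?v d z * legendre_on ?u ?v e z)"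
    by simp
  also have "\<dots> = (if i = j then 1 else 0)"
  proof (cases "d = e")
    case True
    have "legendre_scale J d * legendre_scale J d
        = (LINT z:{?u..?v}|lebesgue. legendre_on ?u ?v d z * legendre_on ?u ?v d z)"
      using legendre_on_norm_pos[OF uv, of d] by (simp add: legendre_scale_def power2_eq_square)
    moreover have "(LINT z:{?u..?v}|lebesgue. legendre_on ?u ?v d z * legendre_on ?u ?v d z) \<noteq> 0"
      using legendre_on_norm_pos[OF uv, of d] by (simp add: power2_eq_square)
    ultimately show ?thesis using True ij by (simp only: left_inverse) simp
  next
    case False
    then show ?thesis using ij legendre_on_orthogonal[OF uv False] by simp
  qed
  finally show ?thesis .
qed

lemma legendre_basis_in_dg_space:
  assumes "i < (k + 1) * N"
  shows "legendre_basis k N t i \<in> dg_space k N t"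
proof -
  have ends: "t 0 = a" "t N = b" using part by (auto simp: is_partition_def)
  let ?J = "i div (k + 1)" and ?d = "i mod (k + 1)"
  let ?P = "Polynomial.smult (inverse (legendre_scale ?J ?d)) (pcompose (legendre ?d)
     [: - (t ?J + t (Suc ?J)) / (t (Suc ?J) - t ?J), 2 / (t (Suc ?J) - t ?J) :])"
  have J: "?J < N" by (rule index_cell[OF assms])
  have "degree ?P \<le> degree (legendre ?d) * 1"
    by (intro order_trans[OF degree_smult_le] order_trans[OF degree_pcompose_le] mult_left_mono) auto
  also have "\<dots> \<le> k" using mod_less_divisor[of "k + 1" i] by (simp add: degree_legendre)
  finally have deg: "degree ?P \<le> k" .
  have val: "legendre_basis k N t i z = poly ?P z" if "z \<in> cell N t ?J" for z
  proof -
    have "(2 * z - t ?J - t (Suc ?J)) / (t (Suc ?J) - t ?J)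
        = - (t ?J + t (Suc ?J)) / (t (Suc ?J) - t ?J) + z * (2 / (t (Suc ?J) - t ?J))"
      by (simp add: diff_divide_distrib add_divide_distrib)
    then show ?thesis
      using that by (simp add: legendre_basis_eq legendre_on_def poly_pcompose field_simps)
  qed
  have "\<exists>p. degree p \<le> k \<and> (\<forall>z\<in>cell N t j. legendre_basis k N t i z = poly p z)" if "j < N" for j
  proof (cases "j = ?J")
    case True
    with deg val show ?thesis by blast
  next
    case False
    with cell_unique[OF that J] have "\<forall>z\<in>cell N t j. legendre_basis k N t i z = poly 0 z"
      by (auto simp: legendre_basis_eq)
    then show ?thesis by (intro exI[of _ 0]) auto
  qed
  moreover have "legendre_basis k N t i z = 0" if "z \<notin> {t 0..t N}" for z
    using that cell_subset_domain[OF J] ends by (auto simp: legendre_basis_eq)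
  ultimately show ?thesis by (auto simp: dg_space_def)
qed

text \<open>
  Expanding the polynomial of each cell in Legendre polynomials gives coefficients indexed by cell and degree;
  the index \<open>i\<close> encodes this pair as quotient and remainder by \<open>k + 1\<close>.
\<close>
lemma dg_space_spanned:
  assumes "0 < N" "v \<in> dg_space k N t"
  shows "\<exists>c. v = (\<lambda>z. \<Sum>i<(k + 1) * N. c i * legendre_basis k N t i z)"
proof -
  have ends: "t 0 = a" "t N = b" using part by (auto simp: is_partition_def)
  have "\<forall>j<N. \<exists>c. \<forall>z\<in>cell N t j. v z = (\<Sum>d\<le>k. c d * legendre_on (t j) (t (Suc j)) d z)"
  proof (intro allI impI)
    fix j assume j: "j < N"
    then obtain p where p: "degree p \<le> k" "\<And>z. z \<in> cell N t j \<Longrightarrow> v z = poly p z"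
      using assms(2) by (auto simp: dg_space_def)
    let ?u = "t j" and ?w = "t (Suc j)"
    have uw: "?u < ?w" using partition_less[of j "Suc j"] j by simp
    \<comment> \<open>Pull \<open>p\<close> back to \<open>[-1, 1]\<close>, where the Legendre polynomials live.\<close>
    let ?p = "pcompose p [: (?u + ?w) / 2, (?w - ?u) / 2 :]"
    have "degree ?p \<le> degree p * 1"
      by (intro order_trans[OF degree_pcompose_le] mult_left_mono) auto
    then have "degree ?p \<le> k" using p by simp
    then obtain c where c: "?p = (\<Sum>d\<le>k. Polynomial.smult (c d) (legendre d))"
      using legendre_span by blast
    have "v z = (\<Sum>d\<le>k. c d * legendre_on ?u ?w d z)" if "z \<in> cell N t j" for z
    proof -
      let ?z = "(2 * z - ?u - ?w) / (?w - ?u)"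
      have "poly p z = poly ?p ?z"
      proof -
        have "?z * ((?w - ?u) / 2) = (2 * z - ?u - ?w) / 2" using uw by simp
        then have "(?u + ?w) / 2 + ?z * ((?w - ?u) / 2) = z"
          by (simp only:) (simp add: field_simps)
        then show ?thesis by (simp add: poly_pcompose)
      qed
      also have "\<dots> = (\<Sum>d\<le>k. c d * legendre_on ?u ?w d z)"
        by (simp only: c) (simp add: poly_sum legendre_on_def)
      finally show ?thesis using p(2)[OF that] by simp
    qed
    then show "\<exists>c. \<forall>z\<in>cell N t j. v z = (\<Sum>d\<le>k. c d * legendre_on ?u ?w d z)" by blast
  qed
  then obtain c where c: "\<And>j z. j < N \<Longrightarrow> z \<in> cell N t j \<Longrightarrow>
      v z = (\<Sum>d\<le>k. c j d * legendre_on (t j) (t (Suc j)) d z)"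
    by metis
  let ?c = "\<lambda>i. c (i div (k + 1)) (i mod (k + 1)) * legendre_scale (i div (k + 1)) (i mod (k + 1))"
  have "v z = (\<Sum>i<(k + 1) * N. ?c i * legendre_basis k N t i z)" for z
  proof (cases "z \<in> {a..b}")
    case True
    then obtain J where J: "J < N" "z \<in> cell N t J" using cell_exists assms(1) by blast
    let ?g = "\<lambda>i. ?c i * legendre_basis k N t i z"
    have "(\<Sum>i<(k + 1) * N. ?g i) = (\<Sum>j<N. sum ?g {j * (k + 1)..<j * (k + 1) + (k + 1)})"
      by (subst sum.nat_group) (simp add: mult.commute)
    also have "\<dots> = (\<Sum>j<N. if j = J then v z else 0)"
    proof (rule sum.cong)
      fix j assume "j \<in> {..<N}"
      then have j: "j < N" by simp
      have "sum ?g {j * (k + 1)..<j * (k + 1) + (k + 1)} = (\<Sum>d<k + 1. ?g (d + j * (k + 1)))"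
        using sum.shift_bounds_nat_ivl[of ?g 0 "j * (k + 1)" "k + 1"]
        by (simp add: lessThan_atLeast0 add.commute)
      also have "\<dots> = (\<Sum>d<k + 1. if j = J then c j d * legendre_on (t j) (t (Suc j)) d z else 0)"
      proof (rule sum.cong)
        fix d assume "d \<in> {..<k + 1}"
        then have d: "d < k + 1" by simp
        have dm: "(d + j * (k + 1)) div (k + 1) = j" "(d + j * (k + 1)) mod (k + 1) = d"
          using d by (simp_all only: div_mult_self1 mod_mult_self1) simp_all
        have "z \<in> cell N t j \<longleftrightarrow> j = J" using cell_unique[OF j J(1)] J by blast
        then show "?g (d + j * (k + 1)) = (if j = J then c j d * legendre_on (t j) (t (Suc j)) d z else 0)"
          unfolding legendre_basis_eq dm using legendre_scale_pos[OF j, of d]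
          by (cases "j = J") auto
      qed simp
      also have "\<dots> = (if j = J then v z else 0)"
        using c[OF J] by (simp add: lessThan_Suc_atMost)
      finally show "sum ?g {j * (k + 1)..<j * (k + 1) + (k + 1)} = (if j = J then v z else 0)" .
    qed simp
    also have "\<dots> = v z" using J(1) by simp
    finally show ?thesis by simp
  next
    case False
    then have "v z = 0" using assms(2) ends by (simp add: dg_space_def)
    moreover have "legendre_basis k N t i z = 0" if "i < (k + 1) * N" for i
      using False cell_subset_domain[OF index_cell[OF that]] by (auto simp: legendre_basis_eq)
    ultimately show ?thesis by simp
  qed
  then have "v = (\<lambda>z. \<Sum>i<(k + 1) * N. ?c i * legendre_basis k N t i z)" ..
  then show ?thesis by (intro exI[of _ ?c])
qed

end

section \<open>Symmetric positive semidefinite forms and projections\<close>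

unbundle no inner_syntax and no vec_syntax

declare minus_carrier_mat [simp]

definition bilin :: "real mat \<Rightarrow> real vec \<Rightarrow> real vec \<Rightarrow> real" where
  "bilin M u v = u \<bullet> (M *\<^sub>v v)"

lemma bilin_add_left:
  assumes "M \<in> carrier_mat n n" "u \<in> carrier_vec n" "v \<in> carrier_vec n" "w \<in> carrier_vec n"
  shows "bilin M (u + v) w = bilin M u w + bilin M v w"
  using assms unfolding bilin_def by (intro add_scalar_prod_distrib) auto

lemma bilin_add_right:
  assumes "M \<in> carrier_mat n n" "u \<in> carrier_vec n" "v \<in> carrier_vec n" "w \<in> carrier_vec n"
  shows "bilin M w (u + v) = bilin M w u + bilin M w v"
  using assms unfolding bilin_def
  by (simp add: mult_add_distrib_mat_vec scalar_prod_add_distrib[of _ n])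

lemma bilin_smult_left:
  assumes "M \<in> carrier_mat n n" "u \<in> carrier_vec n" "v \<in> carrier_vec n"
  shows "bilin M (c \<cdot>\<^sub>v u) v = c * bilin M u v"
  using assms unfolding bilin_def by (simp add: smult_scalar_prod_distrib[of _ n])

lemma bilin_smult_right:
  assumes "M \<in> carrier_mat n n" "u \<in> carrier_vec n" "v \<in> carrier_vec n"
  shows "bilin M u (c \<cdot>\<^sub>v v) = c * bilin M u v"
  using assms unfolding bilin_def
  by (simp add: mult_mat_vec[of _ n n] scalar_prod_smult_distrib[of _ n])

lemma minus_eq_add_smult:
  assumes "u \<in> carrier_vec n" "v \<in> carrier_vec n"
  shows "(u - v :: real vec) = u + (-1) \<cdot>\<^sub>v v"
  using assms by (intro eq_vecI) auto

lemma bilin_diff_left: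
  assumes "M \<in> carrier_mat n n" "u \<in> carrier_vec n" "v \<in> carrier_vec n" "w \<in> carrier_vec n"
  shows "bilin M (u - v) w = bilin M u w - bilin M v w"
  using assms by (simp add: minus_eq_add_smult[of _ n] bilin_add_left[of _ n] bilin_smult_left[of _ n])

lemma bilin_diff_right:
  assumes "M \<in> carrier_mat n n" "u \<in> carrier_vec n" "v \<in> carrier_vec n" "w \<in> carrier_vec n"
  shows "bilin M w (u - v) = bilin M w u - bilin M w v"
  using assms by (simp add: minus_eq_add_smult[of _ n] bilin_add_right[of _ n] bilin_smult_right[of _ n])

lemmas bilin_linear = bilin_add_left bilin_add_right bilin_smult_left bilin_smult_right
  bilin_diff_left bilin_diff_right

text \<open>
  The discriminant criterion behind the Cauchy-Schwarz inequality for semidefinite forms, where \<open>c = 0\<close> is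
  possible.
\<close>
lemma nonneg_quadratic_discriminant:
  fixes a b c :: real
  assumes "\<And>t. 0 \<le> a + 2 * t * b + t\<^sup>2 * c"
  shows "b\<^sup>2 \<le> a * c"
proof (cases "c = 0")
  case True
  have "b = 0"
  proof (rule ccontr)
    assume "b \<noteq> 0"
    with assms[of "- (a + 1) / (2 * b)"] True show False by (simp add: field_simps)
  qed
  with True show ?thesis by simp
next
  case False
  have "c \<ge> 0"
  proof (rule ccontr)
    assume "\<not> c \<ge> 0"
    \<comment> \<open>At \<open>\<plusminus> sqrt T\<close> the quadratic sums to \<open>2 (a - \<bar>a\<bar> - 1) < 0\<close>.\<close>
    define T where "T = (\<bar>a\<bar> + 1) / (- c)"
    from assms[of "sqrt T"] assms[of "- sqrt T"] have "0 \<le> a + (sqrt T)\<^sup>2 * c" by simp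
    moreover have "T \<ge> 0" "T * c = - (\<bar>a\<bar> + 1)"
      using \<open>\<not> c \<ge> 0\<close> by (auto simp: T_def field_simps)
    ultimately show False by simp
  qed
  with False have "c > 0" by simp
  with assms[of "- b / c"] show ?thesis by (simp add: power2_eq_square field_simps)
qed

locale psd_form =
  fixes n :: nat and M :: "real mat"
  assumes carrier [simp]: "M \<in> carrier_mat n n"
    and symmetric: "transpose_mat M = M"
    and nonneg: "v \<in> carrier_vec n \<Longrightarrow> 0 \<le> bilin M v v"
begin

lemma mult_carrier [simp]: "v \<in> carrier_vec n \<Longrightarrow> M *\<^sub>v v \<in> carrier_vec n"
  by (rule mult_mat_vec_carrier[OF carrier])

lemma commute:
  assumes "u \<in> carrier_vec n" "v \<in> carrier_vec n"
  shows "bilin M u v = bilin M v u"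
  using transpose_vec_mult_scalar[OF carrier assms(2) assms(1)] comm_scalar_prod[of "M *\<^sub>v u" n v] assms
  by (simp add: symmetric bilin_def)

definition len :: "real vec \<Rightarrow> real" where
  "len v = sqrt (bilin M v v)"

lemma len_nonneg: "v \<in> carrier_vec n \<Longrightarrow> 0 \<le> len v"
  by (simp add: len_def nonneg)

lemma len_sq: "v \<in> carrier_vec n \<Longrightarrow> (len v)\<^sup>2 = bilin M v v"
  by (simp add: len_def nonneg)

lemma Cauchy_Schwarz:
  assumes "u \<in> carrier_vec n" "v \<in> carrier_vec n"
  shows "\<bar>bilin M u v\<bar> \<le> len u * len v"
proof -
  have "0 \<le> bilin M u u + 2 * t * bilin M u v + t\<^sup>2 * bilin M v v" for t
    using nonneg[of "u + t \<cdot>\<^sub>v v"] assms commute[OF assms]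
    by (simp add: bilin_linear[of _ n] algebra_simps power2_eq_square)
  from nonneg_quadratic_discriminant[OF this]
  have "(bilin M u v)\<^sup>2 \<le> (len u * len v)\<^sup>2"
    using assms by (simp add: power_mult_distrib len_sq)
  then have "\<bar>bilin M u v\<bar> \<le> \<bar>len u * len v\<bar>" by (simp only: abs_le_square_iff)
  then show ?thesis using assms by (simp add: len_nonneg)
qed

end

text \<open>
  \<open>A\<close> plays the role of the mass matrix of the weight \<open>\<epsilon>\<^sup>2\<close> and \<open>C\<close> that of the weight \<open>\<chi> \<epsilon>\<^sup>2\<close>.
\<close>
locale equivalent_forms = A: psd_form n A + C: psd_form n C for n A C +
  fixes lo hi :: real
  assumes lo: "0 < lo" and lo_le_hi: "lo \<le> hi"
    and lower: "v \<in> carrier_vec n \<Longrightarrow> lo * bilin A v v \<le> bilin C v v"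
    and upper: "v \<in> carrier_vec n \<Longrightarrow> bilin C v v \<le> hi * bilin A v v"
begin

text \<open>
  For an implicit Euler step \<open>g\<close> of the decay equation \<open>A g' = - C g\<close> started from \<open>d\<close>, testing with \<open>g\<close> itself and
  the coercivity of \<open>C\<close> give the damping factor. The equation is assumed for this one test function, so that
  the lemma serves steps in the whole space and steps posed in a subspace that contains \<open>g\<close>.
\<close>
lemma implicit_step_estimate:
  assumes "g \<in> carrier_vec n" "d \<in> carrier_vec n" "0 \<le> dt"
    and step: "bilin A (g - d) g + dt * bilin C g g = 0"
  shows "(1 + dt * lo) * A.len g \<le> A.len d"
proof (cases "A.len g = 0")
  case False
  then have pos: "A.len g > 0" using A.len_nonneg[OF assms(1)] by simp
  have "(1 + dt * lo) * (A.len g)\<^sup>2 \<le> bilin A g g + dt * bilin C g g"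
    using mult_left_mono[OF lower[OF assms(1)] \<open>0 \<le> dt\<close>]
    by (simp add: A.len_sq assms distrib_right mult.assoc)
  also have "\<dots> = bilin A d g"
    using step assms by (simp add: bilin_linear[of _ n])
  also have "\<dots> \<le> A.len d * A.len g"
    using A.Cauchy_Schwarz[OF assms(2) assms(1)] by simp
  finally have "(1 + dt * lo) * A.len g * A.len g \<le> A.len d * A.len g"
    by (simp only: power2_eq_square mult.assoc)
  with pos show ?thesis by (simp only: mult_le_cancel_right_pos)
qed (use A.len_nonneg[OF assms(2)] in simp)

text \<open>
  The algebraic core of the K-step. Here \<open>q\<close> stands for the \<open>C\<close>-projection of \<open>e\<close> onto a subspace that
  contains \<open>f\<close>. Then \<open>p = f - \<kappa> q\<close> is the \<open>C\<close>-projection of \<open>f - \<kappa> e\<close>, and the assumption \<open>step\<close> says that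
  \<open>- \<kappa> q\<close> satisfies the implicit Euler step started from \<open>p\<close>, tested with \<open>q\<close>. A \<open>C\<close>-projection does
  not increase the \<open>C\<close>-length; passing from \<open>A\<close> to \<open>C\<close> and back costs the factor \<open>sqrt (hi / lo)\<close>.
\<close>
lemma projected_step_estimate:
  assumes carr: "e \<in> carrier_vec n" "q \<in> carrier_vec n" "f \<in> carrier_vec n"
    and "0 \<le> dt" "0 \<le> \<kappa>"
    and proj: "bilin C q q = bilin C e q" "bilin C q f = bilin C e f"
    and step: "bilin A f q = - (dt * \<kappa> * bilin C q q)"
  shows "\<kappa> * (1 + dt * lo) * A.len q \<le> sqrt (hi / lo) * A.len (f - \<kappa> \<cdot>\<^sub>v e)"
proof -
  define d where "d = f - \<kappa> \<cdot>\<^sub>v e"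
  define p where "p = f - \<kappa> \<cdot>\<^sub>v q"
  have [simp]: "d \<in> carrier_vec n" "p \<in> carrier_vec n" using carr by (auto simp: d_def p_def)
  note [simp] = carr
  have comm: "bilin C e q = bilin C q e" "bilin C f q = bilin C q f" "bilin C f e = bilin C e f"
    by (simp_all add: C.commute)
  have "(1 + dt * lo) * A.len (\<kappa> \<cdot>\<^sub>v q) \<le> A.len p"
  proof -
    have "(1 + dt * lo) * A.len (\<kappa> \<cdot>\<^sub>v q) \<le> A.len ((-1) \<cdot>\<^sub>v p)"
      using step \<open>0 \<le> dt\<close>
      by (intro implicit_step_estimate) (auto simp: p_def bilin_linear[of _ n] algebra_simps)
    also have "\<dots> = A.len p" by (simp add: A.len_def bilin_linear[of _ n])
    finally show ?thesis .
  qed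
  moreover have "A.len (\<kappa> \<cdot>\<^sub>v q) = \<kappa> * A.len q"
    using \<open>0 \<le> \<kappa>\<close> by (simp add: A.len_def bilin_linear[of _ n] real_sqrt_mult flip: mult.assoc)
  moreover have "A.len p \<le> sqrt (hi / lo) * A.len d"
  proof -
    have "bilin C p p = bilin C d p"
      using proj comm by (simp add: p_def d_def bilin_linear[of _ n] algebra_simps)
    then have "(C.len p)\<^sup>2 \<le> C.len d * C.len p"
      using C.Cauchy_Schwarz[of d p] by (simp add: C.len_sq)
    then have "C.len p \<le> C.len d"
      using C.len_nonneg[of p] C.len_nonneg[of d]
      by (cases "C.len p = 0") (auto simp: power2_eq_square)
    then have "bilin C p p \<le> bilin C d d" by (simp add: C.len_def)
    then have "lo * bilin A p p \<le> hi * bilin A d d"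
      using lower[of p] upper[of d] by simp
    then have "bilin A p p \<le> hi / lo * bilin A d d"
      using lo by (simp add: field_simps)
    then show ?thesis by (simp add: A.len_def flip: real_sqrt_mult)
  qed
  ultimately have "(1 + dt * lo) * (\<kappa> * A.len q) \<le> sqrt (hi / lo) * A.len d"
    by (metis order_trans)
  then show ?thesis by (simp only: d_def mult_ac)
qed

end

definition outer :: "real vec \<Rightarrow> real vec \<Rightarrow> real mat" where
  "outer z w = mat (dim_vec z) (dim_vec w) (\<lambda>(i, j). z $ i * w $ j)"

text \<open>
  For \<open>M\<close> symmetric positive definite this is the inner product that belongs to the norm \<open>weighted_norm M\<close>.
\<close>
definition frob :: "real mat \<Rightarrow> real mat \<Rightarrow> real mat \<Rightarrow> real" where
  "frob M F G = (\<Sum>i<dim_row F. bilin M (row F i) (row G i))"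

lemma outer_carrier [simp]:
  "z \<in> carrier_vec m \<Longrightarrow> w \<in> carrier_vec n \<Longrightarrow> outer z w \<in> carrier_mat m n"
  by (simp add: outer_def carrier_vecD)

lemma row_outer: "i < dim_vec z \<Longrightarrow> row (outer z w) i = z $ i \<cdot>\<^sub>v w"
  by (intro eq_vecI) (auto simp: outer_def)

lemma outer_mult_vec:
  assumes "v \<in> carrier_vec (dim_vec w)"
  shows "outer z w *\<^sub>v v = (w \<bullet> v) \<cdot>\<^sub>v z"
  using assms
  by (intro eq_vecI) (auto simp: outer_def scalar_prod_def sum_distrib_left sum_distrib_right mult_ac intro!: sum.cong)

lemma mult_outer:
  assumes "B \<in> carrier_mat p m" "z \<in> carrier_vec m"
  shows "B * outer z w = outer (B *\<^sub>v z) w"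
  using assms
  by (intro eq_matI) (auto simp: outer_def scalar_prod_def sum_distrib_left mult_ac intro!: sum.cong)

lemma outer_mult_transpose:
  assumes "B \<in> carrier_mat n r" "b \<in> carrier_vec r"
  shows "outer z b * transpose_mat B = outer z (B *\<^sub>v b)"
  using assms
  by (intro eq_matI) (auto simp: outer_def scalar_prod_def sum_distrib_left mult_ac intro!: sum.cong)

text \<open>
  Rank-one test matrices turn the Galerkin equations into statements about vectors; no other test matrices
  occur in the half steps.
\<close>
lemma frob_outer:
  assumes "F \<in> carrier_mat m n" "M \<in> carrier_mat n n" "z \<in> carrier_vec m" "w \<in> carrier_vec n"
  shows "frob M F (outer z w) = z \<bullet> (F *\<^sub>v (M *\<^sub>v w))"
proof -
  have "frob M F (outer z w) = (\<Sum>i<m. z $ i * (row F i \<bullet> (M *\<^sub>v w)))"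
    unfolding frob_def using assms
    by (intro sum.cong) (auto simp: row_outer bilin_smult_right[of _ n] simp flip: bilin_def)
  also have "\<dots> = z \<bullet> (F *\<^sub>v (M *\<^sub>v w))"
    using assms by (auto simp: scalar_prod_def[of z] lessThan_atLeast0 intro!: sum.cong)
  finally show ?thesis .
qed

context psd_form
begin

lemma frob_commute:
  assumes "F \<in> carrier_mat m n" "G \<in> carrier_mat m n"
  shows "frob M F G = frob M G F"
  using assms unfolding frob_def by (auto intro!: sum.cong commute)

lemma frob_nonneg: "F \<in> carrier_mat m n \<Longrightarrow> 0 \<le> frob M F F"
  unfolding frob_def by (auto intro!: sum_nonneg nonneg)

lemma frob_diff_left:
  assumes "F \<in> carrier_mat m n" "G \<in> carrier_mat m n" "H \<in> carrier_mat m n"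
  shows "frob M (F - G) H = frob M F H - frob M G H"
proof -
  have "row (F - G) i = row F i - row G i" if "i < m" for i
    using that assms by (intro eq_vecI) auto
  then show ?thesis
    using assms unfolding frob_def by (simp add: bilin_linear[of _ n] sum_subtractf)
qed

text \<open>
  Contracting the rows of a matrix with a vector is a Cauchy-Schwarz estimate. It follows from the
  nonnegativity of \<open>\<zeta> D - z v\<^sup>T\<close> in the norm of \<open>frob\<close>, where \<open>v = D\<^sup>T z\<close> and \<open>\<zeta> = z \<bullet> z\<close>.
\<close>
lemma len_contract_le_frob:
  assumes D: "D \<in> carrier_mat m n" and z: "z \<in> carrier_vec m"
  shows "(len (transpose_mat D *\<^sub>v z))\<^sup>2 \<le> (z \<bullet> z) * frob M D D"
proof (cases "z \<bullet> z = 0")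
  case True
  have "(\<Sum>i<m. (z $ i)\<^sup>2) = 0"
    using True z by (simp add: scalar_prod_def lessThan_atLeast0 power2_eq_square)
  then have "z = 0\<^sub>v m"
    using z by (intro eq_vecI) (auto simp: sum_nonneg_eq_0_iff)
  then show ?thesis
  proof -
    assume "z = 0\<^sub>v m"
    then have "transpose_mat D *\<^sub>v z = 0\<^sub>v n" using D by (intro eq_vecI) auto
    then have "len (transpose_mat D *\<^sub>v z) = 0"
      by (simp add: len_def bilin_def scalar_prod_left_zero[of _ n])
    with True show ?thesis by simp
  qed
next
  case False
  define v where "v = transpose_mat D *\<^sub>v z"
  have v [simp]: "v \<in> carrier_vec n"
    unfolding v_def by (rule mult_mat_vec_carrier[of _ n m]) (use D z in auto)
  define \<zeta> where "\<zeta> = z \<bullet> z"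
  have "\<zeta> = (\<Sum>i<m. (z $ i)\<^sup>2)"
    using z by (simp add: \<zeta>_def scalar_prod_def lessThan_atLeast0 power2_eq_square)
  then have "\<zeta> \<ge> 0" by (simp add: sum_nonneg)
  with False have pos: "\<zeta> > 0" by (simp add: \<zeta>_def)
  have zz: "(\<Sum>i<m. z $ i * z $ i) = \<zeta>"
    using z by (simp add: \<zeta>_def scalar_prod_def lessThan_atLeast0)
  have row [simp]: "row D i \<in> carrier_vec n" for i
    by (rule carrier_vecI) (use D in simp)
  have "(\<Sum>i<m. z $ i * bilin M (row D i) v) = z \<bullet> (D *\<^sub>v (M *\<^sub>v v))"
    unfolding scalar_prod_def[of z] bilin_def lessThan_atLeast0 using D by (intro sum.cong) auto
  also have "\<dots> = bilin M v v"
    using transpose_vec_mult_scalar[OF D mult_mat_vec_carrier[OF carrier v] z]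
    by (simp add: bilin_def v_def)
  finally have cross: "(\<Sum>i<m. z $ i * bilin M (row D i) v) = bilin M v v" .
  have "0 \<le> (\<Sum>i<m. bilin M (\<zeta> \<cdot>\<^sub>v row D i - z $ i \<cdot>\<^sub>v v) (\<zeta> \<cdot>\<^sub>v row D i - z $ i \<cdot>\<^sub>v v))"
    by (intro sum_nonneg nonneg) simp
  also have "\<dots> = (\<Sum>i<m. \<zeta>\<^sup>2 * bilin M (row D i) (row D i) - 2 * \<zeta> * (z $ i * bilin M (row D i) v)
      + z $ i * z $ i * bilin M v v)"
  proof (rule sum.cong)
    fix i
    show "bilin M (\<zeta> \<cdot>\<^sub>v row D i - z $ i \<cdot>\<^sub>v v) (\<zeta> \<cdot>\<^sub>v row D i - z $ i \<cdot>\<^sub>v v)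
        = \<zeta>\<^sup>2 * bilin M (row D i) (row D i) - 2 * \<zeta> * (z $ i * bilin M (row D i) v)
          + z $ i * z $ i * bilin M v v"
      using commute[OF v row[of i]] by (simp add: bilin_linear[of _ n] power2_eq_square algebra_simps)
  qed simp
  also have "\<dots> = \<zeta>\<^sup>2 * frob M D D - 2 * \<zeta> * bilin M v v + \<zeta> * bilin M v v"
    unfolding sum.distrib sum_subtractf sum_distrib_left[symmetric] sum_distrib_right[symmetric] cross zz
    using D by (simp add: frob_def)
  finally have "\<zeta> * bilin M v v \<le> \<zeta> * (\<zeta> * frob M D D)"
    by (simp add: power2_eq_square algebra_simps)
  with pos have "bilin M v v \<le> \<zeta> * frob M D D" by (simp only: mult_le_cancel_left_pos)
  then show ?thesis by (simp only: len_sq[OF v] flip: v_def \<zeta>_def)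
qed

end

lemma mult_scalar_transpose:
  fixes B :: "real mat"
  assumes "B \<in> carrier_mat p r" "b \<in> carrier_vec r" "v \<in> carrier_vec p"
  shows "(B *\<^sub>v b) \<bullet> v = b \<bullet> (transpose_mat B *\<^sub>v v)"
  using transpose_vec_mult_scalar[of "transpose_mat B" r p v b] assms by simp

lemma frob_outer_outer:
  assumes "M \<in> carrier_mat n n" "a \<in> carrier_vec m" "b \<in> carrier_vec n"
    "a' \<in> carrier_vec m" "b' \<in> carrier_vec n"
  shows "frob M (outer a b) (outer a' b') = (a \<bullet> a') * bilin M b b'"
proof -
  have "frob M (outer a b) (outer a' b') = a' \<bullet> (outer a b *\<^sub>v (M *\<^sub>v b'))"
    using assms by (intro frob_outer[of _ m n]) auto
  also have "outer a b *\<^sub>v (M *\<^sub>v b') = (b \<bullet> (M *\<^sub>v b')) \<cdot>\<^sub>v a"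
    by (rule outer_mult_vec) (use mult_mat_vec_carrier[OF assms(1,5)] carrier_vecD[OF assms(3)] in simp)
  also have "a' \<bullet> \<dots> = (a \<bullet> a') * bilin M b b'"
    using scalar_prod_smult_distrib[OF assms(4,2)] comm_scalar_prod[OF assms(2,4)]
    by (simp add: bilin_def mult.commute)
  finally show ?thesis .
qed

context psd_form
begin

text \<open>
  The \<open>M\<close>-orthogonal projection onto the column space of \<open>E\<close>, provided that the columns of \<open>E\<close> are \<open>M\<close>-orthonormal.
\<close>
definition proj :: "real mat \<Rightarrow> real vec \<Rightarrow> real vec" where
  "proj E v = E *\<^sub>v (transpose_mat E *\<^sub>v (M *\<^sub>v v))"

context
  fixes E :: "real mat" and r :: nat
  assumes E: "E \<in> carrier_mat n r" and orth: "transpose_mat E * M * E = 1\<^sub>m r"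
begin

lemma range_carrier: "b \<in> carrier_vec r \<Longrightarrow> E *\<^sub>v b \<in> carrier_vec n"
  by (rule mult_mat_vec_carrier[OF E])

lemma coeff_carrier: "v \<in> carrier_vec n \<Longrightarrow> transpose_mat E *\<^sub>v v \<in> carrier_vec r"
  by (rule mult_mat_vec_carrier[of _ r n]) (use E in auto)

lemma proj_carrier: "v \<in> carrier_vec n \<Longrightarrow> proj E v \<in> carrier_vec n"
  by (simp add: proj_def range_carrier coeff_carrier)

lemma bilin_range:
  assumes "b \<in> carrier_vec r" "c \<in> carrier_vec r"
  shows "bilin M (E *\<^sub>v b) (E *\<^sub>v c) = b \<bullet> c"
proof -
  have "bilin M (E *\<^sub>v b) (E *\<^sub>v c) = b \<bullet> (transpose_mat E *\<^sub>v (M *\<^sub>v (E *\<^sub>v c)))"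
    unfolding bilin_def using assms E by (intro mult_scalar_transpose[of _ n r]) (auto simp: range_carrier)
  also have "transpose_mat E *\<^sub>v (M *\<^sub>v (E *\<^sub>v c)) = (transpose_mat E * M * E) *\<^sub>v c"
    using E assms by (simp add: assoc_mult_mat_vec[of _ r n _ n] assoc_mult_mat_vec[of _ r n _ r] range_carrier mult_carrier_mat[of _ r n])
  also have "\<dots> = c" using assms by (simp add: orth)
  finally show ?thesis .
qed

lemma bilin_proj_range:
  assumes "v \<in> carrier_vec n" "b \<in> carrier_vec r"
  shows "bilin M (proj E v) (E *\<^sub>v b) = bilin M v (E *\<^sub>v b)"
proof -
  let ?a = "transpose_mat E *\<^sub>v (M *\<^sub>v v)"
  have a: "?a \<in> carrier_vec r" using assms by (simp add: coeff_carrier)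
  have "bilin M (proj E v) (E *\<^sub>v b) = b \<bullet> ?a"
    using bilin_range[OF a assms(2)] comm_scalar_prod[OF a assms(2)] by (simp add: proj_def)
  also have "\<dots> = bilin M (E *\<^sub>v b) v"
    unfolding bilin_def using assms E by (intro mult_scalar_transpose[of _ n r, symmetric]) auto
  also have "\<dots> = bilin M v (E *\<^sub>v b)"
    using assms by (intro commute) (auto simp: range_carrier)
  finally show ?thesis .
qed

lemma bilin_proj_self:
  assumes "v \<in> carrier_vec n"
  shows "bilin M (proj E v) v = bilin M (proj E v) (proj E v)"
  using bilin_proj_range[OF assms, of "transpose_mat E *\<^sub>v (M *\<^sub>v v)"] assms commute[of v "proj E v"]
  by (simp add: proj_carrier coeff_carrier) (simp add: proj_def)

lemma len_sq_residual:
  assumes "v \<in> carrier_vec n"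
  shows "(len (v - proj E v))\<^sup>2 = bilin M v v - bilin M (proj E v) (proj E v)"
  using bilin_proj_self[OF assms] assms commute[of v "proj E v"]
  by (simp add: len_sq proj_carrier bilin_linear[of _ n])

lemma residual_orthogonal:
  assumes "v \<in> carrier_vec n" "b \<in> carrier_vec r"
  shows "bilin M (v - proj E v) (E *\<^sub>v b) = 0"
  using bilin_proj_range[OF assms] assms by (simp add: proj_carrier range_carrier bilin_linear[of _ n])

lemma residual_self:
  assumes "v \<in> carrier_vec n"
  shows "bilin M (v - proj E v) v = (len (v - proj E v))\<^sup>2"
  using bilin_proj_self[OF assms] assms
  by (simp add: len_sq_residual proj_carrier bilin_linear[of _ n])

end

lemma frob_diff_right:
  assumes "F \<in> carrier_mat m n" "G \<in> carrier_mat m n" "H \<in> carrier_mat m n"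
  shows "frob M H (F - G) = frob M H F - frob M H G"
  using frob_diff_left[OF assms] frob_commute[OF assms(3,1)] frob_commute[OF assms(3,2)]
    frob_commute[OF assms(3) minus_carrier_mat[OF assms(2), of F]] by simp

lemma frob_best_approximation:
  assumes carr: "F \<in> carrier_mat m n" "G \<in> carrier_mat m n" "H \<in> carrier_mat m n"
    and orth: "frob M (F - H) (F - G) = 0"
  shows "frob M (F - H) (F - H) \<le> frob M (G - H) (G - H)"
proof -
  define X Y where "X = F - H" and "Y = G - H"
  have [simp]: "X \<in> carrier_mat m n" "Y \<in> carrier_mat m n" using carr by (auto simp: X_def Y_def)
  have "F - G = X - Y" using carr by (intro eq_matI) (auto simp: X_def Y_def)
  then have *: "frob M X (X - Y) = 0" using orth by (simp add: X_def)
  have "0 \<le> frob M (X - Y) (X - Y)" by (rule frob_nonneg[of _ m]) simp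
  also have "\<dots> = frob M X X - 2 * frob M X Y + frob M Y Y"
    by (simp add: frob_diff_left[of _ m] frob_diff_right[of _ m] frob_commute[of Y m X])
  finally show ?thesis
    using * by (simp add: frob_diff_right[of _ m] flip: X_def Y_def)
qed

end

text \<open>
  The Euclidean inner product is treated as the form of the identity matrix, so that one theory of projections
  serves both factors of the tensor product.
\<close>
lemma psd_form_one: "psd_form m (1\<^sub>m m)"
proof
  fix v :: "real vec" assume "v \<in> carrier_vec m"
  then show "0 \<le> bilin (1\<^sub>m m) v v"
    by (simp add: bilin_def scalar_prod_def sum_nonneg)
qed auto

interpretation euclid: psd_form m "1\<^sub>m m" for m
  by (rule psd_form_one)

lemma bilin_one: "v \<in> carrier_vec m \<Longrightarrow> bilin (1\<^sub>m m) u v = u \<bullet> v"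
  by (simp add: bilin_def)

text \<open>
  The Galerkin projection is the best approximation, so it may be compared with the rank-one matrix \<open>a b\<^sup>T\<close>
  of the two separate projections \<open>a\<close> of \<open>u\<close> and \<open>b\<close> of \<open>e\<close>. Its error is \<open>\<bar>u\<bar>\<^sup>2\<bar>e\<bar>\<^sup>2 - \<bar>a\<bar>\<^sup>2\<bar>b\<bar>\<^sup>2\<close>, which Pythagoras in each
  factor rewrites as \<open>\<bar>u - a\<bar>\<^sup>2\<bar>e\<bar>\<^sup>2 + \<bar>a\<bar>\<^sup>2\<bar>e - b\<bar>\<^sup>2\<close>.
\<close>
lemma outer_projection_error:
  assumes A: "psd_form n A" and carr: "U \<in> carrier_mat m r" "E \<in> carrier_mat n r"
    "u \<in> carrier_vec m" "e \<in> carrier_vec n" "S \<in> carrier_mat r r"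
    and orthU: "transpose_mat U * U = 1\<^sub>m r" and orthE: "transpose_mat E * A * E = 1\<^sub>m r"
    and galerkin: "\<And>T. T \<in> carrier_mat r r \<Longrightarrow>
      frob A (U * S * transpose_mat E - outer u e) (U * T * transpose_mat E) = 0"
  shows "frob A (U * S * transpose_mat E - outer u e) (U * S * transpose_mat E - outer u e)
    \<le> (euclid.len m (u - euclid.proj m U u) * psd_form.len A e)\<^sup>2
      + (euclid.len m u * psd_form.len A (e - psd_form.proj A E e))\<^sup>2"
proof -
  interpret A: psd_form n A by fact
  note [simp] = carr
  have orthU': "transpose_mat U * 1\<^sub>m m * U = 1\<^sub>m r" using orthU right_mult_one_mat[of "transpose_mat U" r m] by simp
  define a0 b0 where "a0 = transpose_mat U *\<^sub>v (1\<^sub>m m *\<^sub>v u)" and "b0 = transpose_mat E *\<^sub>v (A *\<^sub>v e)"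
  have [simp]: "a0 \<in> carrier_vec r" "b0 \<in> carrier_vec r"
    unfolding a0_def b0_def
    by (intro euclid.coeff_carrier[OF carr(1) orthU'] A.coeff_carrier[OF carr(2) orthE]; simp)+
  define a b where "a = euclid.proj m U u" and "b = A.proj E e"
  have [simp]: "a \<in> carrier_vec m" "b \<in> carrier_vec n"
    unfolding a_def b_def
    by (simp_all add: euclid.proj_carrier[OF carr(1) orthU'] A.proj_carrier[OF carr(2) orthE])
  have UE: "U * T * transpose_mat E \<in> carrier_mat m n" if "T \<in> carrier_mat r r" for T
    using that by (intro mult_carrier_mat[of _ m r] mult_carrier_mat[of U m r]) auto
  have ab: "outer a b = U * outer a0 b0 * transpose_mat E"
  proof -
    have "U * outer a0 b0 * transpose_mat E = outer (U *\<^sub>v a0) b0 * transpose_mat E"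
      by (simp add: mult_outer[of _ m r])
    also have "\<dots> = outer (U *\<^sub>v a0) (E *\<^sub>v b0)"
      by (rule outer_mult_transpose[of _ n r]) simp_all
    finally show ?thesis
      by (simp add: a_def b_def a0_def b0_def euclid.proj_def A.proj_def)
  qed
  have "frob A (U * S * transpose_mat E - outer u e) (U * S * transpose_mat E - outer u e)
      \<le> frob A (outer a b - outer u e) (outer a b - outer u e)"
  proof (rule A.frob_best_approximation[of _ m])
    show "frob A (U * S * transpose_mat E - outer u e) (U * S * transpose_mat E - outer a b) = 0"
      unfolding ab using UE galerkin[of S] galerkin[of "outer a0 b0"]
      by (subst A.frob_diff_right[of _ m]) auto
  qed (simp_all add: UE)
  also have "\<dots> = (a \<bullet> a) * bilin A b b - 2 * (a \<bullet> u) * bilin A b e + (u \<bullet> u) * bilin A e e"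
    using A.commute[of b e] comm_scalar_prod[of u m a]
    by (simp add: A.frob_diff_left[of _ m] A.frob_diff_right[of _ m] frob_outer_outer[of _ n _ m])
  also have "\<dots> = (u \<bullet> u) * bilin A e e - (a \<bullet> a) * bilin A b b"
    using euclid.bilin_proj_self[OF carr(1) orthU' carr(3)] A.bilin_proj_self[OF carr(2) orthE carr(4)]
    by (simp add: bilin_one flip: a_def b_def)
  also have "\<dots> = (u \<bullet> u - a \<bullet> a) * bilin A e e + (a \<bullet> a) * (bilin A e e - bilin A b b)"
    by (simp add: algebra_simps)
  also have "\<dots> = (euclid.len m (u - a) * A.len e)\<^sup>2 + (a \<bullet> a) * (A.len (e - b))\<^sup>2"
    using euclid.len_sq_residual[OF carr(1) orthU' carr(3)] A.len_sq_residual[OF carr(2) orthE carr(4)]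
    by (simp add: bilin_one A.len_sq power_mult_distrib flip: a_def b_def)
  also have "\<dots> \<le> (euclid.len m (u - a) * A.len e)\<^sup>2 + (euclid.len m u * A.len (e - b))\<^sup>2"
  proof -
    have "0 \<le> (euclid.len m (u - a))\<^sup>2" by simp
    then have "a \<bullet> a \<le> (euclid.len m u)\<^sup>2"
      using euclid.len_sq_residual[OF carr(1) orthU' carr(3)]
      by (simp add: euclid.len_sq bilin_one flip: a_def)
    then show ?thesis by (simp add: power_mult_distrib mult_right_mono)
  qed
  finally show ?thesis by (simp add: a_def b_def)
qed

section \<open>Contraction of the two half steps\<close>

lemma transpose_outer:
  "transpose_mat (outer z w) = outer w z"
  by (intro eq_matI) (auto simp: outer_def)

lemma cancel_common_factor:
  fixes c e D g s q \<alpha> :: real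
  assumes "c * c * g * q \<le> s * (c * D)" "\<alpha> * e \<le> q"
    and "0 \<le> c" "0 \<le> s" "0 \<le> D" "0 < g" "0 < \<alpha>"
  shows "c * e \<le> s / (\<alpha> * g) * D"
proof (cases "c = 0")
  case False
  with \<open>0 \<le> c\<close> have c: "0 < c" by simp
  have "c * (c * g * (\<alpha> * e)) \<le> c * (c * g * q)"
    using assms c by (intro mult_left_mono) auto
  also have "\<dots> \<le> c * (s * D)" using assms(1) by (simp add: mult_ac)
  finally have "c * e * (\<alpha> * g) \<le> s * D" using c by (simp add: mult_ac)
  then show ?thesis using assms by (simp add: field_simps)
qed (use assms in auto)

text \<open>
  The rows of the error of the old iterate, contracted with \<open>z\<close>, split into a vector in the column space of \<open>E\<close>
  and a multiple of \<open>e\<close>. For \<open>z = c\<close> in the K-step this is \<open>f - \<kappa> e\<close>.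
\<close>
lemma transpose_step_error:
  assumes "U \<in> carrier_mat m r" "S \<in> carrier_mat r r" "E \<in> carrier_mat n r"
    "u \<in> carrier_vec m" "e \<in> carrier_vec n" "z \<in> carrier_vec m"
  shows "transpose_mat (U * S * transpose_mat E - outer u e) *\<^sub>v z
    = E *\<^sub>v (transpose_mat S *\<^sub>v (transpose_mat U *\<^sub>v z)) - (u \<bullet> z) \<cdot>\<^sub>v e"
proof -
  have US: "U * S \<in> carrier_mat m r" using assms by simp
  have F: "U * S * transpose_mat E \<in> carrier_mat m n"
    by (rule mult_carrier_mat[OF US]) (use assms in simp)
  have Uz: "transpose_mat U *\<^sub>v z \<in> carrier_vec r"
    by (rule mult_mat_vec_carrier[of _ r m]) (use assms in auto)
  have "transpose_mat (U * S * transpose_mat E - outer u e)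
      = transpose_mat (U * S * transpose_mat E) - outer e u"
    using transpose_minus[OF F, of "outer u e"] assms by (simp add: transpose_outer)
  also have "transpose_mat (U * S * transpose_mat E) = E * transpose_mat (U * S)"
    using transpose_mult[OF US, of "transpose_mat E" n] assms by simp
  also have "transpose_mat (U * S) = transpose_mat S * transpose_mat U"
    by (rule transpose_mult[OF assms(1,2)])
  finally have "transpose_mat (U * S * transpose_mat E - outer u e)
    = E * (transpose_mat S * transpose_mat U) - outer e u" .
  moreover have "(E * (transpose_mat S * transpose_mat U)) *\<^sub>v z
      = E *\<^sub>v (transpose_mat S *\<^sub>v (transpose_mat U *\<^sub>v z))"
    using assms
    by (simp add: assoc_mult_mat_vec[of E n r _ m] assoc_mult_mat_vec[of _ r r _ m] mult_carrier_mat[of _ r r])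
  moreover have "outer e u *\<^sub>v z = (u \<bullet> z) \<cdot>\<^sub>v e"
    by (rule outer_mult_vec) (use assms carrier_vecD[OF assms(4)] in simp)
  moreover have "(E * (transpose_mat S * transpose_mat U) - outer e u) *\<^sub>v z
      = (E * (transpose_mat S * transpose_mat U)) *\<^sub>v z - outer e u *\<^sub>v z"
    by (rule minus_mult_distrib_mat_vec[of _ n m])
       (use assms in \<open>auto intro!: mult_carrier_mat[of _ n r] mult_carrier_mat[of _ r r]\<close>)
  ultimately show ?thesis by simp
qed

context equivalent_forms
begin

text \<open>
  The residual \<open>c\<close> of \<open>u\<close> is orthogonal to the columns of \<open>U1\<close>, hence to those of \<open>K = U1 RK\<close>. Testing
  the K-equation with \<open>c q\<^sup>T\<close> therefore leaves a relation without the unknown \<open>K\<close>, which is the hypothesis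
  \<open>step\<close> of \<open>projected_step_estimate\<close> with \<open>\<kappa> = \<bar>c\<bar>\<^sup>2\<close>. The start \<open>f - \<kappa> e\<close> is the error of the old iterate
  contracted with \<open>c\<close>; one factor \<open>\<bar>c\<bar>\<close> cancels.
\<close>
lemma K_step_estimate:
  fixes U0 S0 E0 K U1 RK :: "real mat" and u e q' :: "real vec" and m r :: nat
  defines "F0 \<equiv> U0 * S0 * transpose_mat E0" and "q \<equiv> E0 *\<^sub>v q'"
    and "c \<equiv> u - euclid.proj m U1 u"
  assumes carr: "U0 \<in> carrier_mat m r" "S0 \<in> carrier_mat r r" "E0 \<in> carrier_mat n r"
      "U1 \<in> carrier_mat m r" "RK \<in> carrier_mat r r"
      "u \<in> carrier_vec m" "e \<in> carrier_vec n" "q' \<in> carrier_vec r"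
    and dt: "0 \<le> dt" and \<alpha>: "0 < \<alpha>"
    and K: "K = U1 * RK" and orth: "transpose_mat U1 * U1 = 1\<^sub>m r"
    and proj: "\<And>b. b \<in> carrier_vec r \<Longrightarrow> bilin C q (E0 *\<^sub>v b) = bilin C e (E0 *\<^sub>v b)"
    and large: "\<alpha> * A.len e \<le> A.len q"
    and step: "\<And>z b. z \<in> carrier_vec m \<Longrightarrow> b \<in> carrier_vec r \<Longrightarrow>
      frob A (K * transpose_mat E0 - F0) (outer z (E0 *\<^sub>v b))
        = dt * frob C (outer u e - K * transpose_mat E0) (outer z (E0 *\<^sub>v b))"
  shows "euclid.len m c * A.len e
    \<le> sqrt (hi / lo) / (\<alpha> * (1 + dt * lo)) * sqrt (frob A (F0 - outer u e) (F0 - outer u e))"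
proof -
  note [simp] = carr
  have orth': "transpose_mat U1 * 1\<^sub>m m * U1 = 1\<^sub>m r"
    using orth right_mult_one_mat[of "transpose_mat U1" r m] by simp
  have c [simp]: "c \<in> carrier_vec m"
    by (simp add: c_def euclid.proj_carrier[OF carr(4) orth'])
  have rng [simp]: "E0 *\<^sub>v b \<in> carrier_vec n" if "b \<in> carrier_vec r" for b
    by (rule mult_mat_vec_carrier[OF carr(3) that])
  have coeff [simp]: "transpose_mat E0 *\<^sub>v v \<in> carrier_vec r" if "v \<in> carrier_vec n" for v
    by (rule mult_mat_vec_carrier[of _ r n]) (use that in auto)
  have F0 [simp]: "F0 \<in> carrier_mat m n"
    unfolding F0_def by (rule mult_carrier_mat[of _ m r] mult_carrier_mat[of U0 m r] | simp)+
  have KE [simp]: "K * transpose_mat E0 \<in> carrier_mat m n"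
    unfolding K by (rule mult_carrier_mat[of _ m r] mult_carrier_mat[of U1 m r] | simp)+
  define \<kappa> where "\<kappa> = (euclid.len m c)\<^sup>2"
  have \<kappa>: "\<kappa> = c \<bullet> c" by (simp add: \<kappa>_def euclid.len_sq bilin_one)
  have cu: "c \<bullet> u = \<kappa>" "u \<bullet> c = \<kappa>"
    using euclid.residual_self[OF carr(4) orth' carr(6)] comm_scalar_prod[OF c carr(6)]
    by (simp_all add: bilin_one \<kappa>_def flip: c_def)
  \<comment> \<open>The unknown \<open>K\<close> drops out of every equation tested with \<open>c\<close>.\<close>
  have cK: "c \<bullet> ((K * transpose_mat E0) *\<^sub>v v) = 0" if v: "v \<in> carrier_vec n" for v
  proof -
    have R: "RK *\<^sub>v (transpose_mat E0 *\<^sub>v v) \<in> carrier_vec r"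
      by (rule mult_mat_vec_carrier[OF carr(5) coeff[OF v]])
    have "(K * transpose_mat E0) *\<^sub>v v = U1 *\<^sub>v (RK *\<^sub>v (transpose_mat E0 *\<^sub>v v))"
      unfolding K using v
      by (simp add: assoc_mult_mat_vec[of _ m r _ n] assoc_mult_mat_vec[of _ m r _ r] mult_carrier_mat[of _ m r])
    then show ?thesis
      using euclid.residual_orthogonal[OF carr(4) orth' carr(6) R] mult_mat_vec_carrier[OF carr(4) R]
      by (simp add: bilin_one flip: c_def)
  qed
  define f where "f = E0 *\<^sub>v (transpose_mat S0 *\<^sub>v (transpose_mat U0 *\<^sub>v c))"
  have f_coeff: "transpose_mat S0 *\<^sub>v (transpose_mat U0 *\<^sub>v c) \<in> carrier_vec r"
    by (rule mult_mat_vec_carrier[of _ r r] mult_mat_vec_carrier[of _ r m] | simp)+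
  then have f [simp]: "f \<in> carrier_vec n" by (simp add: f_def)
  have d: "transpose_mat (F0 - outer u e) *\<^sub>v c = f - \<kappa> \<cdot>\<^sub>v e"
    using transpose_step_error[of U0 m r S0 E0 n u e c] by (simp add: F0_def f_def cu)
  have F0c: "c \<bullet> (F0 *\<^sub>v v) = f \<bullet> v" if v: "v \<in> carrier_vec n" for v
  proof -
    have "(F0 - outer u e) *\<^sub>v v = F0 *\<^sub>v v - outer u e *\<^sub>v v"
      using v by (intro minus_mult_distrib_mat_vec[of _ m n]) auto
    moreover have "outer u e *\<^sub>v v = (e \<bullet> v) \<cdot>\<^sub>v u"
      by (rule outer_mult_vec) (simp add: v carrier_vecD[OF carr(7)])
    moreover have "F0 *\<^sub>v v \<in> carrier_vec m" by (rule mult_mat_vec_carrier[OF F0 v])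
    ultimately have "c \<bullet> ((F0 - outer u e) *\<^sub>v v) = c \<bullet> (F0 *\<^sub>v v) - (e \<bullet> v) * \<kappa>"
      using scalar_prod_minus_distrib[of c m "F0 *\<^sub>v v" "(e \<bullet> v) \<cdot>\<^sub>v u"] by (simp add: cu scalar_prod_smult_distrib[of _ m])
    moreover have "c \<bullet> ((F0 - outer u e) *\<^sub>v v) = (f - \<kappa> \<cdot>\<^sub>v e) \<bullet> v"
      unfolding d[symmetric] by (rule transpose_vec_mult_scalar[of _ m n, symmetric]) (use v in auto)
    moreover have "(f - \<kappa> \<cdot>\<^sub>v e) \<bullet> v = f \<bullet> v - \<kappa> * (e \<bullet> v)"
      using v minus_scalar_prod_distrib[of f n "\<kappa> \<cdot>\<^sub>v e" v] by (simp add: smult_scalar_prod_distrib[of _ n])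
    ultimately show ?thesis by (simp add: mult.commute)
  qed
  have q [simp]: "q \<in> carrier_vec n" by (simp add: q_def)
  have "- bilin A f q = dt * (\<kappa> * bilin C e q)"
  proof -
    have "frob A (K * transpose_mat E0 - F0) (outer c q) = - bilin A f q"
      using cK[OF A.mult_carrier[OF q]] F0c[OF A.mult_carrier[OF q]]
      by (simp add: A.frob_diff_left[of _ m]) (simp add: frob_outer[of _ m n] bilin_def)
    moreover have "frob C (outer u e - K * transpose_mat E0) (outer c q) = \<kappa> * bilin C e q"
      using cK[OF C.mult_carrier[OF q]]
      by (simp add: C.frob_diff_left[of _ m] frob_outer_outer[of _ n _ m] cu)
         (simp add: frob_outer[of _ m n])
    ultimately show ?thesis using step[OF c carr(8)] by (simp add: q_def)
  qed
  then have Afq: "bilin A f q = - (dt * \<kappa> * bilin C q q)"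
    using proj[OF carr(8)] by (simp flip: q_def)
  have "\<kappa> * (1 + dt * lo) * A.len q \<le> sqrt (hi / lo) * A.len (f - \<kappa> \<cdot>\<^sub>v e)"
  proof (rule projected_step_estimate[OF carr(7) q f dt _ _ _ Afq])
    show "bilin C q q = bilin C e q" using proj[OF carr(8)] by (simp flip: q_def)
    show "bilin C q f = bilin C e f" using proj[OF f_coeff] by (simp flip: f_def)
  qed (simp add: \<kappa>_def)
  also have "\<dots> \<le> sqrt (hi / lo) * (euclid.len m c * sqrt (frob A (F0 - outer u e) (F0 - outer u e)))"
  proof -
    have "(A.len (f - \<kappa> \<cdot>\<^sub>v e))\<^sup>2 \<le> \<kappa> * frob A (F0 - outer u e) (F0 - outer u e)"
      using A.len_contract_le_frob[of "F0 - outer u e" m c] unfolding d \<kappa>[symmetric] by simp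
    also have "\<dots> = (euclid.len m c * sqrt (frob A (F0 - outer u e) (F0 - outer u e)))\<^sup>2"
      using A.frob_nonneg[of "F0 - outer u e" m] by (simp add: power_mult_distrib \<kappa>_def)
    finally have "A.len (f - \<kappa> \<cdot>\<^sub>v e) \<le> euclid.len m c * sqrt (frob A (F0 - outer u e) (F0 - outer u e))"
      by (rule power2_le_imp_le) (simp add: euclid.len_nonneg A.frob_nonneg[of _ m])
    then show ?thesis using lo lo_le_hi by (intro mult_left_mono) auto
  qed
  finally have main: "\<kappa> * (1 + dt * lo) * A.len q
    \<le> sqrt (hi / lo) * (euclid.len m c * sqrt (frob A (F0 - outer u e) (F0 - outer u e)))" .
  show ?thesis
  proof (rule cancel_common_factor[where q = "A.len q"])
    show "euclid.len m c * euclid.len m c * (1 + dt * lo) * A.len q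
        \<le> sqrt (hi / lo) * (euclid.len m c * sqrt (frob A (F0 - outer u e) (F0 - outer u e)))"
      using main by (simp only: \<kappa>_def power2_eq_square)
    show "0 < 1 + dt * lo" using dt lo by (simp add: add_pos_nonneg)
  qed (use lo lo_le_hi \<alpha> large in \<open>auto simp: A.len_nonneg euclid.len_nonneg A.frob_nonneg[of _ m]\<close>)
qed

text \<open>
  Contracting the L-equation with \<open>z\<close>, the projection of \<open>u\<close> onto the columns of \<open>U0\<close>, turns it into an
  implicit Euler step for \<open>g = h - \<zeta> e\<close> started from \<open>d = D\<^sup>T z\<close>, where \<open>D\<close> is the error of the old iterate,
  \<open>h\<close> is the contraction of \<open>U0 L\<^sup>T\<close>, and \<open>\<zeta> = \<bar>z\<bar>\<^sup>2 = z \<bullet> u\<close>. Since \<open>h\<close> lies in the column space of \<open>E1\<close>, the vector \<open>g\<close> is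
  at least as long as \<open>\<zeta>\<close> times the residual of \<open>e\<close>; one factor \<open>\<bar>z\<bar>\<close> cancels.
\<close>
lemma L_step_estimate:
  fixes U0 S0 E0 L E1 RL :: "real mat" and u e :: "real vec" and m r :: nat
  defines "F0 \<equiv> U0 * S0 * transpose_mat E0"
    and "c \<equiv> e - A.proj E1 e" and "z \<equiv> euclid.proj m U0 u"
  assumes carr: "U0 \<in> carrier_mat m r" "S0 \<in> carrier_mat r r" "E0 \<in> carrier_mat n r"
      "E1 \<in> carrier_mat n r" "RL \<in> carrier_mat r r"
      "u \<in> carrier_vec m" "e \<in> carrier_vec n"
    and dt: "0 \<le> dt" and \<beta>: "0 < \<beta>"
    and L: "L = E1 * RL" and orth: "transpose_mat U0 * U0 = 1\<^sub>m r"
      "transpose_mat E1 * A * E1 = 1\<^sub>m r"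
    and large: "\<beta> * euclid.len m u \<le> euclid.len m z"
    and step: "\<And>w b. w \<in> carrier_vec n \<Longrightarrow> b \<in> carrier_vec r \<Longrightarrow>
      frob A (U0 * transpose_mat L - F0) (outer (U0 *\<^sub>v b) w)
        = dt * frob C (outer u e - U0 * transpose_mat L) (outer (U0 *\<^sub>v b) w)"
  shows "euclid.len m u * A.len c
    \<le> 1 / (\<beta> * (1 + dt * lo)) * sqrt (frob A (F0 - outer u e) (F0 - outer u e))"
proof -
  note [simp] = carr
  have orth': "transpose_mat U0 * 1\<^sub>m m * U0 = 1\<^sub>m r"
    using orth right_mult_one_mat[of "transpose_mat U0" r m] by simp
  define b where "b = transpose_mat U0 *\<^sub>v u"
  have b [simp]: "b \<in> carrier_vec r"
    unfolding b_def by (rule mult_mat_vec_carrier[of _ r m]) simp_all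
  have z_eq: "z = U0 *\<^sub>v b" by (simp add: z_def euclid.proj_def b_def)
  have z [simp]: "z \<in> carrier_vec m"
    by (simp add: z_def euclid.proj_carrier[OF carr(1) orth'])
  have c [simp]: "c \<in> carrier_vec n"
    by (simp add: c_def A.proj_carrier[OF carr(4) orth(2)])
  have F0 [simp]: "F0 \<in> carrier_mat m n"
    unfolding F0_def by (rule mult_carrier_mat[of _ m r] mult_carrier_mat[of U0 m r] | simp)+
  have Lc [simp]: "L \<in> carrier_mat n r"
    unfolding L by (rule mult_carrier_mat[of _ n r]) simp_all
  have UL [simp]: "U0 * transpose_mat L \<in> carrier_mat m n"
    by (rule mult_carrier_mat[of _ m r]) simp_all
  define \<zeta> where "\<zeta> = (euclid.len m z)\<^sup>2"
  have \<zeta>: "\<zeta> = z \<bullet> z" by (simp add: \<zeta>_def euclid.len_sq bilin_one)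
  have zu: "z \<bullet> u = \<zeta>" "u \<bullet> z = \<zeta>"
    using euclid.bilin_proj_self[OF carr(1) orth' carr(6)] comm_scalar_prod[OF z carr(6)]
    by (simp_all add: bilin_one \<zeta> flip: z_def)
  define h where "h = L *\<^sub>v b"
  have Rb: "RL *\<^sub>v b \<in> carrier_vec r" by (rule mult_mat_vec_carrier[OF carr(5) b])
  have h_range: "h = E1 *\<^sub>v (RL *\<^sub>v b)"
    unfolding h_def L by (rule assoc_mult_mat_vec[of _ n r _ r]) simp_all
  have h [simp]: "h \<in> carrier_vec n"
    unfolding h_def by (rule mult_mat_vec_carrier[of _ n r]) simp_all
  define d where "d = transpose_mat (F0 - outer u e) *\<^sub>v z"
  have d [simp]: "d \<in> carrier_vec n"
    unfolding d_def by (rule mult_mat_vec_carrier[of _ n m]) simp_all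
  have hv: "z \<bullet> ((U0 * transpose_mat L) *\<^sub>v v) = h \<bullet> v" if v: "v \<in> carrier_vec n" for v
  proof -
    have Lv: "transpose_mat L *\<^sub>v v \<in> carrier_vec r"
      by (rule mult_mat_vec_carrier[of _ r n]) (simp_all add: v)
    have "(U0 * transpose_mat L) *\<^sub>v v = U0 *\<^sub>v (transpose_mat L *\<^sub>v v)"
      by (rule assoc_mult_mat_vec[of _ m r _ n]) (simp_all add: v)
    then have "z \<bullet> ((U0 * transpose_mat L) *\<^sub>v v) = b \<bullet> (transpose_mat L *\<^sub>v v)"
      using euclid.bilin_range[OF carr(1) orth' b Lv] mult_mat_vec_carrier[OF carr(1) Lv]
      by (simp add: z_eq bilin_one)
    also have "\<dots> = h \<bullet> v"
      unfolding h_def by (rule mult_scalar_transpose[symmetric, of _ n r]) (simp_all add: v)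
    finally show ?thesis .
  qed
  have dv: "z \<bullet> ((F0 - outer u e) *\<^sub>v v) = d \<bullet> v" if v: "v \<in> carrier_vec n" for v
    unfolding d_def by (rule transpose_vec_mult_scalar[of _ m n, symmetric]) (simp_all add: v)
  define g where "g = h - \<zeta> \<cdot>\<^sub>v e"
  have g [simp]: "g \<in> carrier_vec n" by (simp add: g_def)
  have "bilin A (g - d) g + dt * bilin C g g = 0"
  proof -
    have split: "U0 * transpose_mat L - F0
        = (U0 * transpose_mat L - outer u e) - (F0 - outer u e)"
      by (rule eq_matI) (simp_all add: outer_def carrier_matD[OF F0] carrier_matD[OF UL] carrier_vecD[OF carr(6)] carrier_vecD[OF carr(7)])
    have "frob A (U0 * transpose_mat L - outer u e) (outer z g) = bilin A g g"
      using hv[OF A.mult_carrier[OF g]] A.commute[OF h carr(7)]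
      by (simp add: A.frob_diff_left[of _ m] frob_outer_outer[of _ n _ m] zu)
         (simp add: frob_outer[of _ m n] g_def bilin_linear[of _ n] flip: bilin_def)
    moreover have "frob A (F0 - outer u e) (outer z g) = bilin A d g"
      using dv[OF A.mult_carrier[OF g]] by (simp add: frob_outer[of _ m n] bilin_def)
    moreover have "frob C (outer u e - U0 * transpose_mat L) (outer z g) = - bilin C g g"
      using hv[OF C.mult_carrier[OF g]] C.commute[OF h carr(7)]
      by (simp add: C.frob_diff_left[of _ m] frob_outer_outer[of _ n _ m] zu)
         (simp add: frob_outer[of _ m n] g_def bilin_linear[of _ n] flip: bilin_def)
    ultimately show ?thesis
      using step[OF g b] unfolding split z_eq[symmetric]
      by (simp add: A.frob_diff_left[of _ m] bilin_diff_left[of _ n])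
  qed
  from implicit_step_estimate[OF g d dt this]
  have "(1 + dt * lo) * A.len g \<le> A.len d" .
  also have "\<dots> \<le> euclid.len m z * sqrt (frob A (F0 - outer u e) (F0 - outer u e))"
  proof (rule power2_le_imp_le)
    have "(A.len d)\<^sup>2 \<le> \<zeta> * frob A (F0 - outer u e) (F0 - outer u e)"
      unfolding d_def \<zeta> by (rule A.len_contract_le_frob[of _ m]) simp_all
    then show "(A.len d)\<^sup>2 \<le> (euclid.len m z * sqrt (frob A (F0 - outer u e) (F0 - outer u e)))\<^sup>2"
      using A.frob_nonneg[of "F0 - outer u e" m] by (simp add: power_mult_distrib \<zeta>_def)
  qed (simp add: euclid.len_nonneg A.frob_nonneg[of _ m])
  finally have g_le: "(1 + dt * lo) * A.len g
    \<le> euclid.len m z * sqrt (frob A (F0 - outer u e) (F0 - outer u e))" .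
  have "\<zeta> * A.len c \<le> A.len g"
  proof (cases "A.len c = 0")
    case True
    then show ?thesis by (simp add: A.len_nonneg)
  next
    case False
    then have pos: "0 < A.len c" using A.len_nonneg[OF c] by simp
    have "bilin A c g = - \<zeta> * (A.len c)\<^sup>2"
      using A.residual_orthogonal[OF carr(4) orth(2) carr(7) Rb] A.residual_self[OF carr(4) orth(2) carr(7)]
      by (simp add: g_def bilin_linear[of _ n] flip: c_def h_range)
    then have "\<zeta> * A.len c * A.len c \<le> A.len g * A.len c"
      using A.Cauchy_Schwarz[OF c g] by (simp add: power2_eq_square mult_ac)
    with pos show ?thesis by (simp only: mult_le_cancel_right_pos)
  qed
  then have "(1 + dt * lo) * (\<zeta> * A.len c) \<le> (1 + dt * lo) * A.len g"
    using dt lo by (intro mult_left_mono) auto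
  with g_le have main: "euclid.len m z * euclid.len m z * (1 + dt * lo) * A.len c
    \<le> 1 * (euclid.len m z * sqrt (frob A (F0 - outer u e) (F0 - outer u e)))"
    by (simp add: \<zeta>_def power2_eq_square mult_ac)
  have "\<beta> * euclid.len m u * A.len c \<le> euclid.len m z * A.len c"
    by (intro mult_right_mono large A.len_nonneg c)
  also have "\<dots> \<le> 1 / (1 * (1 + dt * lo)) * sqrt (frob A (F0 - outer u e) (F0 - outer u e))"
    by (rule cancel_common_factor[OF main])
       (use dt lo in \<open>auto simp: A.len_nonneg euclid.len_nonneg A.frob_nonneg[of _ m] add_pos_nonneg\<close>)
  finally have "\<beta> * (euclid.len m u * A.len c)
    \<le> 1 / (1 + dt * lo) * sqrt (frob A (F0 - outer u e) (F0 - outer u e))" by (simp add: mult_ac)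
  moreover have "0 < 1 + dt * lo" using dt lo by (simp add: add_pos_nonneg)
  moreover have "x \<le> 1 / (\<beta> * g) * D" if "\<beta> * x \<le> 1 / g * D" "0 < g" for x g D :: real
    using that \<beta> by (simp add: field_simps)
  ultimately show ?thesis by blast
qed

end

section \<open>The discretization in coefficients\<close>

lemma indicator_interval_measurable [simp]:
  fixes a b :: real
  shows "indicat_real {a..b} \<in> borel_measurable lebesgue"
  by (rule borel_measurable_indicator, rule fmeasurableD) simp

lemma set_integrable_bounded:
  fixes f :: "real \<Rightarrow> real"
  assumes "set_borel_measurable lebesgue {a..b} f" "\<And>x. x \<in> {a..b} \<Longrightarrow> \<bar>f x\<bar> \<le> B"
  shows "set_integrable lebesgue {a..b} f"
  unfolding set_integrable_def
proof (rule Bochner_Integration.integrable_bound)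
  have "(\<lambda>x. B) absolutely_integrable_on {a..b}"
    by (rule absolutely_integrable_on_const) simp
  then show "integrable lebesgue (\<lambda>x. B * indicat_real {a..b} x)"
    by (simp add: set_integrable_def mult.commute)
  show "(\<lambda>x. indicat_real {a..b} x *\<^sub>R f x) \<in> borel_measurable lebesgue"
    using assms(1) by (simp add: set_borel_measurable_def)
  show "AE x in lebesgue. norm (indicat_real {a..b} x *\<^sub>R f x) \<le> norm (B * indicat_real {a..b} x)"
    using assms(2) by (intro AE_I2) (force simp: indicator_def)
qed

lemma set_integral_finite_sum:
  fixes f :: "'i \<Rightarrow> real \<Rightarrow> real"
  assumes "\<And>p. p \<in> P \<Longrightarrow> set_integrable M S (f p)"
  shows "set_integrable M S (\<lambda>z. \<Sum>p\<in>P. f p z)"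
    and "(LINT z:S|M. (\<Sum>p\<in>P. f p z)) = (\<Sum>p\<in>P. (LINT z:S|M. f p z))"
  using assms unfolding set_lebesgue_integral_def set_integrable_def scaleR_sum_right
  by (auto intro: Bochner_Integration.integral_sum Bochner_Integration.integrable_sum)

text \<open>
  All integrands of the scheme are finite sums of products of a function of \<open>\<mu>\<close> and a function of \<open>\<epsilon>\<close>, so their
  iterated integrals are evaluated by linearity alone.
\<close>
lemma iterated_integral_separated_sum:
  fixes a b :: "'i \<Rightarrow> real \<Rightarrow> real"
  assumes "finite P" and a: "\<And>p. p \<in> P \<Longrightarrow> set_integrable lebesgue I (a p)"
    and b: "\<And>p. p \<in> P \<Longrightarrow> set_integrable lebesgue J (b p)"
  shows "(LINT \<epsilon>:J|lebesgue. (LINT \<mu>:I|lebesgue. (\<Sum>p\<in>P. a p \<mu> * b p \<epsilon>)))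
    = (\<Sum>p\<in>P. (LINT \<mu>:I|lebesgue. a p \<mu>) * (LINT \<epsilon>:J|lebesgue. b p \<epsilon>))"
proof -
  have "(LINT \<mu>:I|lebesgue. (\<Sum>p\<in>P. a p \<mu> * b p \<epsilon>)) = (\<Sum>p\<in>P. (LINT \<mu>:I|lebesgue. a p \<mu>) * b p \<epsilon>)" for \<epsilon>
    using a by (subst set_integral_finite_sum(2)) (auto intro: set_integrable_mult_left)
  then have "(LINT \<epsilon>:J|lebesgue. (LINT \<mu>:I|lebesgue. (\<Sum>p\<in>P. a p \<mu> * b p \<epsilon>)))
     = (LINT \<epsilon>:J|lebesgue. (\<Sum>p\<in>P. (LINT \<mu>:I|lebesgue. a p \<mu>) * b p \<epsilon>))" by simp
  also have "\<dots> = (\<Sum>p\<in>P. (LINT \<mu>:I|lebesgue. a p \<mu>) * (LINT \<epsilon>:J|lebesgue. b p \<epsilon>))"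
    using b by (subst set_integral_finite_sum(2)) (auto intro: set_integrable_mult_right)
  finally show ?thesis .
qed

lemma definite_mat_inv:
  assumes M: "M \<in> carrier_mat n n"
    and pos: "\<And>v. v \<in> carrier_vec n \<Longrightarrow> bilin M v v = 0 \<Longrightarrow> v = 0\<^sub>v n"
  shows "mat_inv M \<in> carrier_mat n n" "M * mat_inv M = 1\<^sub>m n" "mat_inv M * M = 1\<^sub>m n"
proof -
  have "Determinant.det M \<noteq> 0"
  proof
    assume "Determinant.det M = 0"
    then obtain v where "v \<in> carrier_vec n" "v \<noteq> 0\<^sub>v n" "M *\<^sub>v v = 0\<^sub>v n"
      using det_0_iff_vec_prod_zero_field[OF M] by blast
    then show False using pos[of v] by (simp add: bilin_def)
  qed
  then have "M \<in> Units (ring_mat TYPE(real) n ())" by (rule det_non_zero_imp_unit[OF M])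
  then obtain B where B: "mat_inverse M = Some B" using mat_inverse(1)[OF M, where b = "()"] by (cases "mat_inverse M") auto
  then have "mat_inv M = B" by (simp add: mat_inv_def)
  with mat_inverse(2)[OF M B] show "mat_inv M \<in> carrier_mat n n" "M * mat_inv M = 1\<^sub>m n" "mat_inv M * M = 1\<^sub>m n"
    by auto
qed

lemma recon_diff:
  assumes "F \<in> carrier_mat m n" "G \<in> carrier_mat m n"
  shows "(\<lambda>\<mu> \<epsilon>. recon x y F \<mu> \<epsilon> - recon x y G \<mu> \<epsilon>) = recon x y (F - G)"
  using carrier_matD[OF assms(1)] carrier_matD[OF assms(2)]
  by (auto simp: recon_def fun_eq_iff algebra_simps simp flip: sum_subtractf)

lemma bilin_sum:
  assumes "M \<in> carrier_mat n n" "v \<in> carrier_vec n" "w \<in> carrier_vec n"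
  shows "bilin M v w = (\<Sum>i<n. \<Sum>j<n. v $ i * w $ j * M $$ (i, j))"
  using assms unfolding bilin_def scalar_prod_def lessThan_atLeast0
  by (auto simp: scalar_prod_def sum_distrib_left mult_ac intro!: sum.cong)

lemma frob_definite:
  assumes "D \<in> carrier_mat m n" "frob M D D = 0"
    and nonneg: "\<And>v. v \<in> carrier_vec n \<Longrightarrow> 0 \<le> bilin M v v"
    and definite: "\<And>v. v \<in> carrier_vec n \<Longrightarrow> bilin M v v = 0 \<Longrightarrow> v = 0\<^sub>v n"
  shows "D = 0\<^sub>m m n"
proof -
  have row: "row D i \<in> carrier_vec n" for i by (rule carrier_vecI) (use assms in simp)
  have "\<forall>i\<in>{..<m}. bilin M (row D i) (row D i) = 0"
    using assms(1,2) nonneg[OF row] by (subst sum_nonneg_eq_0_iff[symmetric]) (auto simp: frob_def)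
  then have "row D i = 0\<^sub>v n" if "i < m" for i using definite[OF row] that by simp
  then have "D $$ (i, j) = 0" if "i < m" "j < n" for i j
    using that assms(1) index_row(1)[of i D j] by (metis carrier_matD index_zero_vec(1))
  then show ?thesis using assms(1) by (intro eq_matI) auto
qed

lemma dg_space_sum:
  assumes "finite I" "\<And>i. i \<in> I \<Longrightarrow> v i \<in> dg_space k N r"
  shows "(\<lambda>z. \<Sum>i\<in>I. c i * v i z) \<in> dg_space k N r"
proof -
  have "\<exists>p. degree p \<le> k \<and> (\<forall>z\<in>cell N r j. (\<Sum>i\<in>I. c i * v i z) = poly p z)" if j: "j < N" for j
  proof -
    have "\<forall>i\<in>I. \<exists>p. degree p \<le> k \<and> (\<forall>z\<in>cell N r j. v i z = poly p z)"
      using assms j by (auto simp: dg_space_def)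
    then obtain p where p: "\<And>i. i \<in> I \<Longrightarrow> degree (p i) \<le> k \<and> (\<forall>z\<in>cell N r j. v i z = poly (p i) z)"
      by metis
    let ?q = "\<Sum>i\<in>I. Polynomial.smult (c i) (p i)"
    have "degree ?q \<le> k"
      using p assms(1) by (intro degree_sum_le) (auto intro: order_trans[OF degree_smult_le])
    moreover have "(\<Sum>i\<in>I. c i * v i z) = poly ?q z" if "z \<in> cell N r j" for z
      using p that by (simp add: poly_sum)
    ultimately show ?thesis by blast
  qed
  moreover have "(\<Sum>i\<in>I. c i * v i z) = 0" if "z \<notin> {r 0..r N}" for z
    using assms that by (intro sum.neutral) (auto simp: dg_space_def)
  ultimately show ?thesis by (auto simp: dg_space_def)
qed

locale dg_discretization =
  fixes emax lo hi :: real and eta chi :: "real \<Rightarrow> real"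
    and k N\<mu> N\<epsilon> :: nat and s t :: "nat \<Rightarrow> real"
  assumes emax: "emax > 0"
    and eta_meas: "set_borel_measurable lebesgue {0..emax} eta"
    and eta_L2: "set_integrable lebesgue {0..emax} (\<lambda>\<epsilon>. (eta \<epsilon>)\<^sup>2 * \<epsilon>\<^sup>2)"
    and chi_meas: "set_borel_measurable lebesgue {0..emax} chi"
    and lo: "lo > 0"
    and chi_bounds: "\<And>\<epsilon>. \<epsilon> \<in> {0..emax} \<Longrightarrow> lo \<le> chi \<epsilon> \<and> chi \<epsilon> \<le> hi"
    and part_mu: "is_partition (-1) 1 N\<mu> s"
    and part_eps: "is_partition 0 emax N\<epsilon> t"
begin

definition m where "m = (k + 1) * N\<mu>"
definition n where "n = (k + 1) * N\<epsilon>"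
definition x where "x = legendre_basis k N\<mu> s"
definition y where "y = legendre_basis k N\<epsilon> t"

lemma cells_pos: "0 < N\<mu>" "0 < N\<epsilon>"
  using part_mu part_eps emax by (auto simp: is_partition_def intro!: Nat.gr0I)

lemma y_measurable: "y i \<in> borel_measurable lebesgue"
  and x_measurable: "x i \<in> borel_measurable lebesgue"
  unfolding x_def y_def
  by (rule legendre_basis_measurable[OF part_eps] legendre_basis_measurable[OF part_mu])+

lemma y_bounded: "\<exists>B. \<forall>z. \<bar>y i z\<bar> \<le> B"
  and x_bounded: "\<exists>B. \<forall>z. \<bar>x i z\<bar> \<le> B"
  unfolding x_def y_def
  by (rule legendre_basis_bounded[OF part_eps] legendre_basis_bounded[OF part_mu])+

lemma x_integrable: "set_integrable lebesgue {-1..1} (x i)"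
proof -
  obtain B where "\<And>z. \<bar>x i z\<bar> \<le> B" using x_bounded by blast
  then show ?thesis
    using x_measurable[of i]
    by (intro set_integrable_bounded[of _ _ _ B])
       (auto simp: set_borel_measurable_def intro!: borel_measurable_times)
qed

lemma xx_integrable: "set_integrable lebesgue {-1..1} (\<lambda>z. x i z * x j z)"
proof -
  obtain B B' where "\<And>z. \<bar>x i z\<bar> \<le> B" "\<And>z. \<bar>x j z\<bar> \<le> B'" using x_bounded by metis
  then have "\<And>z. \<bar>x i z * x j z\<bar> \<le> B * B'"
    by (simp add: abs_mult) (meson abs_ge_zero mult_mono order_trans)
  then show ?thesis
    using x_measurable[of i] x_measurable[of j]
    by (intro set_integrable_bounded[of _ _ _ "B * B'"])
       (auto simp: set_borel_measurable_def intro!: borel_measurable_times)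
qed

definition bounded_weight :: "(real \<Rightarrow> real) \<Rightarrow> bool" where
  "bounded_weight \<rho> \<longleftrightarrow> set_borel_measurable lebesgue {0..emax} \<rho> \<and> (\<exists>B. \<forall>\<epsilon>\<in>{0..emax}. \<bar>\<rho> \<epsilon>\<bar> \<le> B)"

lemma bounded_weight_one: "bounded_weight (\<lambda>_. 1)"
  by (auto simp: bounded_weight_def set_borel_measurable_def)

lemma bounded_weight_chi: "bounded_weight chi"
  unfolding bounded_weight_def using chi_meas chi_bounds lo
  by (auto intro!: exI[of _ hi]) (smt (verit))

lemma weighted_integrable:
  assumes "bounded_weight \<rho>"
  shows "set_integrable lebesgue {0..emax} (\<lambda>\<epsilon>. \<rho> \<epsilon> * y i \<epsilon> * y j \<epsilon> * \<epsilon>\<^sup>2)"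
proof -
  obtain B where B: "\<And>\<epsilon>. \<epsilon> \<in> {0..emax} \<Longrightarrow> \<bar>\<rho> \<epsilon>\<bar> \<le> B" using assms unfolding bounded_weight_def by blast
  obtain B1 B2 where B12: "\<And>z. \<bar>y i z\<bar> \<le> B1" "\<And>z. \<bar>y j z\<bar> \<le> B2" using y_bounded by metis
  have B0: "0 \<le> B" "0 \<le> B1" "0 \<le> B2"
    using B[of 0] B12[of 0] emax by (auto intro: order_trans[OF abs_ge_zero])
  show ?thesis
  proof (rule set_integrable_bounded)
    have "(\<lambda>\<epsilon>. indicat_real {0..emax} \<epsilon> *\<^sub>R \<rho> \<epsilon>) \<in> borel_measurable lebesgue"
      using assms by (simp add: bounded_weight_def set_borel_measurable_def)
    then have "(\<lambda>\<epsilon>. (indicat_real {0..emax} \<epsilon> *\<^sub>R \<rho> \<epsilon>) * (y i \<epsilon> * y j \<epsilon> * \<epsilon>\<^sup>2)) \<in> borel_measurable lebesgue"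
      using y_measurable by (intro borel_measurable_times) (auto intro!: measurable_completion)
    then show "set_borel_measurable lebesgue {0..emax} (\<lambda>\<epsilon>. \<rho> \<epsilon> * y i \<epsilon> * y j \<epsilon> * \<epsilon>\<^sup>2)"
      by (simp add: set_borel_measurable_def mult_ac)
    fix \<epsilon> assume \<epsilon>: "\<epsilon> \<in> {0..emax}"
    have "\<bar>\<rho> \<epsilon> * y i \<epsilon> * y j \<epsilon> * \<epsilon>\<^sup>2\<bar> = \<bar>\<rho> \<epsilon>\<bar> * \<bar>y i \<epsilon>\<bar> * \<bar>y j \<epsilon>\<bar> * \<epsilon>\<^sup>2" by (simp add: abs_mult)
    also have "\<dots> \<le> B * B1 * B2 * emax\<^sup>2"
      using B[OF \<epsilon>] B12[of \<epsilon>] B0 \<epsilon> by (intro mult_mono power_mono) auto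
    finally show "\<bar>\<rho> \<epsilon> * y i \<epsilon> * y j \<epsilon> * \<epsilon>\<^sup>2\<bar> \<le> B * B1 * B2 * emax\<^sup>2" .
  qed
qed

text \<open>
  The emissivity is only square integrable; the product with a basis function is dominated by the sum of the two
  squares.
\<close>
lemma eta_integrable: "set_integrable lebesgue {0..emax} (\<lambda>\<epsilon>. eta \<epsilon> * y j \<epsilon> * \<epsilon>\<^sup>2)"
  unfolding set_integrable_def
proof (rule Bochner_Integration.integrable_bound)
  have one: "set_integrable lebesgue {0..emax} (\<lambda>\<epsilon>. 1 * y j \<epsilon> * y j \<epsilon> * \<epsilon>\<^sup>2)"
    by (rule weighted_integrable[OF bounded_weight_one])
  show "integrable lebesgue (\<lambda>\<epsilon>. indicat_real {0..emax} \<epsilon> *\<^sub>R ((eta \<epsilon>)\<^sup>2 * \<epsilon>\<^sup>2 + 1 * y j \<epsilon> * y j \<epsilon> * \<epsilon>\<^sup>2))"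
    using set_integral_add(1)[OF eta_L2 one] by (simp add: set_integrable_def)
  have "(\<lambda>\<epsilon>. (indicat_real {0..emax} \<epsilon> *\<^sub>R eta \<epsilon>) * (y j \<epsilon> * \<epsilon>\<^sup>2)) \<in> borel_measurable lebesgue"
    using y_measurable eta_meas
    by (intro borel_measurable_times) (auto intro!: measurable_completion simp: set_borel_measurable_def)
  then show "(\<lambda>\<epsilon>. indicat_real {0..emax} \<epsilon> *\<^sub>R (eta \<epsilon> * y j \<epsilon> * \<epsilon>\<^sup>2)) \<in> borel_measurable lebesgue"
    by (simp add: mult_ac)
  have "\<bar>eta \<epsilon> * y j \<epsilon> * \<epsilon>\<^sup>2\<bar> \<le> (eta \<epsilon>)\<^sup>2 * \<epsilon>\<^sup>2 + 1 * y j \<epsilon> * y j \<epsilon> * \<epsilon>\<^sup>2" for \<epsilon>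
  proof -
    have "0 \<le> (\<bar>eta \<epsilon>\<bar> - \<bar>y j \<epsilon>\<bar>)\<^sup>2 + (eta \<epsilon>)\<^sup>2 + (y j \<epsilon>)\<^sup>2" by simp
    then have "\<bar>eta \<epsilon> * y j \<epsilon>\<bar> \<le> (eta \<epsilon>)\<^sup>2 + (y j \<epsilon>)\<^sup>2"
      by (simp add: power2_diff abs_mult)
    from mult_right_mono[OF this, of "\<epsilon>\<^sup>2"]
    have "\<bar>eta \<epsilon> * y j \<epsilon>\<bar> * \<epsilon>\<^sup>2 \<le> ((eta \<epsilon>)\<^sup>2 + (y j \<epsilon>)\<^sup>2) * \<epsilon>\<^sup>2" by simp
    moreover have "\<bar>eta \<epsilon> * y j \<epsilon> * \<epsilon>\<^sup>2\<bar> = \<bar>eta \<epsilon> * y j \<epsilon>\<bar> * \<epsilon>\<^sup>2" by (simp add: abs_mult)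
    ultimately show ?thesis by (simp add: distrib_right power2_eq_square)
  qed
  then show "AE \<epsilon> in lebesgue. norm (indicat_real {0..emax} \<epsilon> *\<^sub>R (eta \<epsilon> * y j \<epsilon> * \<epsilon>\<^sup>2))
      \<le> norm (indicat_real {0..emax} \<epsilon> *\<^sub>R ((eta \<epsilon>)\<^sup>2 * \<epsilon>\<^sup>2 + 1 * y j \<epsilon> * y j \<epsilon> * \<epsilon>\<^sup>2))"
    by (intro AE_I2) (force simp: indicator_def)
qed

abbreviation mass where "mass \<equiv> mass_mat emax n y"

lemma mass_carrier [simp]: "mass \<rho> \<in> carrier_mat n n"
  by (simp add: mass_mat_def)

lemma mass_symmetric: "transpose_mat (mass \<rho>) = mass \<rho>"
  by (intro eq_matI) (auto simp: mass_mat_def mult_ac)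

definition eps_fun :: "real vec \<Rightarrow> real \<Rightarrow> real" where
  "eps_fun v \<epsilon> = (\<Sum>j<n. v $ j * y j \<epsilon>)"

lemma mass_form:
  assumes "bounded_weight \<rho>" "v \<in> carrier_vec n" "w \<in> carrier_vec n"
  shows "set_integrable lebesgue {0..emax} (\<lambda>\<epsilon>. \<rho> \<epsilon> * eps_fun v \<epsilon> * eps_fun w \<epsilon> * \<epsilon>\<^sup>2)"
    and "bilin (mass \<rho>) v w = (LINT \<epsilon>:{0..emax}|lebesgue. \<rho> \<epsilon> * eps_fun v \<epsilon> * eps_fun w \<epsilon> * \<epsilon>\<^sup>2)"
proof -
  have eq: "(\<lambda>\<epsilon>. \<rho> \<epsilon> * eps_fun v \<epsilon> * eps_fun w \<epsilon> * \<epsilon>\<^sup>2)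
      = (\<lambda>\<epsilon>. \<Sum>i<n. \<Sum>j<n. v $ i * w $ j * (\<rho> \<epsilon> * y i \<epsilon> * y j \<epsilon> * \<epsilon>\<^sup>2))"
    by (simp add: eps_fun_def sum_distrib_left sum_distrib_right mult_ac fun_eq_iff)
  have int: "set_integrable lebesgue {0..emax} (\<lambda>\<epsilon>. v $ i * w $ j * (\<rho> \<epsilon> * y i \<epsilon> * y j \<epsilon> * \<epsilon>\<^sup>2))" for i j
    by (intro set_integrable_mult_right weighted_integrable assms)
  show "set_integrable lebesgue {0..emax} (\<lambda>\<epsilon>. \<rho> \<epsilon> * eps_fun v \<epsilon> * eps_fun w \<epsilon> * \<epsilon>\<^sup>2)"
    unfolding eq by (intro set_integral_finite_sum(1) int)
  have "(LINT \<epsilon>:{0..emax}|lebesgue. \<rho> \<epsilon> * eps_fun v \<epsilon> * eps_fun w \<epsilon> * \<epsilon>\<^sup>2)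
      = (\<Sum>i<n. \<Sum>j<n. LINT \<epsilon>:{0..emax}|lebesgue. v $ i * w $ j * (\<rho> \<epsilon> * y i \<epsilon> * y j \<epsilon> * \<epsilon>\<^sup>2))"
    unfolding eq by (simp only: set_integral_finite_sum int)
  also have "\<dots> = bilin (mass \<rho>) v w"
    using assms by (simp add: bilin_sum[of _ n] mass_mat_def)
  finally show "bilin (mass \<rho>) v w = (LINT \<epsilon>:{0..emax}|lebesgue. \<rho> \<epsilon> * eps_fun v \<epsilon> * eps_fun w \<epsilon> * \<epsilon>\<^sup>2)" ..
qed

lemma eps_fun_coefficient:
  assumes "i < n"
  shows "(LINT \<epsilon>:{0..emax}|lebesgue. eps_fun v \<epsilon> * y i \<epsilon>) = v $ i"
proof -
  have int: "set_integrable lebesgue {0..emax} (\<lambda>\<epsilon>. y j \<epsilon> * y i \<epsilon>)" for j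
  proof -
    obtain B B' where "\<And>z. \<bar>y j z\<bar> \<le> B" "\<And>z. \<bar>y i z\<bar> \<le> B'" using y_bounded by metis
    then have "\<And>z. \<bar>y j z * y i z\<bar> \<le> B * B'"
      by (simp add: abs_mult) (meson abs_ge_zero mult_mono order_trans)
    then show ?thesis
      using y_measurable[of i] y_measurable[of j]
      by (intro set_integrable_bounded[of _ _ _ "B * B'"])
         (auto simp: set_borel_measurable_def intro!: borel_measurable_times)
  qed
  have "(LINT \<epsilon>:{0..emax}|lebesgue. eps_fun v \<epsilon> * y i \<epsilon>)
      = (LINT \<epsilon>:{0..emax}|lebesgue. (\<Sum>j<n. v $ j * (y j \<epsilon> * y i \<epsilon>)))"
    by (simp add: eps_fun_def sum_distrib_right mult.assoc)
  also have "\<dots> = (\<Sum>j<n. v $ j * (LINT \<epsilon>:{0..emax}|lebesgue. y j \<epsilon> * y i \<epsilon>))"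
    by (subst set_integral_finite_sum) (auto intro!: set_integrable_mult_right int)
  also have "\<dots> = (\<Sum>j<n. if j = i then v $ j else 0)"
    using assms unfolding y_def n_def
    by (intro sum.cong refl) (subst legendre_basis_orthonormal[OF part_eps], auto)
  also have "\<dots> = v $ i" using assms by simp
  finally show ?thesis .
qed

lemma mass_one_nonneg:
  assumes "v \<in> carrier_vec n"
  shows "0 \<le> bilin (mass (\<lambda>_. 1)) v v"
proof -
  have "0 \<le> 1 * eps_fun v \<epsilon> * eps_fun v \<epsilon> * \<epsilon>\<^sup>2" for \<epsilon> by (simp add: mult.assoc[symmetric])
  then show ?thesis
    unfolding mass_form(2)[OF bounded_weight_one assms assms] set_lebesgue_integral_def
    by (intro Bochner_Integration.integral_nonneg scaleR_nonneg_nonneg) simp_all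
qed

text \<open>
  If \<open>\<integral> v\<^sup>2 \<epsilon>\<^sup>2 = 0\<close> then \<open>v\<close> vanishes almost everywhere, the zero of the weight at \<open>\<epsilon> = 0\<close> being a null set.
  The coefficients of \<open>v\<close> are its inner products with the orthonormal basis, so they vanish as well.
\<close>
lemma mass_one_definite:
  assumes v: "v \<in> carrier_vec n" and zero: "bilin (mass (\<lambda>_. 1)) v v = 0"
  shows "v = 0\<^sub>v n"
proof -
  let ?h = "\<lambda>\<epsilon>. indicat_real {0..emax} \<epsilon> *\<^sub>R (1 * eps_fun v \<epsilon> * eps_fun v \<epsilon> * \<epsilon>\<^sup>2)"
  have "AE \<epsilon> in lebesgue. ?h \<epsilon> = 0"
  proof (subst integral_nonneg_eq_0_iff_AE[symmetric])
    show "integrable lebesgue ?h"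
      using mass_form(1)[OF bounded_weight_one v v] by (simp add: set_integrable_def)
    show "AE \<epsilon> in lebesgue. 0 \<le> ?h \<epsilon>" by (simp add: indicator_def)
    show "integral\<^sup>L lebesgue ?h = 0"
      using zero mass_form(2)[OF bounded_weight_one v v] by (simp add: set_lebesgue_integral_def)
  qed
  moreover have "AE \<epsilon> in lebesgue. \<epsilon> \<noteq> (0 :: real)"
    by (rule AE_completion) (rule AE_lborel_singleton)
  ultimately have ae: "AE \<epsilon> in lebesgue. indicat_real {0..emax} \<epsilon> *\<^sub>R (eps_fun v \<epsilon> * y i \<epsilon>) = 0" for i
    by eventually_elim (auto simp: indicator_def)
  have "v $ i = 0" if "i < n" for i
  proof -
    have "v $ i = (LINT \<epsilon>:{0..emax}|lebesgue. eps_fun v \<epsilon> * y i \<epsilon>)" using eps_fun_coefficient[OF that] ..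
    also have "\<dots> = 0"
      unfolding set_lebesgue_integral_def by (rule integral_eq_zero_AE[OF ae])
    finally show ?thesis .
  qed
  then show ?thesis using v by (intro eq_vecI) auto
qed

lemma chi_form_bounds:
  assumes v: "v \<in> carrier_vec n"
  shows "lo * bilin (mass (\<lambda>_. 1)) v v \<le> bilin (mass chi) v v"
    and "bilin (mass chi) v v \<le> hi * bilin (mass (\<lambda>_. 1)) v v"
proof -
  let ?A = "\<lambda>\<epsilon>. 1 * eps_fun v \<epsilon> * eps_fun v \<epsilon> * \<epsilon>\<^sup>2"
  let ?C = "\<lambda>\<epsilon>. chi \<epsilon> * eps_fun v \<epsilon> * eps_fun v \<epsilon> * \<epsilon>\<^sup>2"
  note A = mass_form[OF bounded_weight_one v v] and C = mass_form[OF bounded_weight_chi v v]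
  have "0 \<le> ?A \<epsilon>" for \<epsilon> by (simp add: mult.assoc[symmetric])
  then have bd: "lo * ?A \<epsilon> \<le> ?C \<epsilon>" "?C \<epsilon> \<le> hi * ?A \<epsilon>" if "\<epsilon> \<in> {0..emax}" for \<epsilon>
    using mult_right_mono[of lo "chi \<epsilon>" "?A \<epsilon>"] mult_right_mono[of "chi \<epsilon>" hi "?A \<epsilon>"] chi_bounds[OF that]
    by (simp_all add: mult.assoc)
  have "(LINT \<epsilon>:{0..emax}|lebesgue. lo * ?A \<epsilon>) \<le> (LINT \<epsilon>:{0..emax}|lebesgue. ?C \<epsilon>)"
    by (intro set_integral_mono set_integrable_mult_right A(1) C(1) bd)
  then show "lo * bilin (mass (\<lambda>_. 1)) v v \<le> bilin (mass chi) v v" by (simp only: A(2) C(2) set_integral_mult_right)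
  have "(LINT \<epsilon>:{0..emax}|lebesgue. ?C \<epsilon>) \<le> (LINT \<epsilon>:{0..emax}|lebesgue. hi * ?A \<epsilon>)"
    by (intro set_integral_mono set_integrable_mult_right A(1) C(1) bd)
  then show "bilin (mass chi) v v \<le> hi * bilin (mass (\<lambda>_. 1)) v v" by (simp only: A(2) C(2) set_integral_mult_right)
qed

sublocale equivalent_forms n "mass (\<lambda>_. 1)" "mass chi" lo hi
proof unfold_locales
  show "lo \<le> hi" using chi_bounds[of 0] emax by simp
  show "0 \<le> bilin (mass chi) v v" if "v \<in> carrier_vec n" for v
    using chi_form_bounds(1)[OF that] mass_one_nonneg[OF that] lo
    by (meson mult_nonneg_nonneg less_imp_le order_trans)
qed (auto simp: mass_symmetric mass_one_nonneg chi_form_bounds lo)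

lemma chi_definite:
  assumes v: "v \<in> carrier_vec n" and zero: "bilin (mass chi) v v = 0"
  shows "v = 0\<^sub>v n"
proof (rule mass_one_definite[OF v])
  have "lo * bilin (mass (\<lambda>_. 1)) v v \<le> 0" using chi_form_bounds(1)[OF v] zero by simp
  then show "bilin (mass (\<lambda>_. 1)) v v = 0"
    using mass_one_nonneg[OF v] lo by (simp add: mult_le_0_iff)
qed

definition index_pairs :: "(nat \<times> nat) set" where
  "index_pairs = {..<m} \<times> {..<n}"

lemma recon_eq:
  assumes "F \<in> carrier_mat m n"
  shows "recon x y F \<mu> \<epsilon> = (\<Sum>p\<in>index_pairs. x (fst p) \<mu> * F $$ p * y (snd p) \<epsilon>)"
proof -
  have "recon x y F \<mu> \<epsilon> = (\<Sum>i<m. \<Sum>j<n. x i \<mu> * F $$ (i, j) * y j \<epsilon>)"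
    by (simp only: recon_def carrier_matD[OF assms])
  then show ?thesis by (simp only: index_pairs_def sum.cartesian_product' fst_conv snd_conv)
qed

lemma x_orthonormal:
  assumes "i < m" "j < m"
  shows "(LINT \<mu>:{-1..1}|lebesgue. x i \<mu> * x j \<mu>) = (if i = j then 1 else 0)"
  using assms unfolding x_def m_def by (rule legendre_basis_orthonormal[OF part_mu])

lemma weighted_inner_recon:
  assumes F: "F \<in> carrier_mat m n" and G: "G \<in> carrier_mat m n" and \<rho>: "bounded_weight \<rho>"
  shows "weighted_inner emax (\<lambda>\<mu> \<epsilon>. \<rho> \<epsilon> * recon x y F \<mu> \<epsilon>) (recon x y G) = frob (mass \<rho>) F G"
proof -
  let ?P = "index_pairs \<times> index_pairs"
  let ?a = "\<lambda>p \<mu>. x (fst (fst p)) \<mu> * x (fst (snd p)) \<mu>"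
  let ?b = "\<lambda>p \<epsilon>. F $$ fst p * G $$ snd p * (\<rho> \<epsilon> * y (snd (fst p)) \<epsilon> * y (snd (snd p)) \<epsilon> * \<epsilon>\<^sup>2)"
  have "\<rho> \<epsilon> * recon x y F \<mu> \<epsilon> * recon x y G \<mu> \<epsilon> * \<epsilon>\<^sup>2 = (\<Sum>p\<in>?P. ?a p \<mu> * ?b p \<epsilon>)" for \<mu> \<epsilon>
  proof -
    have "recon x y F \<mu> \<epsilon> * recon x y G \<mu> \<epsilon>
      = (\<Sum>p\<in>?P. (x (fst (fst p)) \<mu> * F $$ fst p * y (snd (fst p)) \<epsilon>) *
          (x (fst (snd p)) \<mu> * G $$ snd p * y (snd (snd p)) \<epsilon>))"
      by (simp add: recon_eq[OF F] recon_eq[OF G] sum_product sum.cartesian_product case_prod_beta)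
    then have "\<rho> \<epsilon> * recon x y F \<mu> \<epsilon> * recon x y G \<mu> \<epsilon> * \<epsilon>\<^sup>2
      = \<rho> \<epsilon> * (\<Sum>p\<in>?P. (x (fst (fst p)) \<mu> * F $$ fst p * y (snd (fst p)) \<epsilon>) *
          (x (fst (snd p)) \<mu> * G $$ snd p * y (snd (snd p)) \<epsilon>)) * \<epsilon>\<^sup>2"
      by (simp only: mult.assoc)
    also have "\<dots> = (\<Sum>p\<in>?P. ?a p \<mu> * ?b p \<epsilon>)"
      unfolding sum_distrib_left sum_distrib_right by (intro sum.cong) (simp_all only: mult_ac)
    finally show ?thesis .
  qed
  then have "weighted_inner emax (\<lambda>\<mu> \<epsilon>. \<rho> \<epsilon> * recon x y F \<mu> \<epsilon>) (recon x y G)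
      = (LINT \<epsilon>:{0..emax}|lebesgue. (LINT \<mu>:{-1..1}|lebesgue. (\<Sum>p\<in>?P. ?a p \<mu> * ?b p \<epsilon>)))"
    by (simp only: weighted_inner_def)
  also have "\<dots> = (\<Sum>p\<in>?P. (LINT \<mu>:{-1..1}|lebesgue. ?a p \<mu>) * (LINT \<epsilon>:{0..emax}|lebesgue. ?b p \<epsilon>))"
    by (intro iterated_integral_separated_sum xx_integrable set_integrable_mult_right
        weighted_integrable \<rho>) (simp add: index_pairs_def)
  also have "\<dots> = (\<Sum>p\<in>?P. (if fst (fst p) = fst (snd p) then
      F $$ fst p * G $$ snd p * mass \<rho> $$ (snd (fst p), snd (snd p)) else 0))"
    by (intro sum.cong) (auto simp: index_pairs_def x_orthonormal mass_mat_def)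
  also have "\<dots> = (\<Sum>i<m. \<Sum>j<n. \<Sum>i'<m. \<Sum>l<n. if i = i' then F $$ (i, j) * G $$ (i', l) * mass \<rho> $$ (j, l) else 0)"
    unfolding index_pairs_def sum.cartesian_product' by (simp cong: if_cong)
  also have "\<dots> = (\<Sum>i<m. \<Sum>j<n. \<Sum>l<n. F $$ (i, j) * G $$ (i, l) * mass \<rho> $$ (j, l))"
  proof -
    have "(\<Sum>i'<m. \<Sum>l<n. if i = i' then h i' l else 0) = (\<Sum>l<n. h i l)"
      if "i < m" for i and h :: "nat \<Rightarrow> nat \<Rightarrow> real"
      using that by (subst sum.swap) simp
    then show ?thesis by (intro sum.cong[OF refl]) (simp only: lessThan_iff)
  qed
  also have "\<dots> = frob (mass \<rho>) F G"
    unfolding frob_def using F G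
    by (intro sum.cong) (auto simp: bilin_sum[of _ n] intro!: sum.cong)
  finally show ?thesis .
qed

text \<open>
  The equilibrium has the coefficient matrix \<open>outer u e\<close>: \<open>u\<close> expands the constant \<open>1\<close> in \<open>\<mu>\<close> and \<open>e\<close> the
  discrete quotient of emissivity and opacity in \<open>\<epsilon>\<close>.
\<close>
definition u where "u = vec m (\<lambda>i. LINT \<mu>:{-1..1}|lebesgue. x i \<mu>)"
definition load_vec where "load_vec = vec n (\<lambda>j. LINT \<epsilon>:{0..emax}|lebesgue. eta \<epsilon> * y j \<epsilon> * \<epsilon>\<^sup>2)"
definition e where "e = mat_inv (mass chi) *\<^sub>v load_vec"

lemmas chi_inverse = definite_mat_inv[of "mass chi" n, OF mass_carrier chi_definite]

lemma u_carrier [simp]: "u \<in> carrier_vec m" by (simp add: u_def)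
lemma load_vec_carrier [simp]: "load_vec \<in> carrier_vec n" by (simp add: load_vec_def)
lemma e_carrier [simp]: "e \<in> carrier_vec n"
  unfolding e_def by (rule mult_mat_vec_carrier[OF chi_inverse(1) load_vec_carrier])

lemma chi_mult_e: "mass chi *\<^sub>v e = load_vec"
  using assoc_mult_mat_vec[OF mass_carrier[of chi] chi_inverse(1) load_vec_carrier] chi_inverse(2)
  by (simp add: e_def)

text \<open>
  The source acts on the discrete space like \<open>\<chi>\<close> times the discrete equilibrium, because \<open>mass chi *\<^sub>v e\<close>
  is the load vector. This is what makes \<open>Aform\<close> homogeneous in the distance to equilibrium.
\<close>
lemma weighted_inner_eta:
  assumes G: "G \<in> carrier_mat m n"
  shows "weighted_inner emax (\<lambda>\<mu> \<epsilon>. eta \<epsilon>) (recon x y G) = frob (mass chi) (outer u e) G"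
proof -
  let ?b = "\<lambda>p \<epsilon>. G $$ p * (eta \<epsilon> * y (snd p) \<epsilon> * \<epsilon>\<^sup>2)"
  have "eta \<epsilon> * recon x y G \<mu> \<epsilon> * \<epsilon>\<^sup>2 = (\<Sum>p\<in>index_pairs. x (fst p) \<mu> * ?b p \<epsilon>)" for \<mu> \<epsilon>
    unfolding recon_eq[OF G] sum_distrib_left sum_distrib_right
    by (intro sum.cong) (simp_all only: mult_ac)
  then have "weighted_inner emax (\<lambda>\<mu> \<epsilon>. eta \<epsilon>) (recon x y G)
      = (LINT \<epsilon>:{0..emax}|lebesgue. (LINT \<mu>:{-1..1}|lebesgue. (\<Sum>p\<in>index_pairs. x (fst p) \<mu> * ?b p \<epsilon>)))"
    by (simp only: weighted_inner_def)
  also have "\<dots> = (\<Sum>p\<in>index_pairs. (LINT \<mu>:{-1..1}|lebesgue. x (fst p) \<mu>) * (LINT \<epsilon>:{0..emax}|lebesgue. ?b p \<epsilon>))"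
    by (intro iterated_integral_separated_sum x_integrable set_integrable_mult_right eta_integrable)
       (simp add: index_pairs_def)
  also have "\<dots> = (\<Sum>p\<in>index_pairs. u $ fst p * (G $$ p * load_vec $ snd p))"
    by (intro sum.cong) (auto simp: index_pairs_def u_def load_vec_def)
  also have "\<dots> = (\<Sum>i<m. \<Sum>j<n. u $ i * (G $$ (i, j) * load_vec $ j))"
    by (simp add: index_pairs_def sum.cartesian_product case_prod_beta)
  also have "\<dots> = u \<bullet> (G *\<^sub>v load_vec)"
    unfolding scalar_prod_def[of u] lessThan_atLeast0 using G
    by (auto simp: scalar_prod_def sum_distrib_left carrier_vecD[OF load_vec_carrier] intro!: sum.cong)
  also have "\<dots> = frob (mass chi) G (outer u e)"
    using frob_outer[OF G mass_carrier u_carrier e_carrier] by (simp add: chi_mult_e)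
  also have "\<dots> = frob (mass chi) (outer u e) G"
    by (rule C.frob_commute[OF G]) simp
  finally show ?thesis .
qed

lemma Aform_recon:
  assumes "F \<in> carrier_mat m n" "G \<in> carrier_mat m n"
  shows "Aform emax eta chi (recon x y F) (recon x y G) = frob (mass chi) (outer u e - F) G"
proof -
  have "Aform emax eta chi (recon x y F) (recon x y G)
      = frob (mass chi) (outer u e) G - frob (mass chi) F G"
    by (simp only: Aform_def weighted_inner_eta[OF assms(2)] weighted_inner_recon[OF assms bounded_weight_chi])
  also have "\<dots> = frob (mass chi) (outer u e - F) G"
    by (rule C.frob_diff_left[symmetric, of _ m]) (simp_all add: assms)
  finally show ?thesis .
qed

lemma weighted_inner_recon_one:
  assumes "F \<in> carrier_mat m n" "G \<in> carrier_mat m n"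
  shows "weighted_inner emax (recon x y F) (recon x y G) = frob (mass (\<lambda>_. 1)) F G"
  using weighted_inner_recon[OF assms bounded_weight_one] by (simp only: mult_1)

abbreviation V where "V \<equiv> tensor_space (dg_space k N\<mu> s) (dg_space k N\<epsilon> t)"

lemma recon_in_tensor_space:
  assumes G: "G \<in> carrier_mat m n"
  shows "recon x y G \<in> V"
proof -
  have "x i \<in> dg_space k N\<mu> s \<and> (\<lambda>\<epsilon>. \<Sum>j<n. G $$ (i, j) * y j \<epsilon>) \<in> dg_space k N\<epsilon> t" if "i < m" for i
    using that unfolding x_def y_def m_def n_def
    by (auto intro!: dg_space_sum legendre_basis_in_dg_space[OF part_mu] legendre_basis_in_dg_space[OF part_eps])
  moreover have "recon x y G = (\<lambda>\<mu> \<epsilon>. \<Sum>i<m. x i \<mu> * (\<Sum>j<n. G $$ (i, j) * y j \<epsilon>))"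
    using G by (simp add: recon_def sum_distrib_left mult.assoc)
  ultimately show ?thesis
    unfolding tensor_space_def
    by (intro CollectI exI[of _ m] exI[of _ x] exI[of _ "\<lambda>i \<epsilon>. \<Sum>j<n. G $$ (i, j) * y j \<epsilon>"])
       simp
qed

lemma tensor_space_is_recon:
  assumes "f \<in> V"
  shows "\<exists>F\<in>carrier_mat m n. f = recon x y F"
proof -
  obtain p :: nat and v w where vw: "\<forall>i<p. v i \<in> dg_space k N\<mu> s \<and> w i \<in> dg_space k N\<epsilon> t"
    and f: "f = (\<lambda>\<mu> \<epsilon>. \<Sum>i<p. v i \<mu> * w i \<epsilon>)"
    using assms unfolding tensor_space_def by blast
  have "\<forall>i\<in>{..<p}. \<exists>c. v i = (\<lambda>z. \<Sum>j<m. c j * x j z)"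
    unfolding x_def m_def using vw by (intro ballI dg_space_spanned[OF part_mu cells_pos(1)]) simp
  from bchoice[OF this] obtain c where c: "\<forall>i\<in>{..<p}. v i = (\<lambda>z. \<Sum>j<m. c i j * x j z)" ..
  have "\<forall>i\<in>{..<p}. \<exists>c. w i = (\<lambda>z. \<Sum>j<n. c j * y j z)"
    unfolding y_def n_def using vw by (intro ballI dg_space_spanned[OF part_eps cells_pos(2)]) simp
  from bchoice[OF this] obtain d where d: "\<forall>i\<in>{..<p}. w i = (\<lambda>z. \<Sum>j<n. d i j * y j z)" ..
  let ?F = "mat m n (\<lambda>(j, l). \<Sum>i<p. c i j * d i l)"
  have "f = recon x y ?F"
  proof (intro ext)
    fix \<mu> \<epsilon>
    have "f \<mu> \<epsilon> = (\<Sum>i<p. \<Sum>j<m. \<Sum>l<n. c i j * x j \<mu> * (d i l * y l \<epsilon>))"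
    proof -
      have "v i \<mu> * w i \<epsilon> = (\<Sum>j<m. \<Sum>l<n. c i j * x j \<mu> * (d i l * y l \<epsilon>))" if "i < p" for i
        using c d that by (simp only: lessThan_iff sum_product)
      then show ?thesis unfolding f by (intro sum.cong[OF refl]) (simp only: lessThan_iff)
    qed
    also have "\<dots> = (\<Sum>j<m. \<Sum>i<p. \<Sum>l<n. c i j * x j \<mu> * (d i l * y l \<epsilon>))"
      by (rule sum.swap)
    also have "\<dots> = (\<Sum>j<m. \<Sum>l<n. \<Sum>i<p. c i j * x j \<mu> * (d i l * y l \<epsilon>))"
      by (rule sum.cong[OF refl], rule sum.swap)
    also have "\<dots> = recon x y ?F \<mu> \<epsilon>"
      by (simp add: recon_def sum_distrib_left sum_distrib_right mult_ac)
    finally show "f \<mu> \<epsilon> = recon x y ?F \<mu> \<epsilon>" .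
  qed
  then show ?thesis by (intro bexI[of _ ?F]) auto
qed

text \<open>
  Every function of the tensor space has a coefficient matrix, so the defect \<open>D\<close> of the coefficients is an
  admissible test function; testing with it gives \<open>frob (mass chi) D D = 0\<close>.
\<close>
theorem equilibrium_eq:
  assumes "is_equilibrium emax eta chi V f"
  shows "f = recon x y (outer u e)"
proof -
  have ue: "outer u e \<in> carrier_mat m n" by simp
  obtain F where F: "F \<in> carrier_mat m n" "f = recon x y F"
    using assms tensor_space_is_recon by (auto simp: is_equilibrium_def)
  define D where "D = outer u e - F"
  have D: "D \<in> carrier_mat m n" using F(1) by (simp add: D_def)
  have "frob (mass chi) D D = 0"
    using assms recon_in_tensor_space[OF D] Aform_recon[OF F(1) D]
    by (auto simp: is_equilibrium_def F(2) D_def)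
  then have "D = 0\<^sub>m m n" by (rule frob_definite[OF D _ C.nonneg chi_definite])
  then have "(outer u e) $$ (i, j) = F $$ (i, j)" if "i < m" "j < n" for i j
    using that carrier_matD[OF F(1)] index_minus_mat(1)[of i F j "outer u e"] by (simp add: D_def)
  then have "outer u e = F" using carrier_matD[OF F(1)] carrier_matD[OF ue] by (intro eq_matI) auto
  with F(2) show ?thesis by simp
qed

end

section \<open>From the scheme to coefficient identities\<close>

lemma row_mult:
  fixes B :: "real mat"
  assumes "B \<in> carrier_mat p q" "B' \<in> carrier_mat q l" "i < p"
  shows "row (B * B') i = transpose_mat B' *\<^sub>v row B i"
proof -
  have "row (B * B') i = col (transpose_mat (B * B')) i"
    by (rule col_transpose[symmetric]) (use assms in simp)
  also have "transpose_mat (B * B') = transpose_mat B' * transpose_mat B"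
    by (rule transpose_mult[OF assms(1,2)])
  also have "col \<dots> i = transpose_mat B' *\<^sub>v col (transpose_mat B) i"
    by (rule col_mult2[of _ l q _ p]) (use assms in simp_all)
  also have "col (transpose_mat B) i = row B i"
    by (rule col_transpose) (use assms in simp)
  finally show ?thesis .
qed

lemma weighted_norm_row:
  assumes Z: "Z \<in> carrier_mat 1 n" and M: "M \<in> carrier_mat n n"
  shows "weighted_norm M Z = sqrt (bilin M (row Z 0) (row Z 0))"
proof -
  have ZM: "Z * M \<in> carrier_mat 1 n" by (rule mult_carrier_mat[OF Z M])
  have ZMZ: "Z * M * transpose_mat Z \<in> carrier_mat 1 1"
    by (rule mult_carrier_mat[OF ZM]) (use Z in simp)
  have "mat_trace (Z * M * transpose_mat Z) = row (Z * M) 0 \<bullet> row Z 0"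
  proof -
    have "mat_trace (Z * M * transpose_mat Z) = (Z * M * transpose_mat Z) $$ (0, 0)"
      using carrier_matD[OF ZMZ] by (simp only: mat_trace_def) simp
    also have "\<dots> = row (Z * M) 0 \<bullet> col (transpose_mat Z) 0"
      by (rule index_mult_mat(1)) (use carrier_matD[OF ZM] carrier_matD[OF Z] in simp_all)
    also have "col (transpose_mat Z) 0 = row Z 0"
      by (rule col_transpose) (use carrier_matD[OF Z] in simp)
    finally show ?thesis .
  qed
  also have "\<dots> = (transpose_mat M *\<^sub>v row Z 0) \<bullet> row Z 0"
    by (subst row_mult[OF Z M]) simp_all
  also have "\<dots> = bilin M (row Z 0) (row Z 0)"
    unfolding bilin_def by (rule transpose_vec_mult_scalar[OF M]) (use Z in auto)
  finally show ?thesis by (simp add: weighted_norm_def)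
qed

lemma col_norm_eq_len:
  assumes "Z \<in> carrier_mat m 1"
  shows "col_norm Z = euclid.len m (col Z 0)"
proof -
  have c: "col Z 0 \<in> carrier_vec m" using assms by auto
  have "(\<Sum>i<dim_row Z. (Z $$ (i, 0))\<^sup>2) = col Z 0 \<bullet> col Z 0"
    using assms by (simp add: scalar_prod_def lessThan_atLeast0 power2_eq_square)
  then show ?thesis by (simp add: col_norm_def euclid.len_def bilin_one[OF c])
qed

lemma symmetric_inverse:
  fixes M B :: "real mat"
  assumes carr: "M \<in> carrier_mat p p" "B \<in> carrier_mat p p"
    and sym: "transpose_mat M = M" and inv: "M * B = 1\<^sub>m p"
  shows "transpose_mat B = B"
proof -
  have Bt: "transpose_mat B \<in> carrier_mat p p" using carr by simp
  have "transpose_mat B * M = 1\<^sub>m p"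
    using transpose_mult[OF carr] by (simp add: sym inv)
  then have "B = transpose_mat B * M * B" using carr by simp
  also have "\<dots> = transpose_mat B * (M * B)" by (rule assoc_mult_mat[OF Bt carr])
  also have "\<dots> = transpose_mat B" using Bt by (simp add: inv)
  finally show ?thesis ..
qed

lemma (in psd_form) len_smult:
  assumes "v \<in> carrier_vec n"
  shows "len (c \<cdot>\<^sub>v v) = \<bar>c\<bar> * len v"
proof -
  have "bilin M (c \<cdot>\<^sub>v v) (c \<cdot>\<^sub>v v) = c\<^sup>2 * bilin M v v"
    using assms by (simp add: bilin_linear[of _ n] power2_eq_square)
  then show ?thesis by (simp add: len_def real_sqrt_mult)
qed

context equivalent_forms
begin

text \<open>
  The two half steps bound the two products in \<open>outer_projection_error\<close>: the K-step the one with the residual of \<open>u\<close>,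
  the L-step the one with the residual of \<open>e\<close>.
\<close>
lemma dlr_step_error:
  fixes U0 S0 E0 K L U1 E1 RK RL S :: "real mat" and u e q' :: "real vec" and m r :: nat
  defines "F0 \<equiv> U0 * S0 * transpose_mat E0"
    and "G \<equiv> U1 * S * transpose_mat E1 - outer u e" and "D \<equiv> U0 * S0 * transpose_mat E0 - outer u e"
  assumes carr: "U0 \<in> carrier_mat m r" "S0 \<in> carrier_mat r r" "E0 \<in> carrier_mat n r"
      "U1 \<in> carrier_mat m r" "E1 \<in> carrier_mat n r" "RK \<in> carrier_mat r r" "RL \<in> carrier_mat r r"
      "S \<in> carrier_mat r r" "u \<in> carrier_vec m" "e \<in> carrier_vec n" "q' \<in> carrier_vec r"
    and pos: "0 \<le> dt" "0 < \<alpha>" "0 < \<beta>"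
    and factor: "K = U1 * RK" "L = E1 * RL"
    and orth: "transpose_mat U0 * U0 = 1\<^sub>m r" "transpose_mat U1 * U1 = 1\<^sub>m r"
      "transpose_mat E1 * A * E1 = 1\<^sub>m r"
    and proj: "\<And>b. b \<in> carrier_vec r \<Longrightarrow> bilin C (E0 *\<^sub>v q') (E0 *\<^sub>v b) = bilin C e (E0 *\<^sub>v b)"
    and alpha: "\<alpha> * A.len e \<le> A.len (E0 *\<^sub>v q')"
    and beta: "\<beta> * euclid.len m u \<le> euclid.len m (euclid.proj m U0 u)"
    and K_step: "\<And>z b. z \<in> carrier_vec m \<Longrightarrow> b \<in> carrier_vec r \<Longrightarrow>
      frob A (K * transpose_mat E0 - F0) (outer z (E0 *\<^sub>v b))
        = dt * frob C (outer u e - K * transpose_mat E0) (outer z (E0 *\<^sub>v b))"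
    and L_step: "\<And>w b. w \<in> carrier_vec n \<Longrightarrow> b \<in> carrier_vec r \<Longrightarrow>
      frob A (U0 * transpose_mat L - F0) (outer (U0 *\<^sub>v b) w)
        = dt * frob C (outer u e - U0 * transpose_mat L) (outer (U0 *\<^sub>v b) w)"
    and galerkin: "\<And>T. T \<in> carrier_mat r r \<Longrightarrow> frob A G (U1 * T * transpose_mat E1) = 0"
  shows "frob A G G \<le> ((sqrt (hi / lo) / (\<alpha> * (1 + dt * lo)))\<^sup>2 + (1 / (\<beta> * (1 + dt * lo)))\<^sup>2) * frob A D D"
proof -
  have D: "D \<in> carrier_mat m n" unfolding D_def using carr by simp
  have g: "0 < 1 + dt * lo" using pos lo by (simp add: add_pos_nonneg)
  let ?kK = "sqrt (hi / lo) / (\<alpha> * (1 + dt * lo))" and ?kL = "1 / (\<beta> * (1 + dt * lo))"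
  have orthU: "transpose_mat U1 * 1\<^sub>m m * U1 = 1\<^sub>m r"
    using orth(2) right_mult_one_mat[of "transpose_mat U1" r m] carr by simp
  have "euclid.len m (u - euclid.proj m U1 u) * A.len e \<le> ?kK * sqrt (frob A D D)"
    unfolding D_def
    by (rule K_step_estimate[where K = K and RK = RK and q' = q']) (fact carr pos factor orth proj alpha K_step[unfolded F0_def])+
  moreover have "euclid.len m u * A.len (e - A.proj E1 e) \<le> ?kL * sqrt (frob A D D)"
    unfolding D_def
    by (rule L_step_estimate[where L = L and RL = RL]) (fact carr pos factor orth beta L_step[unfolded F0_def])+
  moreover have "0 \<le> euclid.len m (u - euclid.proj m U1 u) * A.len e"
    using carr euclid.proj_carrier[OF carr(4) orthU carr(9)]
    by (intro mult_nonneg_nonneg euclid.len_nonneg A.len_nonneg) simp_all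
  moreover have "0 \<le> euclid.len m u * A.len (e - A.proj E1 e)"
    using carr A.proj_carrier[OF carr(5) orth(3) carr(10)]
    by (intro mult_nonneg_nonneg euclid.len_nonneg A.len_nonneg) simp_all
  ultimately have "(euclid.len m (u - euclid.proj m U1 u) * A.len e)\<^sup>2
      + (euclid.len m u * A.len (e - A.proj E1 e))\<^sup>2
      \<le> (?kK * sqrt (frob A D D))\<^sup>2 + (?kL * sqrt (frob A D D))\<^sup>2"
    by (intro add_mono power_mono)
  also have "\<dots> = (?kK\<^sup>2 + ?kL\<^sup>2) * frob A D D"
    using A.frob_nonneg[OF D] by (simp only: power_mult_distrib real_sqrt_pow2 distrib_right)
  finally have "(euclid.len m (u - euclid.proj m U1 u) * A.len e)\<^sup>2
      + (euclid.len m u * A.len (e - A.proj E1 e))\<^sup>2 \<le> (?kK\<^sup>2 + ?kL\<^sup>2) * frob A D D" .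
  moreover have "frob A G G \<le> (euclid.len m (u - euclid.proj m U1 u) * A.len e)\<^sup>2
      + (euclid.len m u * A.len (e - A.proj E1 e))\<^sup>2"
    unfolding G_def
    by (rule outer_projection_error[OF A.psd_form_axioms]) (fact carr orth galerkin[unfolded G_def])+
  ultimately show ?thesis by (rule order_trans[rotated])
qed

end

context dg_discretization
begin

lemma wnorm_recon_diff:
  assumes "F \<in> carrier_mat m n" "G \<in> carrier_mat m n"
  shows "wnorm emax (\<lambda>\<mu> \<epsilon>. recon x y F \<mu> \<epsilon> - recon x y G \<mu> \<epsilon>)
    = sqrt (frob (mass (\<lambda>_. 1)) (F - G) (F - G))"
  unfolding wnorm_def recon_diff[OF assms]
    weighted_inner_recon_one[OF minus_carrier_mat[OF assms(2), of F] minus_carrier_mat[OF assms(2), of F]] ..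

lemma euler_step_frob:
  assumes "euler_step emax eta chi dt W (recon x y F0) (recon x y F)" "0 < dt"
    and "F0 \<in> carrier_mat m n" "F \<in> carrier_mat m n" "G \<in> carrier_mat m n" "recon x y G \<in> W"
  shows "frob (mass (\<lambda>_. 1)) (F - F0) G = dt * frob (mass chi) (outer u e - F) G"
proof -
  have "1 / dt * weighted_inner emax (\<lambda>\<mu> \<epsilon>. recon x y F \<mu> \<epsilon> - recon x y F0 \<mu> \<epsilon>) (recon x y G)
      = Aform emax eta chi (recon x y F) (recon x y G)"
    using assms(1,6) by (simp add: euler_step_def)
  then have "1 / dt * frob (mass (\<lambda>_. 1)) (F - F0) G = frob (mass chi) (outer u e - F) G"
    unfolding recon_diff[OF assms(4,3)] Aform_recon[OF assms(4,5)]
      weighted_inner_recon_one[OF minus_carrier_mat[OF assms(3), of F] assms(5)] .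
  then show ?thesis using \<open>0 < dt\<close> by (simp add: field_simps)
qed

lemma K_step_frob:
  assumes "euler_step emax eta chi dt (space_K x y m r E) (recon x y F0) (recon x y (K * transpose_mat E))"
    and "0 < dt" "F0 \<in> carrier_mat m n" "K \<in> carrier_mat m r" "E \<in> carrier_mat n r"
    and "z \<in> carrier_vec m" "b \<in> carrier_vec r"
  shows "frob (mass (\<lambda>_. 1)) (K * transpose_mat E - F0) (outer z (E *\<^sub>v b))
    = dt * frob (mass chi) (outer u e - K * transpose_mat E) (outer z (E *\<^sub>v b))"
proof (rule euler_step_frob[OF assms(1-3)])
  show "recon x y (outer z (E *\<^sub>v b)) \<in> space_K x y m r E"
    unfolding space_K_def outer_mult_transpose[OF assms(5,7), symmetric]
    using outer_carrier[OF assms(6,7)] by blast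
  show "K * transpose_mat E \<in> carrier_mat m n"
    by (rule mult_carrier_mat[OF assms(4)]) (use assms(5) in simp)
  show "outer z (E *\<^sub>v b) \<in> carrier_mat m n"
    by (rule outer_carrier[OF assms(6) mult_mat_vec_carrier[OF assms(5,7)]])
qed

lemma L_step_frob:
  assumes "euler_step emax eta chi dt (space_L x y n r U) (recon x y F0) (recon x y (U * transpose_mat L))"
    and "0 < dt" "F0 \<in> carrier_mat m n" "L \<in> carrier_mat n r" "U \<in> carrier_mat m r"
    and "w \<in> carrier_vec n" "b \<in> carrier_vec r"
  shows "frob (mass (\<lambda>_. 1)) (U * transpose_mat L - F0) (outer (U *\<^sub>v b) w)
    = dt * frob (mass chi) (outer u e - U * transpose_mat L) (outer (U *\<^sub>v b) w)"
proof (rule euler_step_frob[OF assms(1-3)])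
  have "outer (U *\<^sub>v b) w = U * transpose_mat (outer w b)"
    by (simp only: transpose_outer mult_outer[OF assms(5,7)])
  then show "recon x y (outer (U *\<^sub>v b) w) \<in> space_L x y n r U"
    unfolding space_L_def
    by (intro CollectI exI[of _ "outer w b"]) (simp add: outer_carrier[OF assms(6,7)])
  show "U * transpose_mat L \<in> carrier_mat m n"
    by (rule mult_carrier_mat[OF assms(5)]) (use assms(4) in simp)
  show "outer (U *\<^sub>v b) w \<in> carrier_mat m n"
    by (rule outer_carrier[OF mult_mat_vec_carrier[OF assms(5,7)] assms(6)])
qed

lemma orth_projection_frob:
  assumes proj: "is_orth_projection emax (space_S x y r U E) (recon x y F) f"
    and F: "F \<in> carrier_mat m n" and U: "U \<in> carrier_mat m r" and E: "E \<in> carrier_mat n r"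
  obtains S where "S \<in> carrier_mat r r" "f = recon x y (U * S * transpose_mat E)"
    "\<And>T. T \<in> carrier_mat r r \<Longrightarrow>
      frob (mass (\<lambda>_. 1)) (U * S * transpose_mat E - F) (U * T * transpose_mat E) = 0"
proof -
  obtain S where S: "S \<in> carrier_mat r r" "f = recon x y (U * S * transpose_mat E)"
    using proj by (auto simp: is_orth_projection_def space_S_def)
  have carr: "U * T * transpose_mat E \<in> carrier_mat m n" if "T \<in> carrier_mat r r" for T
    by (rule mult_carrier_mat[OF mult_carrier_mat[OF U that]]) (use E in simp)
  have "frob (mass (\<lambda>_. 1)) (U * S * transpose_mat E - F) (U * T * transpose_mat E) = 0"
    if T: "T \<in> carrier_mat r r" for T
  proof -
    have "recon x y (U * T * transpose_mat E) \<in> space_S x y r U E"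
      unfolding space_S_def using T by blast
    then have "weighted_inner emax (\<lambda>\<mu> \<epsilon>. f \<mu> \<epsilon> - recon x y F \<mu> \<epsilon>) (recon x y (U * T * transpose_mat E)) = 0"
      using proj by (simp add: is_orth_projection_def)
    then show ?thesis
      unfolding S(2) recon_diff[OF carr[OF S(1)] F]
      by (simp only: weighted_inner_recon_one[OF minus_carrier_mat[OF F] carr[OF T]])
  qed
  with S show ?thesis by (rule that)
qed

text \<open>
  This is the hypothesis on \<open>\<beta>\<close> freed of its normalization. The length of \<open>u\<close> cannot vanish there: division by zero
  would make the normalized vector zero, contradicting \<open>0 < \<beta>\<close>.
\<close>
lemma len_proj_lower_bound:
  assumes U: "U \<in> carrier_mat m r" and orth: "transpose_mat U * U = 1\<^sub>m r" and "0 < \<beta>"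
    and beta: "\<beta> \<le> col_norm (proj_U U * ((1 / col_norm (load_mu m x)) \<cdot>\<^sub>m load_mu m x))"
  shows "\<beta> * euclid.len m u \<le> euclid.len m (euclid.proj m U u)"
proof -
  have L0: "load_mu m x \<in> carrier_mat m 1" "col (load_mu m x) 0 = u"
    by (auto simp: load_mu_def u_def)
  have N: "col_norm (load_mu m x) = euclid.len m u" using col_norm_eq_len[OF L0(1)] L0(2) by simp
  let ?N = "euclid.len m u"
  have Ut: "transpose_mat U \<in> carrier_mat r m" using U by simp
  have P: "proj_U U \<in> carrier_mat m m" unfolding proj_U_def by (rule mult_carrier_mat[OF U Ut])
  have smult: "(1 / ?N) \<cdot>\<^sub>m load_mu m x \<in> carrier_mat m 1" using L0 by simp
  have orth': "transpose_mat U * 1\<^sub>m m * U = 1\<^sub>m r" using orth right_mult_one_mat[OF Ut] by simp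
  have proj: "euclid.proj m U u = proj_U U *\<^sub>v u"
    using assoc_mult_mat_vec[OF U Ut u_carrier] by (simp add: euclid.proj_def proj_U_def)
  have "col (proj_U U * ((1 / ?N) \<cdot>\<^sub>m load_mu m x)) 0 = proj_U U *\<^sub>v col ((1 / ?N) \<cdot>\<^sub>m load_mu m x) 0"
    by (rule col_mult2[OF P smult]) simp
  also have "col ((1 / ?N) \<cdot>\<^sub>m load_mu m x) 0 = (1 / ?N) \<cdot>\<^sub>v u"
    using L0 by (simp add: load_mu_def u_def)
  also have "proj_U U *\<^sub>v \<dots> = (1 / ?N) \<cdot>\<^sub>v euclid.proj m U u"
    unfolding proj by (rule mult_mat_vec[OF P u_carrier])
  finally have "col_norm (proj_U U * ((1 / ?N) \<cdot>\<^sub>m load_mu m x)) = \<bar>1 / ?N\<bar> * euclid.len m (euclid.proj m U u)"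
    using col_norm_eq_len[OF mult_carrier_mat[OF P smult]]
      euclid.len_smult[OF euclid.proj_carrier[OF U orth' u_carrier]] by simp
  then have "\<beta> \<le> \<bar>1 / ?N\<bar> * euclid.len m (euclid.proj m U u)" using beta N by simp
  moreover have "0 \<le> ?N" by (simp add: euclid.len_nonneg)
  ultimately show ?thesis using \<open>0 < \<beta>\<close> by (cases "?N = 0") (auto simp: field_simps)
qed

text \<open>
  With \<open>M = E\<^sup>T C E\<close> the vector \<open>E q'\<close> for \<open>q' = M\<^sup>-\<^sup>1 E\<^sup>T C e\<close> is the \<open>C\<close>-projection of \<open>e\<close> onto the columns of \<open>E\<close>. Up to the
  normalization of \<open>e\<close> it is the single row of the matrix in the hypothesis on \<open>\<alpha>\<close>; to transpose that row,
  the symmetry of the two inverse matrices is used.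
\<close>
lemma chi_projection_of_equilibrium:
  assumes E: "E \<in> carrier_mat n r" and orth: "transpose_mat E * mass (\<lambda>_. 1) * E = 1\<^sub>m r" and "0 < \<alpha>"
    and alpha: "\<alpha> \<le> weighted_norm (mass (\<lambda>_. 1)) (transpose_mat
       ((1 / weighted_norm (mass (\<lambda>_. 1)) (transpose_mat (load_eps emax n y eta) * mat_inv (mass chi)))
          \<cdot>\<^sub>m (mat_inv (mass chi) * load_eps emax n y eta)) * mass chi * proj_E_chi (mass chi) E)"
  obtains q' where "q' \<in> carrier_vec r"
    "\<And>b. b \<in> carrier_vec r \<Longrightarrow> bilin (mass chi) (E *\<^sub>v q') (E *\<^sub>v b) = bilin (mass chi) e (E *\<^sub>v b)"
    "\<alpha> * A.len e \<le> A.len (E *\<^sub>v q')"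
proof -
  let ?A = "mass (\<lambda>_. 1)" and ?C = "mass chi" and ?l = "load_eps emax n y eta"
  let ?Ci = "mat_inv ?C"
  note Ci = chi_inverse(1)
  have l: "?l \<in> carrier_mat n 1" "col ?l 0 = load_vec"
    by (auto simp: load_eps_def load_vec_def)
  have Et: "transpose_mat E \<in> carrier_mat r n" using E by simp
  define M where "M = transpose_mat E * ?C * E"
  have EC: "transpose_mat E * ?C \<in> carrier_mat r n" by (rule mult_carrier_mat[OF Et mass_carrier])
  have M: "M \<in> carrier_mat r r" unfolding M_def by (rule mult_carrier_mat[OF EC E])
  have M_vec: "M *\<^sub>v b = transpose_mat E *\<^sub>v (?C *\<^sub>v (E *\<^sub>v b))" if "b \<in> carrier_vec r" for b
    unfolding M_def assoc_mult_mat_vec[OF EC E that]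
    by (rule assoc_mult_mat_vec[OF Et mass_carrier mult_mat_vec_carrier[OF E that]])
  have move: "bilin ?C (E *\<^sub>v b) v = b \<bullet> (transpose_mat E *\<^sub>v (?C *\<^sub>v v))"
    if "b \<in> carrier_vec r" "v \<in> carrier_vec n" for b v
    unfolding bilin_def by (rule mult_scalar_transpose[OF E that(1) C.mult_carrier[OF that(2)]])
  have M_def0: "b = 0\<^sub>v r" if b: "b \<in> carrier_vec r" and "bilin M b b = 0" for b
  proof -
    have Eb: "E *\<^sub>v b \<in> carrier_vec n" by (rule mult_mat_vec_carrier[OF E b])
    have "bilin ?C (E *\<^sub>v b) (E *\<^sub>v b) = 0"
      using move[OF b Eb] M_vec[OF b] that(2) by (simp add: bilin_def)
    then have "E *\<^sub>v b = 0\<^sub>v n" by (rule chi_definite[OF Eb])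
    \<comment> \<open>\<open>E\<close> has \<open>A\<close>-orthonormal columns and is therefore injective.\<close>
    then have "bilin ?A (E *\<^sub>v b) (E *\<^sub>v c) = 0" if "c \<in> carrier_vec r" for c
      using A.mult_carrier[OF mult_mat_vec_carrier[OF E that]]
      by (simp add: bilin_def scalar_prod_left_zero[of _ n])
    then have z: "b \<bullet> c = 0" if "c \<in> carrier_vec r" for c
      using A.bilin_range[OF E orth b that] that by simp
    show ?thesis
    proof (rule eq_vecI)
      fix i assume "i < dim_vec (0\<^sub>v r)"
      then show "b $ i = 0\<^sub>v r $ i" using z[of "unit_vec r i"] b by (simp add: scalar_prod_right_unit[of i r])
    qed (use b in simp)
  qed
  note Mi = definite_mat_inv[OF M M_def0]
  have M_sym: "transpose_mat M = M"
  proof -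
    have "transpose_mat M = transpose_mat E * transpose_mat (transpose_mat E * ?C)"
      unfolding M_def by (rule transpose_mult[OF EC E])
    also have "transpose_mat (transpose_mat E * ?C) = ?C * E"
      using transpose_mult[OF Et mass_carrier[of chi]] by (simp add: mass_symmetric)
    also have "transpose_mat E * (?C * E) = M"
      unfolding M_def by (rule assoc_mult_mat[OF Et mass_carrier E, symmetric])
    finally show ?thesis .
  qed
  have Mi_sym: "transpose_mat (mat_inv M) = mat_inv M" by (rule symmetric_inverse[OF M Mi(1) M_sym Mi(2)])
  have Ci_sym: "transpose_mat ?Ci = ?Ci"
    by (rule symmetric_inverse[OF mass_carrier Ci mass_symmetric chi_inverse(2)])
  define q' where "q' = mat_inv M *\<^sub>v (transpose_mat E *\<^sub>v (?C *\<^sub>v e))"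
  have Ee: "transpose_mat E *\<^sub>v (?C *\<^sub>v e) \<in> carrier_vec r"
    by (rule mult_mat_vec_carrier[OF Et C.mult_carrier[OF e_carrier]])
  have q': "q' \<in> carrier_vec r" unfolding q'_def by (rule mult_mat_vec_carrier[OF Mi(1) Ee])
  have Eq: "E *\<^sub>v q' \<in> carrier_vec n" by (rule mult_mat_vec_carrier[OF E q'])
  have Mq: "M *\<^sub>v q' = transpose_mat E *\<^sub>v (?C *\<^sub>v e)"
    using assoc_mult_mat_vec[OF M Mi(1) Ee] Mi(2) Ee by (simp add: q'_def)
  have "bilin ?C (E *\<^sub>v q') (E *\<^sub>v b) = bilin ?C e (E *\<^sub>v b)" if b: "b \<in> carrier_vec r" for b
  proof -
    have Eb: "E *\<^sub>v b \<in> carrier_vec n" by (rule mult_mat_vec_carrier[OF E b])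
    have "bilin ?C (E *\<^sub>v q') (E *\<^sub>v b) = bilin ?C (E *\<^sub>v b) (E *\<^sub>v q')" by (rule C.commute[OF Eq Eb])
    also have "\<dots> = bilin ?C (E *\<^sub>v b) e"
      using move[OF b Eq] move[OF b e_carrier] M_vec[OF q'] Mq by simp
    also have "\<dots> = bilin ?C e (E *\<^sub>v b)" by (rule C.commute[OF Eb e_carrier])
    finally show ?thesis .
  qed
  moreover have "\<alpha> * A.len e \<le> A.len (E *\<^sub>v q')"
  proof -
    let ?N = "A.len e"
    have lt: "transpose_mat ?l \<in> carrier_mat 1 n" using l by simp
    have row_lt: "row (transpose_mat ?l) 0 = load_vec" using l row_transpose[of 0 ?l] by simp
    have "row (transpose_mat ?l * ?Ci) 0 = e"
      using row_mult[OF lt Ci, of 0] by (simp add: row_lt Ci_sym e_def)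
    then have N: "weighted_norm ?A (transpose_mat ?l * ?Ci) = ?N"
      using weighted_norm_row[OF mult_carrier_mat[OF lt Ci] mass_carrier] by (simp add: A.len_def)
    define W where "W = (1 / ?N) \<cdot>\<^sub>m (?Ci * ?l)"
    have Cil: "?Ci * ?l \<in> carrier_mat n 1" by (rule mult_carrier_mat[OF Ci l(1)])
    have W: "W \<in> carrier_mat n 1" "transpose_mat W \<in> carrier_mat 1 n" using Cil by (simp_all add: W_def)
    have "col (?Ci * ?l) 0 = e" using col_mult2[OF Ci l(1), of 0] by (simp add: l(2) e_def)
    then have row_W: "row (transpose_mat W) 0 = (1 / ?N) \<cdot>\<^sub>v e"
      using W(1) Cil row_transpose[of 0 W] by (auto simp: W_def)
    have WC: "transpose_mat W * ?C \<in> carrier_mat 1 n" by (rule mult_carrier_mat[OF W(2) mass_carrier])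
    have EM: "E * mat_inv M \<in> carrier_mat n r" by (rule mult_carrier_mat[OF E Mi(1)])
    have P: "proj_E_chi ?C E \<in> carrier_mat n n"
      unfolding proj_E_chi_def M_def[symmetric] by (rule mult_carrier_mat[OF EM Et])
    have P_sym: "transpose_mat (proj_E_chi ?C E) = E * mat_inv M * transpose_mat E"
    proof -
      have "transpose_mat (proj_E_chi ?C E) = E * transpose_mat (E * mat_inv M)"
        using transpose_mult[OF EM Et] by (simp add: proj_E_chi_def M_def[symmetric])
      also have "transpose_mat (E * mat_inv M) = mat_inv M * transpose_mat E"
        using transpose_mult[OF E Mi(1)] by (simp add: Mi_sym)
      finally show ?thesis by (simp only: assoc_mult_mat[OF E Mi(1) Et])
    qed
    have Ce: "?C *\<^sub>v ((1 / ?N) \<cdot>\<^sub>v e) = (1 / ?N) \<cdot>\<^sub>v (?C *\<^sub>v e)"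
      by (rule mult_mat_vec[OF mass_carrier e_carrier])
    have "row (transpose_mat W * ?C * proj_E_chi ?C E) 0
        = transpose_mat (proj_E_chi ?C E) *\<^sub>v ((1 / ?N) \<cdot>\<^sub>v (?C *\<^sub>v e))"
      using row_mult[OF WC P, of 0] row_mult[OF W(2) mass_carrier, of 0 chi]
      by (simp add: row_W mass_symmetric Ce)
    also have "\<dots> = (1 / ?N) \<cdot>\<^sub>v ((E * mat_inv M * transpose_mat E) *\<^sub>v (?C *\<^sub>v e))"
      unfolding P_sym by (rule mult_mat_vec[OF mult_carrier_mat[OF EM Et] C.mult_carrier[OF e_carrier]])
    also have "(E * mat_inv M * transpose_mat E) *\<^sub>v (?C *\<^sub>v e) = E *\<^sub>v q'"
      unfolding q'_def assoc_mult_mat_vec[OF EM Et C.mult_carrier[OF e_carrier]]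
      by (rule assoc_mult_mat_vec[OF E Mi(1) Ee])
    finally have "weighted_norm ?A (transpose_mat W * ?C * proj_E_chi ?C E) = A.len ((1 / ?N) \<cdot>\<^sub>v (E *\<^sub>v q'))"
      using weighted_norm_row[OF mult_carrier_mat[OF WC P] mass_carrier] by (simp add: A.len_def)
    then have "\<alpha> \<le> \<bar>1 / ?N\<bar> * A.len (E *\<^sub>v q')"
      using alpha by (simp add: A.len_smult[OF Eq] N W_def)
    moreover have "0 \<le> ?N" by (simp add: A.len_nonneg)
    ultimately show ?thesis using \<open>0 < \<alpha>\<close> by (cases "?N = 0") (auto simp: field_simps)
  qed
  ultimately show ?thesis using q' that by blast
qed

end

section \<open>Convergence towards equilibrium in one step\<close>

text \<open>
  Both terms have the form \<open>(s / (1 + dt lo))\<^sup>2\<close>, and the threshold bounds \<open>dt\<close> below by \<open>sqrt 2 s / (\<delta> lo)\<close>,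
  with \<open>s = sqrt (hi / lo) / \<alpha>\<close> and \<open>s = 1 / \<beta>\<close>.
\<close>
lemma step_size_suffices:
  fixes lo hi dt \<alpha> \<beta> \<delta> :: real and r :: nat
  assumes pos: "0 < lo" "lo \<le> hi" "0 < \<alpha>" "0 < \<beta>" "0 < \<delta>" "1 \<le> r"
    and dt: "dt \<ge> sqrt 2 / \<delta> * max (real r powr (1/2) / (\<beta> * lo))
      (real r powr (1/2) * hi powr (1/2) / (\<alpha> * lo powr (3/2)))"
  shows "(sqrt (hi / lo) / (\<alpha> * (1 + dt * lo)))\<^sup>2 + (1 / (\<beta> * (1 + dt * lo)))\<^sup>2 \<le> \<delta>\<^sup>2"
proof -
  have *: "(s / (1 + dt * lo))\<^sup>2 \<le> \<delta>\<^sup>2 / 2"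
    if s: "0 \<le> s" and le: "sqrt 2 / \<delta> * (real r powr (1/2) * (s / lo)) \<le> dt" for s
  proof -
    have "1 \<le> real r powr (1/2)" using pos by (simp add: powr_half_sqrt)
    then have "1 * (s / lo) \<le> real r powr (1/2) * (s / lo)"
      using s pos by (intro mult_right_mono) auto
    then have "sqrt 2 / \<delta> * (s / lo) \<le> sqrt 2 / \<delta> * (real r powr (1/2) * (s / lo))"
      using pos by (intro mult_left_mono) auto
    with le have "sqrt 2 / \<delta> * (s / lo) \<le> dt" by linarith
    then have le': "sqrt 2 * s \<le> \<delta> * (dt * lo)" using pos by (simp add: field_simps)
    have "0 \<le> sqrt 2 / \<delta> * (s / lo)" using s pos by simp
    with \<open>sqrt 2 / \<delta> * (s / lo) \<le> dt\<close> have "0 \<le> dt" by linarith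
    then have g: "0 < 1 + dt * lo" using pos by (simp add: add_pos_nonneg)
    have "sqrt 2 * s \<le> \<delta> * (1 + dt * lo)" using le' pos by (simp add: algebra_simps)
    then have "sqrt 2 * (s / (1 + dt * lo)) \<le> \<delta>" using g by (simp add: field_simps)
    then have "(sqrt 2 * (s / (1 + dt * lo)))\<^sup>2 \<le> \<delta>\<^sup>2"
      using s g by (intro power_mono) auto
    then have "2 * (s / (1 + dt * lo))\<^sup>2 \<le> \<delta>\<^sup>2" by (simp only: power_mult_distrib) simp
    then show ?thesis by simp
  qed
  have fac: "0 \<le> sqrt 2 / \<delta>" using pos by simp
  have "sqrt 2 / \<delta> * (real r powr (1/2) * (1 / \<beta> / lo)) \<le> dt"
    using order_trans[OF mult_left_mono[OF max.cobounded1 fac] dt] by simp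
  from *[OF _ this] have 1: "(1 / \<beta> / (1 + dt * lo))\<^sup>2 \<le> \<delta>\<^sup>2 / 2" using pos by simp
  have "lo powr (3/2) = lo powr 1 * lo powr (1/2)" by (subst powr_add[symmetric]) simp
  then have "hi powr (1/2) / (\<alpha> * lo powr (3/2)) = sqrt (hi / lo) / \<alpha> / lo"
    using pos by (simp add: powr_half_sqrt real_sqrt_divide field_simps)
  then have "sqrt 2 / \<delta> * (real r powr (1/2) * (sqrt (hi / lo) / \<alpha> / lo)) \<le> dt"
    using order_trans[OF mult_left_mono[OF max.cobounded2 fac] dt] by (simp flip: times_divide_eq_right)
  from *[OF _ this] have 2: "(sqrt (hi / lo) / \<alpha> / (1 + dt * lo))\<^sup>2 \<le> \<delta>\<^sup>2 / 2" using pos by simp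
  from 1 2 show ?thesis by simp
qed

lemma eq_of_minus_eq_zero_mat:
  fixes F G :: "real mat"
  assumes F: "F \<in> carrier_mat p q" and G: "G \<in> carrier_mat p q" and "F - G = 0\<^sub>m p q"
  shows "F = G"
proof (rule eq_matI)
  fix i j assume ij: "i < dim_row G" "j < dim_col G"
  have "(F - G) $$ (i, j) = 0" using assms(3) ij G by simp
  then show "F $$ (i, j) = G $$ (i, j)" using ij by simp
qed (use F G in auto)

theorem lemma4p8:
  fixes emax chimin chimax \<Delta>t \<alpha> \<beta> :: real
    and eta chi :: "real \<Rightarrow> real"
    and k N\<mu> N\<epsilon> m n r :: nat
    and s t :: "nat \<Rightarrow> real"
    and x y :: "nat \<Rightarrow> real \<Rightarrow> real"
    and A1 Achi L0 Leta Ueq Eeq :: "real mat"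
    and U0 S0 E0 K L U1 E1 RK RL :: "real mat"
    and feq fhat fSeq :: "real \<Rightarrow> real \<Rightarrow> real"
  assumes emax: "emax > 0"
    and eta_pos: "\<And>\<epsilon>. \<epsilon> \<in> {0..emax} \<Longrightarrow> eta \<epsilon> > 0"
    and eta_meas: "set_borel_measurable lebesgue {0..emax} eta"
    and eta_L2: "set_integrable lebesgue {0..emax} (\<lambda>\<epsilon>. (eta \<epsilon>)\<^sup>2 * \<epsilon>\<^sup>2)"
    and chi_meas: "set_borel_measurable lebesgue {0..emax} chi"
    and chi_min: "chimin > 0"
    and chi_bounds: "\<And>\<epsilon>. \<epsilon> \<in> {0..emax} \<Longrightarrow> chimin \<le> chi \<epsilon> \<and> chi \<epsilon> \<le> chimax"
    and part_mu: "is_partition (-1) 1 N\<mu> s"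
    and part_eps: "is_partition 0 emax N\<epsilon> t"
    and m_def: "m = (k + 1) * N\<mu>" and n_def: "n = (k + 1) * N\<epsilon>"
    and r: "1 \<le> r" "r \<le> min m n"
    and x_def: "x = legendre_basis k N\<mu> s" and y_def: "y = legendre_basis k N\<epsilon> t"
    and A1_def: "A1 = mass_mat emax n y (\<lambda>_. 1)" and Achi_def: "Achi = mass_mat emax n y chi"
    and L0_def: "L0 = load_mu m x" and Leta_def: "Leta = load_eps emax n y eta"
    and Ueq_def: "Ueq = (1 / col_norm L0) \<cdot>\<^sub>m L0"
    and Eeq_def: "Eeq = (1 / weighted_norm A1 (transpose_mat Leta * mat_inv Achi)) \<cdot>\<^sub>m (mat_inv Achi * Leta)"
    and feq: "is_equilibrium emax eta chi (tensor_space (dg_space k N\<mu> s) (dg_space k N\<epsilon> t)) feq"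
    and carriers_n: "U0 \<in> carrier_mat m r" "S0 \<in> carrier_mat r r" "E0 \<in> carrier_mat n r"
    and orth_n: "transpose_mat U0 * U0 = 1\<^sub>m r" "transpose_mat E0 * A1 * E0 = 1\<^sub>m r"
    and fhat: "fhat = recon x y (U0 * S0 * transpose_mat E0)"
    and dt: "\<Delta>t > 0"
    and carriers_KL: "K \<in> carrier_mat m r" "L \<in> carrier_mat n r"
    and K_step: "euler_step emax eta chi \<Delta>t (space_K x y m r E0) fhat (recon x y (K * transpose_mat E0))"
    and L_step: "euler_step emax eta chi \<Delta>t (space_L x y n r U0) fhat (recon x y (U0 * transpose_mat L))"
    and carriers_n1: "U1 \<in> carrier_mat m r" "E1 \<in> carrier_mat n r"
      "RK \<in> carrier_mat r r" "RL \<in> carrier_mat r r"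
    and factor: "K = U1 * RK" "L = E1 * RL"
    and orth_n1: "transpose_mat U1 * U1 = 1\<^sub>m r" "transpose_mat E1 * A1 * E1 = 1\<^sub>m r"
    and fSeq: "is_orth_projection emax (space_S x y r U1 E1) feq fSeq"
    and beta: "0 < \<beta>" "\<beta> \<le> 1" "col_norm (proj_U U0 * Ueq) \<ge> \<beta>"
    and alpha: "\<alpha> > 0" "weighted_norm A1 (transpose_mat Eeq * Achi * proj_E_chi Achi E0) \<ge> \<alpha>"
  shows "(\<forall>\<delta>>0.
            \<Delta>t \<ge> sqrt 2 / \<delta> * max (real r powr (1/2) / (\<beta> * chimin))
                   (real r powr (1/2) * chimax powr (1/2) / (\<alpha> * chimin powr (3/2)))
            \<longrightarrow> wnorm emax (\<lambda>\<mu> \<epsilon>. fSeq \<mu> \<epsilon> - feq \<mu> \<epsilon>)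
                \<le> \<delta> * wnorm emax (\<lambda>\<mu> \<epsilon>. fhat \<mu> \<epsilon> - feq \<mu> \<epsilon>))
         \<and> (fhat = feq \<longrightarrow> fSeq = feq)"
proof -
  interpret D: dg_discretization emax chimin chimax eta chi k N\<mu> N\<epsilon> s t
    by unfold_locales (fact emax eta_meas eta_L2 chi_meas chi_min chi_bounds part_mu part_eps)+
  have mn: "m = D.m" "n = D.n" and xy: "x = D.x" "y = D.y"
    by (simp_all add: m_def n_def x_def y_def D.m_def D.n_def D.x_def D.y_def)
  have A1: "A1 = D.mass (\<lambda>_. 1)" and Achi: "Achi = D.mass chi"
    by (simp_all add: A1_def Achi_def mn xy)
  note cn = carriers_n[unfolded mn] and cn1 = carriers_n1[unfolded mn] and cKL = carriers_KL[unfolded mn]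
  define F0 where "F0 = U0 * S0 * transpose_mat E0"
  define Feq where "Feq = outer D.u D.e"
  have F0: "F0 \<in> carrier_mat D.m D.n"
    unfolding F0_def by (rule mult_carrier_mat[OF mult_carrier_mat[OF cn(1,2)]]) (use cn(3) in simp)
  have Feq: "Feq \<in> carrier_mat D.m D.n" by (simp add: Feq_def)
  have fhat_eq: "fhat = recon D.x D.y F0" by (simp add: fhat F0_def xy)
  have feq_eq: "feq = recon D.x D.y Feq" unfolding Feq_def by (rule D.equilibrium_eq[OF feq])
  obtain S where S: "S \<in> carrier_mat r r" "fSeq = recon D.x D.y (U1 * S * transpose_mat E1)"
    and galerkin: "\<And>T. T \<in> carrier_mat r r \<Longrightarrow>
      frob (D.mass (\<lambda>_. 1)) (U1 * S * transpose_mat E1 - Feq) (U1 * T * transpose_mat E1) = 0"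
    using D.orth_projection_frob[OF fSeq[unfolded xy feq_eq] Feq cn1(1,2)] by blast
  have FS: "U1 * S * transpose_mat E1 \<in> carrier_mat D.m D.n"
    by (rule mult_carrier_mat[OF mult_carrier_mat[OF cn1(1) S(1)]]) (use cn1(2) in simp)
  obtain q' where q': "q' \<in> carrier_vec r"
    "\<And>b. b \<in> carrier_vec r \<Longrightarrow>
       bilin (D.mass chi) (E0 *\<^sub>v q') (E0 *\<^sub>v b) = bilin (D.mass chi) D.e (E0 *\<^sub>v b)"
    "\<alpha> * D.A.len D.e \<le> D.A.len (E0 *\<^sub>v q')"
    using D.chi_projection_of_equilibrium[OF cn(3) orth_n(2)[unfolded A1] alpha(1)
        alpha(2)[unfolded Eeq_def Leta_def A1 Achi mn xy]] by blast
  have beta': "\<beta> * euclid.len D.m D.u \<le> euclid.len D.m (euclid.proj D.m U0 D.u)"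
    by (rule D.len_proj_lower_bound[OF cn(1) orth_n(1) beta(1) beta(3)[unfolded Ueq_def L0_def mn xy]])
  define err where "err = frob (D.mass (\<lambda>_. 1)) (U1 * S * transpose_mat E1 - Feq) (U1 * S * transpose_mat E1 - Feq)"
  define err0 where "err0 = frob (D.mass (\<lambda>_. 1)) (F0 - Feq) (F0 - Feq)"
  let ?\<kappa> = "(sqrt (chimax / chimin) / (\<alpha> * (1 + \<Delta>t * chimin)))\<^sup>2 + (1 / (\<beta> * (1 + \<Delta>t * chimin)))\<^sup>2"
  have bound: "err \<le> ?\<kappa> * err0"
    unfolding err_def err0_def F0_def Feq_def
  proof (rule D.dlr_step_error)
    show "frob (D.mass (\<lambda>_. 1)) (K * transpose_mat E0 - U0 * S0 * transpose_mat E0) (outer z (E0 *\<^sub>v b))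
        = \<Delta>t * frob (D.mass chi) (outer D.u D.e - K * transpose_mat E0) (outer z (E0 *\<^sub>v b))"
      if "z \<in> carrier_vec D.m" "b \<in> carrier_vec r" for z b
      using D.K_step_frob[OF _ dt F0 cKL(1) cn(3) that] K_step
      by (simp add: fhat_eq F0_def mn xy)
    show "frob (D.mass (\<lambda>_. 1)) (U0 * transpose_mat L - U0 * S0 * transpose_mat E0) (outer (U0 *\<^sub>v b) w)
        = \<Delta>t * frob (D.mass chi) (outer D.u D.e - U0 * transpose_mat L) (outer (U0 *\<^sub>v b) w)"
      if "w \<in> carrier_vec D.n" "b \<in> carrier_vec r" for w b
      using D.L_step_frob[OF _ dt F0 cKL(2) cn(1) that] L_step
      by (simp add: fhat_eq F0_def mn xy)
  qed (use cn cn1 S q' dt alpha(1) beta(1) beta' factor orth_n(1) orth_n1[unfolded A1] galerkin Feq_def in simp_all)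
  have err_norm: "wnorm emax (\<lambda>\<mu> \<epsilon>. fSeq \<mu> \<epsilon> - feq \<mu> \<epsilon>) = sqrt err"
    unfolding S(2) feq_eq err_def by (rule D.wnorm_recon_diff[OF FS Feq])
  have err0_norm: "wnorm emax (\<lambda>\<mu> \<epsilon>. fhat \<mu> \<epsilon> - feq \<mu> \<epsilon>) = sqrt err0"
    unfolding fhat_eq feq_eq err0_def by (rule D.wnorm_recon_diff[OF F0 Feq])
  have err0_nonneg: "0 \<le> err0" unfolding err0_def by (rule D.A.frob_nonneg[OF minus_carrier_mat[OF Feq]])
  have err_nonneg: "0 \<le> err" unfolding err_def by (rule D.A.frob_nonneg[OF minus_carrier_mat[OF Feq]])
  show ?thesis
  proof (intro conjI allI impI)
    fix \<delta> :: real
    assume \<delta>: "0 < \<delta>" and "\<Delta>t \<ge> sqrt 2 / \<delta> * max (real r powr (1/2) / (\<beta> * chimin))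
      (real r powr (1/2) * chimax powr (1/2) / (\<alpha> * chimin powr (3/2)))"
    then have "?\<kappa> \<le> \<delta>\<^sup>2"
      by (intro step_size_suffices[OF D.lo D.lo_le_hi alpha(1) beta(1) \<delta> r(1)])
    then have "err \<le> \<delta>\<^sup>2 * err0"
      using bound err0_nonneg by (meson mult_right_mono order_trans)
    then have "sqrt err \<le> sqrt (\<delta>\<^sup>2 * err0)" by (rule real_sqrt_le_mono)
    then show "wnorm emax (\<lambda>\<mu> \<epsilon>. fSeq \<mu> \<epsilon> - feq \<mu> \<epsilon>)
        \<le> \<delta> * wnorm emax (\<lambda>\<mu> \<epsilon>. fhat \<mu> \<epsilon> - feq \<mu> \<epsilon>)"
      unfolding err_norm err0_norm using \<delta> by (simp add: real_sqrt_mult)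
  next
    assume "fhat = feq"
    then have "sqrt err0 = 0" by (simp add: wnorm_def weighted_inner_def flip: err0_norm)
    then have "err = 0" using bound err_nonneg by simp
    \<comment> \<open>Equality of the functions, not only of their classes modulo null sets, comes from equal coefficients.\<close>
    then have "U1 * S * transpose_mat E1 - Feq = 0\<^sub>m D.m D.n"
      unfolding err_def
      by (rule frob_definite[OF minus_carrier_mat[OF Feq] _ D.mass_one_nonneg D.mass_one_definite])
    then have "U1 * S * transpose_mat E1 = Feq"
      by (rule eq_of_minus_eq_zero_mat[OF FS Feq])
    then show "fSeq = feq" by (simp add: S(2) feq_eq)
  qed
qed

end
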